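(* Under the standing assumptions stated in the context, there exists a solution to the linear programming problem for the single agent, i.e. there exists $(\mu^\star,m^\star)\in\mathcal R$ such that $\Gamma(\mu^\star,m^\star)=\sup_{(\mu,m)\in\mathcal R}\Gamma(\mu,m)$.
   Context: **Notation.** $T>0$; $\mathcal O\subset\mathbb R$ is open with closure $\bar{\mathcal O}$; $A\subset\mathbb R$ is nonempty and compact. $\mathcal P(E)$ denotes the Borel probability measures on $E$. $C_b^{1,2}([0,T]\times\bar{\mathcal O})$ is the set of $u\in C_b([0,T]\times\bar{\mathcal O})$ with $\partial_tu,\partial_xu,\partial_{xx}u\in C_b([0,T]\times\bar{\mathcal O})$. $V$ is the set of families $m=(m_t)_{t\in[0,T]}$ (identified when equal for $dt$-a.e. $t$) of finite Borel measures on $\bar{\mathcal O}\times A$, positive for a.e. $t$, with $t\mapsto m_t(B)$ measurable for every Borel $B$ and $\int_0^Tm_t(\bar{\mathcal O}\times A)dt<\infty$. $\mathcal S$ is the set of bounded measurable $h:[0,T]\times\bar{\mathcal O}\times A\to\mathbb R$ with $h(t,\cdot)$ continuous on $\bar{\mathcal O}\times A$ for each $t$. **Standing assumptions.** (1) $b:[0,T]\times\mathbb R\times A\to\mathbb R$ and $\sigma:[0,T]\times\mathbb R\times A\to\mathbb R_+$ are measurable, bounded, and Lipschitz in $x$ uniformly in $(t,a)$. (2) The restrictions of $b$ and $\sigma$ to $[0,T]\times\bar{\mathcal O}\times A$ are in $\mathcal S$. (3) $f:[0,T]\times\bar{\mathcal O}\times A\to\mathbb R$ is measurable, bounded, and $f(t,\cdot)$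 is upper semicontinuous for each $t$; $g:[0,T]\times\bar{\mathcal O}\to\mathbb R$ is upper semicontinuous and bounded from above. (4) $m_0^*\in\mathcal P(\mathcal O)$ satisfies $\int_{\mathcal O}\ln(1+|x|)m_0^*(dx)<\infty$. **LP problem.** $\mathcal Lu(t,x,a)=b(t,x,a)\partial_xu(t,x)+\frac{\sigma^2}{2}(t,x,a)\partial_{xx}u(t,x)$. $\mathcal R$ is the set of $(\mu,m)\in\mathcal P([0,T]\times\bar{\mathcal O})\times V$ such that for all $u\in C_b^{1,2}([0,T]\times\bar{\mathcal O})$, $$\int_{[0,T]\times\bar{\mathcal O}}u\,d\mu=\int_{\mathcal O}u(0,x)m_0^*(dx)+\int_0^T\int_{\bar{\mathcal O}\times A}\Big(\frac{\partial u}{\partial t}+\mathcal Lu\Big)(t,x,a)m_t(dx,da)dt.$$ $\Gamma:\mathcal R\to\mathbb R\cup\{-\infty\}$, $\Gamma(\mu,m)=\int_0^T\int_{\bar{\mathcal O}\times A}f(t,x,a)m_t(dx,da)dt+\int_{[0,T]\times\bar{\mathcal O}}g(t,x)\mu(dt,dx)$. *)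

theory Defs
  imports "HOL-Probability.Probability"
begin

definition borel_probs :: "'a::topological_space set \<Rightarrow> 'a measure set" where
  "borel_probs E = space (prob_algebra (restrict_space borel E))"

definition bounded_fun_on :: "'a set \<Rightarrow> ('a \<Rightarrow> real) \<Rightarrow> bool" where
  "bounded_fun_on E h \<longleftrightarrow> (\<exists>C. \<forall>z\<in>E. \<bar>h z\<bar> \<le> C)"

definition usc_on :: "'a::topological_space set \<Rightarrow> ('a \<Rightarrow> real) \<Rightarrow> bool" where
  "usc_on E h \<longleftrightarrow> (\<forall>z\<in>E. \<forall>c > h z. \<forall>\<^sub>F w in at z within E. h w < c)"

definition Cb :: "'a::topological_space set \<Rightarrow> ('a \<Rightarrow> real) set" where
  "Cb E = {h. continuous_on E h \<and> bounded_fun_on E h}"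

text \<open>
  Partial derivatives are taken relative to the closed sets \<open>{0..T}\<close> and \<open>D = closure \<O>\<close>, hence
  are one-sided where only one side is available. For \<open>T > 0\<close> and \<open>\<O>\<close> open neither set has
  isolated points, so the derivatives are unique.
\<close>

definition partial_t :: "real \<Rightarrow> (real \<Rightarrow> real \<Rightarrow> real) \<Rightarrow> real \<Rightarrow> real \<Rightarrow> real" where
  "partial_t T u t x = vector_derivative (\<lambda>s. u s x) (at t within {0..T})"

definition partial_x :: "real set \<Rightarrow> (real \<Rightarrow> real \<Rightarrow> real) \<Rightarrow> real \<Rightarrow> real \<Rightarrow> real" where
  "partial_x D u t x = vector_derivative (\<lambda>y. u t y) (at x within D)"

definition Cb12 :: "real \<Rightarrow> real set \<Rightarrow> (real \<Rightarrow> real \<Rightarrow> real) set" where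
  "Cb12 T D = {u.
     (\<forall>t\<in>{0..T}. \<forall>x\<in>D.
        (\<lambda>s. u s x) differentiable (at t within {0..T}) \<and>
        (\<lambda>y. u t y) differentiable (at x within D) \<and>
        (\<lambda>y. partial_x D u t y) differentiable (at x within D)) \<and>
     (\<lambda>(t, x). u t x) \<in> Cb ({0..T} \<times> D) \<and>
     (\<lambda>(t, x). partial_t T u t x) \<in> Cb ({0..T} \<times> D) \<and>
     (\<lambda>(t, x). partial_x D u t x) \<in> Cb ({0..T} \<times> D) \<and>
     (\<lambda>(t, x). partial_x D (partial_x D u) t x) \<in> Cb ({0..T} \<times> D)}"

text \<open>
  A family in \<open>V\<close> that is positive only for almost every \<open>t\<close> is represented by its modification
  that vanishes on the exceptional null set. Families that agree for almost every \<open>t\<close> are not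
  formally identified, and values at times outside \<open>{0..T}\<close> are arbitrary; every notion below only
  sees the integral over \<open>{0..T}\<close> of quantities depending on \<open>m t\<close>, so it is invariant under both.
\<close>

definition V_families :: "real \<Rightarrow> real set \<Rightarrow> real set \<Rightarrow> (real \<Rightarrow> (real \<times> real) measure) set" where
  "V_families T D A = {m.
     (\<forall>t\<in>{0..T}. finite_measure (m t) \<and> sets (m t) = sets (restrict_space borel (D \<times> A))) \<and>
     (\<forall>B\<in>sets (restrict_space borel (D \<times> A)).
        (\<lambda>t. emeasure (m t) B) \<in> borel_measurable (restrict_space borel {0..T})) \<and>
     (\<integral>\<^sup>+ t\<in>{0..T}. emeasure (m t) (D \<times> A) \<partial>lborel) < \<infinity>}"

definition S_functions :: "real \<Rightarrow> real set \<Rightarrow> real set \<Rightarrow> (real \<Rightarrow> real \<Rightarrow> real \<Rightarrow> real) set" where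
  "S_functions T D A = {h.
     (\<lambda>(t, x, a). h t x a) \<in> borel_measurable (restrict_space borel ({0..T} \<times> D \<times> A)) \<and>
     bounded_fun_on ({0..T} \<times> D \<times> A) (\<lambda>(t, x, a). h t x a) \<and>
     (\<forall>t\<in>{0..T}. continuous_on (D \<times> A) (\<lambda>(x, a). h t x a))}"

definition generator ::
  "real set \<Rightarrow> (real \<Rightarrow> real \<Rightarrow> real \<Rightarrow> real) \<Rightarrow> (real \<Rightarrow> real \<Rightarrow> real \<Rightarrow> real) \<Rightarrow>
    (real \<Rightarrow> real \<Rightarrow> real) \<Rightarrow> real \<Rightarrow> real \<Rightarrow> real \<Rightarrow> real" where
  "generator D b \<sigma> u t x a =
     b t x a * partial_x D u t x + (\<sigma> t x a)\<^sup>2 / 2 * partial_x D (partial_x D u) t x"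

definition occupation_integral ::
  "real \<Rightarrow> (real \<Rightarrow> (real \<times> real) measure) \<Rightarrow> (real \<Rightarrow> real \<Rightarrow> real \<Rightarrow> real) \<Rightarrow> real" where
  "occupation_integral T m h = (LINT t:{0..T}|lborel. (LINT (x, a)|m t. h t x a))"

definition lp_feasible ::
  "real \<Rightarrow> real set \<Rightarrow> real set \<Rightarrow> (real \<Rightarrow> real \<Rightarrow> real \<Rightarrow> real) \<Rightarrow> (real \<Rightarrow> real \<Rightarrow> real \<Rightarrow> real) \<Rightarrow>
    real measure \<Rightarrow> ((real \<times> real) measure \<times> (real \<Rightarrow> (real \<times> real) measure)) set" where
  "lp_feasible T \<O> A b \<sigma> m0 =
     {(\<mu>, m) \<in> borel_probs ({0..T} \<times> closure \<O>) \<times> V_families T (closure \<O>) A.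
        \<forall>u\<in>Cb12 T (closure \<O>).
          (LINT (t, x)|\<mu>. u t x) =
            (LINT x|m0. u 0 x) +
            occupation_integral T m
              (\<lambda>t x a. partial_t T u t x + generator (closure \<O>) b \<sigma> u t x a)}"

text \<open>
  Integral with values in the extended reals. It is only used for functions bounded from above
  and finite measures, where the first term is finite and the value \<open>-\<infinity>\<close> is possible.
\<close>

definition ext_integral :: "'a measure \<Rightarrow> ('a \<Rightarrow> real) \<Rightarrow> ereal" where
  "ext_integral M h =
     enn2ereal (\<integral>\<^sup>+ z. ennreal (h z) \<partial>M) - enn2ereal (\<integral>\<^sup>+ z. ennreal (- h z) \<partial>M)"

definition lp_value ::
  "real \<Rightarrow> (real \<Rightarrow> real \<Rightarrow> real \<Rightarrow> real) \<Rightarrow> (real \<Rightarrow> real \<Rightarrow> real) \<Rightarrow>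
    (real \<times> real) measure \<times> (real \<Rightarrow> (real \<times> real) measure) \<Rightarrow> ereal" where
  "lp_value T f g = (\<lambda>(\<mu>, m).
     ereal (occupation_integral T m f) + ext_integral \<mu> (\<lambda>(t, x). g t x))"

end

theory Submission
  imports Defs
begin

text \<open>
  Testing with functions of time alone shows that \<open>m t\<close> has mass at most 1 for almost every \<open>t\<close>, so a
  feasible pair is encoded by a single probability kernel on the plane. Under this encoding both the
  constraints and the objective become integrals of nonnegative lower semicontinuous integrands, each
  equality constraint being split into two inequalities.

  Compactness uses convexity instead of disintegration and stable convergence. Among kernels
  that are nearly optimal one selects near-minimizers of a strictly convex quadratic energy of
  the conditional distribution functions, read off through a Borel code of the plane into the line with
  continuous left inverse. The parallelogram law makes the selection Cauchy, so along it the kernels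
  converge weakly for almost every time. Skorohod's representation and Fatou's lemma then give
  lower semicontinuity of all integrals. Tightness comes from the test functions
  \<open>(1 + T - t) x\<^sup>2 / (R\<^sup>2 + x\<^sup>2)\<close>, whose generator terms are of order \<open>1 / R\<close>.
\<close>

section \<open>Weak limits of measures on the line\<close>

text \<open>The coefficients are only measurable in time, so weak convergence of joint measures on
  time and space would not pass to the limit in their integrals; convergence of the conditional laws
  at almost every fixed time is needed. A maximizing sequence may have no subsequence with this
  property, for instance when its laws oscillate ever faster in time. Convexity gives the freedom to
  change the sequence: all costs are affine in the kernel, so the nearly optimal kernels are closed
  under midpoints, and minimizing a strictly convex functional over these shrinking sets selects a
  sequence without such oscillation. Moving to the line makes laws computable from countably many
  numbers, the distribution function at rational points. These are affine in the law, as the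
  parallelogram law requires. Only the left inverse of the code must be continuous, since it alone
  carries limits back to the plane. Fatou's lemma gives one inequality only, so an equality has to
  be imposed from both sides, with integrands made nonnegative by adding a constant.\<close>

definition rat_inf :: "(real \<Rightarrow> real) \<Rightarrow> real \<Rightarrow> real" where
  "rat_inf \<xi> x = (INF q\<in>{q\<in>\<rat>. x < q}. \<xi> q)"

lemma rat_above_nonempty: "{q\<in>\<rat>. (x::real) < q} \<noteq> {}"
  using Rats_dense_in_real[of x "x + 1"] by auto

text \<open>Helly's construction without the selection step, since the limits along the rationals
  are given. The limit \<open>\<xi>\<close> need not be right-continuous; the infimum over strictly
  larger rationals repairs this and changes nothing at continuity points. \<open>bot\<close>
  excludes mass escaping to the left and \<open>top\<close> mass escaping to the right, so the limit
  is again a probability.\<close>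

lemma weak_conv_of_rational_cdf_limits:
  assumes N: "\<And>n. real_distribution (N n)"
    and lim: "\<And>q. q \<in> \<rat> \<Longrightarrow> (\<lambda>n. cdf (N n) q) \<longlonglongrightarrow> \<xi> q"
    and bot: "\<And>n. cdf (N n) (-1) = 0"
    and top: "\<And>\<epsilon>. \<epsilon> > 0 \<Longrightarrow> \<exists>q\<in>\<rat>. \<xi> q > 1 - \<epsilon>"
  shows "real_distribution (interval_measure (rat_inf \<xi>))"
    and "cdf (interval_measure (rat_inf \<xi>)) = rat_inf \<xi>"
    and "weak_conv_m N (interval_measure (rat_inf \<xi>))"
proof -
  interpret N: real_distribution "N n" for n by (fact N)
  let ?F = "rat_inf \<xi>"
  have \<xi>_nonneg: "0 \<le> \<xi> q" if "q \<in> \<rat>" for q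
    by (rule LIMSEQ_le_const[OF lim[OF that]]) (auto simp: N.cdf_nonneg)
  have \<xi>_le: "\<xi> q \<le> 1" if "q \<in> \<rat>" for q
    by (rule LIMSEQ_le_const2[OF lim[OF that]]) (auto simp: N.cdf_bounded_prob)
  have \<xi>_mono: "\<xi> q \<le> \<xi> r" if "q \<in> \<rat>" "r \<in> \<rat>" "q \<le> r" for q r
    by (rule LIMSEQ_le[OF lim[OF that(1)] lim[OF that(2)]]) (auto simp: N.cdf_nondecreasing that)
  have \<xi>_bot: "\<xi> q = 0" if "q \<in> \<rat>" "q \<le> -1" for q
  proof -
    have "cdf (N n) q = 0" for n
      using N.cdf_nondecreasing[OF that(2), of n] bot[of n] N.cdf_nonneg[of n q] by simp
    then show ?thesis using LIMSEQ_unique[OF lim[OF that(1)], of 0] by simp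
  qed
  have bdd: "bdd_below (\<xi> ` {q\<in>\<rat>. x < q})" for x
    by (rule bdd_belowI[of _ 0]) (auto simp: \<xi>_nonneg)
  have F_le: "?F x \<le> \<xi> q" if "q \<in> \<rat>" "x < q" for x q
    unfolding rat_inf_def by (rule cINF_lower[OF bdd]) (use that in auto)
  have F_ge: "z \<le> ?F x" if "\<And>q. q \<in> \<rat> \<Longrightarrow> x < q \<Longrightarrow> z \<le> \<xi> q" for x z
    unfolding rat_inf_def by (rule cINF_greatest[OF rat_above_nonempty]) (use that in auto)
  have F_mono: "?F x \<le> ?F y" if "x \<le> y" for x y
    by (rule F_ge, rule F_le) (use that in auto)
  have F_above: "\<xi> q \<le> ?F x" if "q \<in> \<rat>" "q \<le> x" for q x
    by (rule F_ge, rule \<xi>_mono) (use that in auto)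
  have F_nonneg: "0 \<le> ?F x" for x
    by (rule F_ge) (rule \<xi>_nonneg)
  have F_le1: "?F x \<le> 1" for x
  proof -
    obtain q where "q \<in> \<rat>" "x < q" using rat_above_nonempty[of x] by auto
    then show ?thesis using F_le[of q x] \<xi>_le[of q] by linarith
  qed
  have F_approx: "\<exists>q\<in>\<rat>. x < q \<and> \<xi> q < z" if "?F x < z" for x z
    using that unfolding rat_inf_def by (subst (asm) cINF_less_iff[OF rat_above_nonempty bdd]) auto
  have rcont: "continuous (at_right a) ?F" for a
    unfolding continuous_within
  proof (rule order_tendstoI)
    fix z assume "z < ?F a"
    then show "\<forall>\<^sub>F x in at_right a. z < ?F x"
      using F_mono[of a] by (intro eventually_at_rightI[of a "a+1"]) (auto simp: less_le_trans)
  next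
    fix z assume "?F a < z"
    then obtain q where q: "q \<in> \<rat>" "a < q" "\<xi> q < z" using F_approx by blast
    then show "\<forall>\<^sub>F x in at_right a. ?F x < z"
      using F_le[of q] by (intro eventually_at_rightI[of a q]) (auto intro: le_less_trans)
  qed
  have lbot: "(?F \<longlongrightarrow> 0) at_bot"
  proof (rule tendsto_eventually)
    have "?F x = 0" if "x \<le> -2" for x
      using F_le[of "-1" x] \<xi>_bot[of "-1"] F_nonneg[of x] that by auto
    then show "\<forall>\<^sub>F x in at_bot. ?F x = 0"
      by (auto simp: eventually_at_bot_linorder)
  qed
  have ltop: "(?F \<longlongrightarrow> 1) at_top"
  proof (rule order_tendstoI)
    fix z :: real assume "z < 1"
    then obtain q where q: "q \<in> \<rat>" "\<xi> q > z" using top[of "1 - z"] by auto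
    then have "z < ?F x" if "x \<ge> q" for x using F_above[of q x] that by linarith
    then show "\<forall>\<^sub>F x in at_top. z < ?F x" by (auto simp: eventually_at_top_linorder)
  next
    fix z :: real assume "1 < z"
    then show "\<forall>\<^sub>F x in at_top. ?F x < z"
      using F_le1 by (intro always_eventually) (auto intro: le_less_trans)
  qed
  show "real_distribution (interval_measure ?F)"
    by (rule real_distribution_interval_measure[OF F_mono rcont lbot ltop])
  show cdf: "cdf (interval_measure ?F) = ?F"
    using cdf_interval_measure[OF F_mono rcont lbot] by simp
  show "weak_conv_m N (interval_measure ?F)"
    unfolding weak_conv_m_def weak_conv_def cdf
  proof (intro allI impI)
    fix x assume x: "isCont ?F x"
    \<comment> \<open>The upper bound comes from a rational above \<open>x\<close> and needs no
      continuity. The lower bound uses left-continuity, which supplies \<open>y < x\<close> with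
      \<open>rat_inf \<xi> y\<close> still above \<open>z\<close>, and then a rational between
      \<open>y\<close> and \<open>x\<close>.\<close>
    show "(\<lambda>n. cdf (N n) x) \<longlonglongrightarrow> ?F x"
    proof (rule order_tendstoI)
      fix z assume "?F x < z"
      then obtain q where q: "q \<in> \<rat>" "x < q" "\<xi> q < z" using F_approx by blast
      have "\<forall>\<^sub>F n in sequentially. cdf (N n) q < z"
        using order_tendstoD(2)[OF lim[OF q(1)] q(3)] .
      then show "\<forall>\<^sub>F n in sequentially. cdf (N n) x < z"
        by eventually_elim (use N.cdf_nondecreasing[of x q] q in \<open>auto intro: le_less_trans\<close>)
    next
      fix z assume z: "z < ?F x"
      have "(?F \<longlongrightarrow> ?F x) (at_left x)"
        using x by (auto simp: isCont_def intro: filterlim_at_split[THEN iffD1, THEN conjunct1])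
      then have "\<forall>\<^sub>F y in at_left x. z < ?F y"
        using z by (rule order_tendstoD)
      then obtain y where y: "y < x" "z < ?F y"
        using eventually_at_left_real[of "x - 1" x]
        by (metis (no_types, lifting) eventually_at_left_field dense order.strict_trans)
      obtain q where q: "q \<in> \<rat>" "y < q" "q < x" using Rats_dense_in_real[OF y(1)] by auto
      have "z < \<xi> q" using F_le[OF q(1,2)] y by linarith
      then have "\<forall>\<^sub>F n in sequentially. z < cdf (N n) q"
        using order_tendstoD(1)[OF lim[OF q(1)]] by blast
      then show "\<forall>\<^sub>F n in sequentially. z < cdf (N n) x"
        by eventually_elim (use N.cdf_nondecreasing[of q x] q in \<open>auto intro: less_le_trans\<close>)
    qed
  qed
qed

text \<open>The portmanteau inequality for a lower semicontinuous \<open>w\<close> and laws carried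
  over by \<open>\<pi>\<close>. Skorohod's representation turns weak convergence on the line into
  pointwise convergence of random variables, continuity of \<open>\<pi>\<close> preserves it, and
  Fatou's lemma finishes.\<close>

lemma lsc_nn_integral_le_liminf:
  fixes w :: "'a::topological_space \<Rightarrow> ennreal" and \<pi> :: "real \<Rightarrow> 'a"
  assumes N: "\<And>n. real_distribution (N n)" and \<nu>: "real_distribution \<nu>"
    and conv: "weak_conv_m N \<nu>"
    and \<pi>: "continuous_on UNIV \<pi>"
    and lsc: "\<And>y. open {p. y < w p}"
  shows "(\<integral>\<^sup>+ p. w p \<partial>distr \<nu> borel \<pi>) \<le> liminf (\<lambda>n. \<integral>\<^sup>+ p. w p \<partial>distr (N n) borel \<pi>)"
proof -
  obtain \<Omega> :: "real measure" and Y_seq Y where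
    Y_seq[measurable]: "\<And>n. Y_seq n \<in> borel_measurable \<Omega>"
    and dY: "\<And>n. distr \<Omega> borel (Y_seq n) = N n"
    and Y: "Y \<in> measurable \<Omega> lborel" and dY': "distr \<Omega> borel Y = \<nu>"
    and lim: "\<And>x. x \<in> space \<Omega> \<Longrightarrow> (\<lambda>n. Y_seq n x) \<longlonglongrightarrow> Y x"
    using Skorohod[OF N \<nu> conv] by blast
  have Y[measurable]: "Y \<in> borel_measurable \<Omega>" using Y by simp
  have [measurable]: "\<pi> \<in> borel_measurable borel"
    by (rule borel_measurable_continuous_onI[OF \<pi>])
  have [measurable]: "w \<in> borel_measurable borel"
    by (rule borel_measurableI_greater) (auto intro!: borel_open lsc)
  have "(\<integral>\<^sup>+ p. w p \<partial>distr \<nu> borel \<pi>) = (\<integral>\<^sup>+ z. w (\<pi> (Y z)) \<partial>\<Omega>)"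
    unfolding dY'[symmetric] by (simp add: nn_integral_distr)
  also have "\<dots> \<le> (\<integral>\<^sup>+ z. liminf (\<lambda>n. w (\<pi> (Y_seq n z))) \<partial>\<Omega>)"
  proof (rule nn_integral_mono)
    fix z assume z: "z \<in> space \<Omega>"
    have lim': "(\<lambda>n. \<pi> (Y_seq n z)) \<longlonglongrightarrow> \<pi> (Y z)"
      using \<pi> lim[OF z] by (auto simp: continuous_on_def intro: continuous_on_tendsto_compose[OF \<pi>])
    show "w (\<pi> (Y z)) \<le> liminf (\<lambda>n. w (\<pi> (Y_seq n z)))"
      unfolding le_Liminf_iff using topological_tendstoD[OF lim' lsc] by auto
  qed
  also have "\<dots> \<le> liminf (\<lambda>n. \<integral>\<^sup>+ z. w (\<pi> (Y_seq n z)) \<partial>\<Omega>)"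
    by (rule nn_integral_liminf) measurable
  also have "\<dots> = liminf (\<lambda>n. \<integral>\<^sup>+ p. w p \<partial>distr (N n) borel \<pi>)"
    unfolding dY[symmetric] by (simp add: nn_integral_distr)
  finally show ?thesis .
qed

section \<open>A Borel code of the plane with continuous left inverse\<close>

text \<open>
  Interleaving the binary digits of both coordinates in base 9, with digits in \<open>{0, 1, 3, 4}\<close> only,
  leaves gaps around every code: close codes force equal leading digits. Hence the decoding map is
  uniformly continuous on the range of the code and extends continuously to the whole line,
  although the code itself is only Borel.
\<close>

definition binary_digit :: "nat \<Rightarrow> real \<Rightarrow> int" where
  "binary_digit n x = \<lfloor>2 ^ Suc n * x\<rfloor> mod 2"

definition base9_digit :: "nat \<Rightarrow> real \<times> real \<Rightarrow> real" where
  "base9_digit n p = of_int (binary_digit n (fst p)) + 3 * of_int (binary_digit n (snd p))"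

text \<open>The index \<open>n\<close> drops the leading \<open>n\<close> digits and rescales, so
  that claims about digits can be proved by induction while shifting \<open>n\<close>.\<close>

definition expansion :: "nat \<Rightarrow> real \<times> real \<Rightarrow> real" where
  "expansion n p = (\<Sum>k. base9_digit (n + k) p / 9 ^ Suc k)"

definition plane_code :: "real \<times> real \<Rightarrow> real" where
  "plane_code p = of_nat (to_nat (\<lfloor>fst p\<rfloor>, \<lfloor>snd p\<rfloor>)) + expansion 0 p"

lemma binary_digit_cases: "binary_digit n x = 0 \<or> binary_digit n x = 1"
  unfolding binary_digit_def by linarith

lemma base9_digit_bounds: "0 \<le> base9_digit n p" "base9_digit n p \<le> 4"
  using binary_digit_cases[of n "fst p"] binary_digit_cases[of n "snd p"] by (auto simp: base9_digit_def)

lemma binary_digit_eq_of_base9_digit_close: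
  assumes "\<bar>base9_digit n p - base9_digit n q\<bar> < 1"
  shows "binary_digit n (fst p) = binary_digit n (fst q)" "binary_digit n (snd p) = binary_digit n (snd q)"
  using assms binary_digit_cases[of n "fst p"] binary_digit_cases[of n "snd p"]
    binary_digit_cases[of n "fst q"] binary_digit_cases[of n "snd q"]
  by (auto simp: base9_digit_def)

text \<open>The largest possible tail, with all digits equal to 4. Its value 1/2 is what leaves the
  gaps: distinct digits differ by at least 1, two tails by at most 1/2.\<close>

lemma sums_four_ninths: "(\<lambda>k. 4 / 9 ^ Suc k) sums (1/2 :: real)"
proof -
  have "(\<lambda>k. 4 / 9 * (1/9) ^ k) sums (4 / 9 * (1 / (1 - 1/9)) :: real)"
    by (intro sums_mult geometric_sums) simp
  then show ?thesis by (simp add: power_divide)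
qed

lemma summable_expansion: "summable (\<lambda>k. base9_digit (n + k) p / 9 ^ Suc k)"
  by (rule summable_comparison_test'[OF sums_summable[OF sums_four_ninths], of 0])
     (auto intro!: divide_right_mono simp: abs_of_nonneg base9_digit_bounds simp del: split_paired_All)

lemma expansion_bounds: "0 \<le> expansion n p" "expansion n p \<le> 1/2"
proof -
  show "0 \<le> expansion n p" unfolding expansion_def
    by (rule suminf_nonneg[OF summable_expansion]) (simp add: base9_digit_bounds)
  have "expansion n p \<le> (\<Sum>k. 4 / 9 ^ Suc k)" unfolding expansion_def
    by (rule suminf_le[OF _ summable_expansion sums_summable[OF sums_four_ninths]])
       (auto intro!: divide_right_mono base9_digit_bounds)
  then show "expansion n p \<le> 1/2" using sums_unique[OF sums_four_ninths] by simp
qed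

lemma expansion_Suc: "expansion n p = (base9_digit n p + expansion (Suc n) p) / 9"
proof -
  have "expansion n p = base9_digit n p / 9 + (\<Sum>k. base9_digit (n + Suc k) p / 9 ^ Suc (Suc k))"
    unfolding expansion_def using suminf_split_head[OF summable_expansion, of n p] by simp
  also have "(\<Sum>k. base9_digit (n + Suc k) p / 9 ^ Suc (Suc k)) = (\<Sum>k. (base9_digit (Suc n + k) p / 9 ^ Suc k) / 9)"
    by (simp add: field_simps)
  also have "\<dots> = expansion (Suc n) p / 9"
    unfolding expansion_def by (rule suminf_divide[OF summable_expansion])
  finally show ?thesis by (simp add: add_divide_distrib)
qed

text \<open>Nine times the difference of two expansions is the difference of the leading digits plus
  that of the tails. The former is below 9/18 = 1/2 in absolute value and the tails lie in [0, 1/2],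
  so the leading digits differ by less than 1 and agree. The tails then differ by exactly nine times
  the original difference, which uses up one factor 9 of the bound.\<close>

lemma binary_digit_eq_of_expansion_close:
  assumes "\<bar>expansion n p - expansion n q\<bar> < 1 / (2 * 9 ^ N)" "k < N"
  shows "binary_digit (n + k) (fst p) = binary_digit (n + k) (fst q) \<and> binary_digit (n + k) (snd p) = binary_digit (n + k) (snd q)"
  using assms
proof (induction N arbitrary: n k)
  case (Suc N)
  have le: "1 / (2 * 9 ^ Suc N) \<le> (1 / 18 :: real)"
    by (simp add: field_simps)
  have eq: "9 * (expansion n p - expansion n q) = base9_digit n p - base9_digit n q + (expansion (Suc n) p - expansion (Suc n) q)"
    unfolding expansion_Suc[of n] by (simp add: field_simps)
  have "\<bar>base9_digit n p - base9_digit n q\<bar> < 1"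
    using less_le_trans[OF Suc.prems(1) le] eq expansion_bounds[of "Suc n" p] expansion_bounds[of "Suc n" q]
    by argo
  note b = binary_digit_eq_of_base9_digit_close[OF this]
  show ?case
  proof (cases k)
    case 0 then show ?thesis using b by simp
  next
    case (Suc k')
    have "base9_digit n p = base9_digit n q" using b by (simp add: base9_digit_def)
    then have "expansion (Suc n) p - expansion (Suc n) q = 9 * (expansion n p - expansion n q)" using eq by simp
    then have "\<bar>expansion (Suc n) p - expansion (Suc n) q\<bar> = 9 * \<bar>expansion n p - expansion n q\<bar>"
      by (simp only: abs_mult abs_numeral)
    also have "\<dots> < 1 / (2 * 9 ^ N)" using Suc.prems(1) by (simp add: field_simps)
    finally show ?thesis using Suc.IH[of "Suc n" k'] Suc Suc.prems(2) by simp
  qed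
qed simp

lemma floor_pow2_eq_of_binary_digits:
  assumes "\<lfloor>x\<rfloor> = \<lfloor>y\<rfloor>" "\<And>k. k < n \<Longrightarrow> binary_digit k x = binary_digit k y"
  shows "\<lfloor>2 ^ n * x\<rfloor> = \<lfloor>2 ^ n * y\<rfloor>"
  using assms(2)
proof (induction n)
  case (Suc n)
  have *: "\<lfloor>2 ^ Suc n * z\<rfloor> = 2 * \<lfloor>2 ^ n * z\<rfloor> + binary_digit n z" for z :: real
  proof -
    have "\<lfloor>2 ^ Suc n * z\<rfloor> div 2 = \<lfloor>2 ^ n * z\<rfloor>"
      using floor_divide_real_eq_div[of 2 "2 ^ Suc n * z"] by simp
    then show ?thesis unfolding binary_digit_def by (metis mult_div_mod_eq)
  qed
  show ?case unfolding * using Suc by simp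
qed (use assms(1) in simp)

lemma abs_diff_less_of_floor_pow2:
  assumes "\<lfloor>2 ^ n * x\<rfloor> = \<lfloor>2 ^ n * (y::real)\<rfloor>"
  shows "\<bar>x - y\<bar> < 1 / 2 ^ n"
proof -
  have "\<bar>2 ^ n * x - 2 ^ n * y\<bar> < 1" using assms by linarith
  then have "2 ^ n * \<bar>x - y\<bar> < 1" by (simp add: abs_mult right_diff_distrib[symmetric])
  then show ?thesis by (simp add: field_simps)
qed

text \<open>Expansions lie in [0, 1/2], so codes at distance below 1/2 have numbers of unit squares
  differing by less than 1, and the squares coincide. The first \<open>N\<close> digits then agree
  and locate each coordinate within \<open>1 / 2 ^ N\<close>.\<close>

lemma plane_code_close:
  fixes p q :: "real \<times> real"
  assumes "\<bar>plane_code p - plane_code q\<bar> < 1 / (2 * 9 ^ N)"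
  shows "dist p q < 2 / 2 ^ N"
proof -
  have le: "1 / (2 * 9 ^ N) \<le> (1 / 2 :: real)" by (simp add: field_simps)
  let ?I = "\<lambda>p::real\<times>real. to_nat (\<lfloor>fst p\<rfloor>, \<lfloor>snd p\<rfloor>)"
  have "\<bar>of_nat (?I p) - of_nat (?I q)\<bar> < (1::real)"
    using assms le expansion_bounds[of 0 p] expansion_bounds[of 0 q] unfolding plane_code_def by linarith
  then have I: "?I p = ?I q" by linarith
  then have fl: "\<lfloor>fst p\<rfloor> = \<lfloor>fst q\<rfloor>" "\<lfloor>snd p\<rfloor> = \<lfloor>snd q\<rfloor>" by auto
  have "\<bar>expansion 0 p - expansion 0 q\<bar> < 1 / (2 * 9 ^ N)"
    using assms I by (simp add: plane_code_def)
  note b = binary_digit_eq_of_expansion_close[OF this, unfolded add_0]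
  have "\<bar>fst p - fst q\<bar> < 1 / 2 ^ N" "\<bar>snd p - snd q\<bar> < 1 / 2 ^ N"
    by (auto intro!: abs_diff_less_of_floor_pow2 floor_pow2_eq_of_binary_digits fl simp: b)
  moreover have "dist p q \<le> \<bar>fst p - fst q\<bar> + \<bar>snd p - snd q\<bar>"
    by (cases p; cases q) (simp add: dist_Pair_Pair dist_real_def sqrt_sum_squares_le_sum_abs)
  ultimately show ?thesis by simp
qed

lemma plane_code_nonneg: "0 \<le> plane_code p"
  using expansion_bounds(1)[of 0 p] by (simp add: plane_code_def)

lemma plane_code_measurable [measurable]: "plane_code \<in> borel_measurable borel"
proof -
  have [measurable]: "(\<lambda>p. binary_digit n (fst p)) \<in> (borel :: (real \<times> real) measure) \<rightarrow>\<^sub>M count_space UNIV"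
    "(\<lambda>p. binary_digit n (snd p)) \<in> (borel :: (real \<times> real) measure) \<rightarrow>\<^sub>M count_space UNIV" for n
    unfolding binary_digit_def borel_prod[symmetric] by measurable
  have [measurable]: "base9_digit n \<in> borel_measurable borel" for n
    unfolding base9_digit_def by measurable
  have 1: "expansion 0 \<in> borel_measurable borel"
    unfolding expansion_def by measurable
  have 2: "(\<lambda>p::real\<times>real. real (to_nat (\<lfloor>fst p\<rfloor>, \<lfloor>snd p\<rfloor>))) \<in> borel_measurable borel"
    unfolding borel_prod[symmetric]
    by measurable
  show ?thesis unfolding plane_code_def
    by (rule borel_measurable_add[OF 2 1])
qed

text \<open>A bounded set meets finitely many unit squares. This is how tightness in the plane
  becomes tightness of the coded laws.\<close>

lemma plane_code_bounded:
  "\<exists>q. \<forall>p. norm p \<le> R \<longrightarrow> plane_code p \<le> q"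
proof -
  let ?S = "(\<lambda>z. real (to_nat z)) ` ({\<lfloor>-R\<rfloor>..\<lfloor>R\<rfloor>} \<times> {\<lfloor>-R\<rfloor>..\<lfloor>R\<rfloor>} :: (int\<times>int) set)"
  have fin: "finite ?S" by auto
  have "plane_code p \<le> Max ?S + 1/2" if "norm p \<le> R" for p
  proof -
    have "\<bar>fst p\<bar> \<le> R" "\<bar>snd p\<bar> \<le> R"
      using that norm_fst_le[of "fst p" "snd p"] norm_snd_le[of "snd p" "fst p"] by auto
    then have "real (to_nat (\<lfloor>fst p\<rfloor>, \<lfloor>snd p\<rfloor>)) \<in> ?S"
      by (intro imageI) (auto intro!: floor_mono)
    from Max_ge[OF fin this] show ?thesis
      using expansion_bounds(2)[of 0 p] by (simp add: plane_code_def)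
  qed
  then show ?thesis by blast
qed

lemma plane_code_left_inverse:
  obtains \<pi> where "continuous_on UNIV \<pi>" "\<And>p. \<pi> (plane_code p) = p"
proof -
  have small: "\<exists>N. 2 / 2 ^ N < e" if "e > 0" for e :: real
  proof -
    have "\<exists>N. (1/2) ^ N < e / 2" by (rule real_arch_pow_inv) (use that in auto)
    then obtain N where "(1/2) ^ N < e / 2" by blast
    then show ?thesis by (auto simp: power_divide field_simps)
  qed
  have inj: "inj plane_code"
  proof (rule injI, rule ccontr)
    fix p q assume eq: "plane_code p = plane_code q" and "p \<noteq> q"
    then obtain N where "2 / 2 ^ N < dist p q" using small[of "dist p q"] by auto
    with plane_code_close[of p q N] eq show False by auto
  qed
  have "uniformly_continuous_on (range plane_code) (inv plane_code)"
    unfolding uniformly_continuous_on_def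
  proof (intro allI impI)
    fix e :: real assume "e > 0"
    then obtain N where N: "2 / 2 ^ N < e" using small by auto
    show "\<exists>d>0. \<forall>x\<in>range plane_code. \<forall>x'\<in>range plane_code.
      dist x' x < d \<longrightarrow> dist (inv plane_code x') (inv plane_code x) < e"
      using plane_code_close[of _ _ N] N inj
      by (intro exI[of _ "1 / (2 * 9 ^ N)"]) (fastforce simp: dist_real_def)
  qed
  \<comment> \<open>The range is not closed: as a coordinate increases to a dyadic number, the codes
    converge to a point that is no code. Hence two extensions, to the closure by uniform continuity
    and to the line by Tietze.\<close>
  then obtain g where g: "uniformly_continuous_on (closure (range plane_code)) g"
    "\<And>x. x \<in> range plane_code \<Longrightarrow> inv plane_code x = g x"
    by (rule uniformly_continuous_on_extension_on_closure) blast
  obtain h where h: "continuous_on UNIV h" "\<And>x. x \<in> closure (range plane_code) \<Longrightarrow> h x = g x"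
    using Tietze_unbounded[OF uniformly_continuous_imp_continuous[OF g(1)], of UNIV] by auto
  have "h (plane_code p) = p" for p
    using h(2)[of "plane_code p"] g(2)[of "plane_code p"] inj closure_subset[of "range plane_code"] by auto
  with h(1) that show ?thesis by blast
qed

section \<open>Compactness of probability kernels\<close>

definition add_measure :: "'a measure \<Rightarrow> 'a measure \<Rightarrow> 'a measure" where
  "add_measure M N = measure_of (space M) (sets M) (\<lambda>X. emeasure M X + emeasure N X)"

lemma sets_add_measure [simp, measurable_cong]: "sets (add_measure M N) = sets M"
  by (simp add: add_measure_def)

lemma space_add_measure [simp]: "space (add_measure M N) = space M"
  by (simp add: add_measure_def)

lemma emeasure_add_measure:
  assumes "sets N = sets M"
  shows "emeasure (add_measure M N) X = emeasure M X + emeasure N X"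
proof (cases "X \<in> sets M")
  case True
  show ?thesis unfolding add_measure_def
  proof (rule emeasure_measure_of_sigma)
    show "sigma_algebra (space M) (sets M)" ..
    show "positive (sets M) (\<lambda>X. emeasure M X + emeasure N X)" by (simp add: positive_def)
    show "countably_additive (sets M) (\<lambda>X. emeasure M X + emeasure N X)"
      by (rule countably_additiveI) (simp add: suminf_add[symmetric] suminf_emeasure assms)
  qed (fact True)
qed (simp add: emeasure_notin_sets assms)

lemma nn_integral_add_measure:
  assumes sets: "sets N = sets M" and f: "f \<in> borel_measurable M"
  shows "nn_integral (add_measure M N) f = nn_integral M f + nn_integral N f"
proof -
  note [measurable_cong] = sets
  note [simp] = sets_eq_imp_space_eq[OF sets]
  show ?thesis
    using f
  proof induction
    case (cong f g)
    then show ?case by (simp cong: nn_integral_cong_simp)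
  next
    case (set A)
    then show ?case by (simp add: emeasure_add_measure sets)
  next
    case (mult f c)
    then show ?case by (simp add: nn_integral_cmult distrib_left)
  next
    case (add f g)
    then show ?case by (simp add: nn_integral_add algebra_simps)
  next
    case (seq U)
    have inc: "incseq U" using seq by simp
    have m: "U i \<in> borel_measurable (add_measure M N)" "U i \<in> borel_measurable N" for i
      using seq(1)[of i] by (simp_all cong: measurable_cong_sets)
    have S: "(SUP i. U i) = (\<lambda>x. SUP i. U i x)" by (simp add: fun_eq_iff image_comp)
    have "nn_integral (add_measure M N) (SUP i. U i) = (SUP i. nn_integral (add_measure M N) (U i))"
      unfolding S by (rule nn_integral_monotone_convergence_SUP[OF inc m(1)])
    also have "\<dots> = (SUP i. nn_integral M (U i) + nn_integral N (U i))"
      using seq by simp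
    also have "\<dots> = (SUP i. nn_integral M (U i)) + (SUP i. nn_integral N (U i))"
      using inc by (intro ennreal_SUP_add) (auto simp: incseq_def le_fun_def intro!: nn_integral_mono)
    also have "\<dots> = nn_integral M (SUP i. U i) + nn_integral N (SUP i. U i)"
      unfolding S nn_integral_monotone_convergence_SUP[OF inc seq(1)]
        nn_integral_monotone_convergence_SUP[OF inc m(2)] ..
    finally show ?case .
  qed
qed

definition mid_measure :: "'a measure \<Rightarrow> 'a measure \<Rightarrow> 'a measure" where
  "mid_measure M N = scale_measure (1/2) (add_measure M N)"

lemma sets_mid_measure [simp, measurable_cong]: "sets (mid_measure M N) = sets M"
  by (simp add: mid_measure_def)

lemma emeasure_mid_measure:
  "sets N = sets M \<Longrightarrow> emeasure (mid_measure M N) X = (emeasure M X + emeasure N X) / 2"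
  by (simp add: mid_measure_def emeasure_add_measure ennreal_times_divide mult.commute divide_ennreal_def)

lemma half_add_self_ennreal: "(x + x) / 2 = (x::ennreal)"
  by (simp add: mult_2[symmetric] ennreal_mult_divide_eq mult.commute)

lemma nn_integral_mid_measure:
  "sets N = sets M \<Longrightarrow> f \<in> borel_measurable M \<Longrightarrow>
    nn_integral (mid_measure M N) f = (nn_integral M f + nn_integral N f) / 2"
  by (simp add: mid_measure_def nn_integral_scale_measure nn_integral_add_measure divide_ennreal_def mult.commute)

lemma mid_measure_kernel:
  assumes K: "K \<in> M \<rightarrow>\<^sub>M prob_algebra N" and L: "L \<in> M \<rightarrow>\<^sub>M prob_algebra N"
  shows "(\<lambda>\<omega>. mid_measure (K \<omega>) (L \<omega>)) \<in> M \<rightarrow>\<^sub>M prob_algebra N"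
proof -
  note KL = measurable_space[OF K] measurable_space[OF L]
  note [measurable] = measurable_prob_algebraD[OF K] measurable_prob_algebraD[OF L]
  have ps: "prob_space (mid_measure (K \<omega>) (L \<omega>))" if "\<omega> \<in> space M" for \<omega>
  proof (rule prob_spaceI)
    have "space (L \<omega>) = space (K \<omega>)"
      using KL[OF that] by (intro sets_eq_imp_space_eq) (simp add: space_prob_algebra)
    then show "emeasure (mid_measure (K \<omega>) (L \<omega>)) (space (mid_measure (K \<omega>) (L \<omega>))) = 1"
      using KL[OF that] prob_space.emeasure_space_1[of "K \<omega>"] prob_space.emeasure_space_1[of "L \<omega>"]
      by (subst emeasure_mid_measure) (auto simp: space_prob_algebra half_add_self_ennreal mid_measure_def space_scale_measure)
  qed
  show ?thesis
  proof (rule measurable_prob_algebraI[OF ps measurable_subprob_algebra])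
    fix A assume [measurable]: "A \<in> sets N"
    have "(\<lambda>\<omega>. (emeasure (K \<omega>) A + emeasure (L \<omega>) A) / 2) \<in> borel_measurable M"
      by measurable
    then show "(\<lambda>\<omega>. emeasure (mid_measure (K \<omega>) (L \<omega>)) A) \<in> borel_measurable M"
      by (rule measurable_cong[THEN iffD1, rotated])
         (use KL in \<open>simp add: emeasure_mid_measure space_prob_algebra\<close>)
  qed (use KL in \<open>auto simp: space_prob_algebra intro: prob_space_imp_subprob_space ps\<close>)
qed

section \<open>Cauchy sequences of near-minimizers from the parallelogram law\<close>

lemma convergent_of_geometric_square_increments:
  fixes a :: "nat \<Rightarrow> real"
  assumes "\<And>n. (a n - a (Suc n))\<^sup>2 \<le> C * (1/2) ^ n"
  shows "convergent a"
proof -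
  have C: "0 \<le> C" using order_trans[OF zero_le_power2 assms[of 0]] by simp
  have "summable (\<lambda>n. a (Suc n) - a n)"
  proof (rule summable_comparison_test'[where N=0])
    show "summable (\<lambda>n. sqrt C * sqrt (1/2) ^ n)"
      by (intro summable_mult summable_geometric) (simp add: real_sqrt_divide)
    show "norm (a (Suc n) - a n) \<le> sqrt C * sqrt (1/2) ^ n" for n
      using real_sqrt_le_mono[OF assms[of n]]
      by (simp add: real_sqrt_mult real_sqrt_power[symmetric] abs_minus_commute del: real_sqrt_power)
  qed
  then have "convergent (\<lambda>n. a n - a 0)"
    by (simp add: summable_iff_convergent sum_lessThan_telescope)
  then have "convergent (\<lambda>n. (a n - a 0) + a 0)"
    by (intro convergent_add convergent_const)
  then show ?thesis by simp
qed

text \<open>The argument for projections onto convex sets in a Hilbert space, with \<open>d\<close>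
  in the role of the squared distance. The infima over the shrinking sets increase to a finite limit
  \<open>l\<close>. If two points of \<open>C n\<close> have energy near \<open>l\<close> and
  \<open>j n\<close> is near \<open>l\<close> too, then their midpoint has energy at least
  \<open>j n\<close>, and the parallelogram law forces the points together.\<close>

lemma parallelogram_minimizing_sequence:
  fixes J :: "'k \<Rightarrow> real" and d :: "'k \<Rightarrow> 'k \<Rightarrow> real"
  assumes ne: "\<And>n. C n \<noteq> {}" and dec: "decseq C"
    and mid: "\<And>n x y. x \<in> C n \<Longrightarrow> y \<in> C n \<Longrightarrow> mid x y \<in> C n"
    and bdd: "\<And>x. x \<in> C 0 \<Longrightarrow> 0 \<le> J x \<and> J x \<le> B"
    and par: "\<And>x y. x \<in> C 0 \<Longrightarrow> y \<in> C 0 \<Longrightarrow> d x y = 2 * J x + 2 * J y - 4 * J (mid x y)"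
  shows "\<exists>X. \<forall>n. X n \<in> C n \<and> d (X n) (X (Suc n)) \<le> (1/4) ^ n"
proof -
  have C0: "x \<in> C 0" if "x \<in> C n" for x n using dec that by (auto simp: decseq_def)
  define j where "j n = Inf (J ` C n)" for n
  have bb: "bdd_below (J ` C n)" for n
    by (rule bdd_belowI[of _ 0]) (use bdd C0 in auto)
  have j_le: "j n \<le> J x" if "x \<in> C n" for n x
    unfolding j_def by (rule cINF_lower[OF bb that])
  have inc: "incseq j"
    unfolding incseq_def j_def using dec ne by (auto intro!: cINF_superset_mono bb simp: decseq_def)
  have "j n \<le> B" for n
  proof -
    obtain x where "x \<in> C n" using ne by blast
    then show ?thesis using j_le[of x n] bdd[of x] C0[of x n] by linarith
  qed
  then obtain l where l: "j \<longlonglongrightarrow> l" "\<And>n. j n \<le> l"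
    using incseq_convergent[OF inc] by blast
  \<comment> \<open>The coefficients 2, 2 and 4 of the parallelogram law produce at most eight
    errors of size \<open>e m\<close>, hence the division by 8. The ratio 1/4 leaves room for a
    weight \<open>2 ^ n\<close> when the distances are summed later.\<close>
  define e :: "nat \<Rightarrow> real" where "e m = (1/4) ^ m / 8" for m
  have e: "0 < e m" for m by (simp add: e_def)
  have "\<exists>N\<ge>m. \<exists>x\<in>C N. l - e m \<le> j N \<and> J x \<le> l + e m" for m
  proof -
    have "\<forall>\<^sub>F n in sequentially. l - e m < j n"
      using order_tendstoD(1)[OF l(1), of "l - e m"] e by simp
    then obtain N where N: "N \<ge> m" "l - e m < j N"
      by (metis eventually_sequentially nat_le_linear order_refl)
    have "j N < l + e m" using l(2)[of N] e[of m] by linarith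
    then obtain x where "x \<in> C N" "J x < l + e m"
      unfolding j_def using cINF_less_iff[OF ne bb] by blast
    with N show ?thesis by (intro exI[of _ N]) force
  qed
  then obtain N X where N: "\<And>m. N m \<ge> m" "\<And>m. X m \<in> C (N m)" "\<And>m. l - e m \<le> j (N m)"
    "\<And>m. J (X m) \<le> l + e m"
    by metis
  have Xm: "X m \<in> C m" for m using N(1,2)[of m] dec by (auto simp: decseq_def)
  have "d (X m) (X (Suc m)) \<le> (1/4) ^ m" for m
  proof -
    \<comment> \<open>The smaller index gives the larger set, which contains both points, and its
      infimum is one of the two already controlled.\<close>
    define n where "n = min (N m) (N (Suc m))"
    have in_n: "X m \<in> C n" "X (Suc m) \<in> C n"
      using N(2)[of m] N(2)[of "Suc m"] dec unfolding n_def decseq_def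
      by (meson min.cobounded1 subsetD, meson min.cobounded2 subsetD)
    have es: "e (Suc m) \<le> e m" by (simp add: e_def)
    have "l - e m \<le> j n" using N(3)[of m] N(3)[of "Suc m"] es by (auto simp: n_def min_def)
    then have "l - e m \<le> J (mid (X m) (X (Suc m)))"
      using j_le[OF mid[OF in_n]] by linarith
    then have "d (X m) (X (Suc m)) \<le> 8 * e m"
      using par[OF C0[OF in_n(1)] C0[OF in_n(2)]] N(4)[of m] N(4)[of "Suc m"] es by linarith
    then show ?thesis by (simp add: e_def)
  qed
  with Xm show ?thesis by blast
qed

section \<open>Coded distribution functions, their energy and their limits\<close>

definition enum_rat :: "nat \<Rightarrow> real" where "enum_rat k = of_rat (from_nat k)"

lemma enum_rat_surj: "q \<in> \<rat> \<Longrightarrow> \<exists>k. q = enum_rat k"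
  unfolding enum_rat_def by (metis Rats_cases from_nat_to_nat)

definition code_cdf :: "(real \<times> real) measure \<Rightarrow> nat \<Rightarrow> real" where
  "code_cdf P k = measure P {p. plane_code p \<le> enum_rat k}"

text \<open>
  The integral of this strictly convex energy over the clock plays the role of a squared Hilbert
  norm: near-minimizers over nested midpoint-convex sets form a Cauchy sequence, which replaces weak
  compactness by almost everywhere convergence of the distribution functions.
\<close>

definition cdf_energy :: "(nat \<Rightarrow> real) \<Rightarrow> real" where
  "cdf_energy x = (\<Sum>k. (1/2) ^ k * (x k)\<^sup>2)"

lemma summable_cdf_energy:
  assumes "\<And>k. \<bar>x k\<bar> \<le> 1"
  shows "summable (\<lambda>k. (1/2) ^ k * (x k :: real)\<^sup>2)"
proof (rule summable_comparison_test'[where N=0])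
  show "summable (\<lambda>k. (1/2) ^ k :: real)" by (intro summable_geometric) simp
  show "norm ((1/2) ^ k * (x k)\<^sup>2) \<le> (1/2) ^ k" for k
    using assms[of k] by (simp add: abs_square_le_1 abs_mult mult_left_le)
qed

lemma cdf_energy_bounds:
  assumes "\<And>k. \<bar>x k\<bar> \<le> 1"
  shows "0 \<le> cdf_energy x" "cdf_energy x \<le> 2"
proof -
  show "0 \<le> cdf_energy x" unfolding cdf_energy_def
    by (rule suminf_nonneg[OF summable_cdf_energy[OF assms]]) simp
  have "cdf_energy x \<le> (\<Sum>k. (1/2) ^ k)" unfolding cdf_energy_def
    by (rule suminf_le[OF _ summable_cdf_energy[OF assms]])
       (use assms in \<open>auto simp: abs_square_le_1 mult_left_le intro: summable_geometric\<close>)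
  then show "cdf_energy x \<le> 2" by (simp add: suminf_geometric)
qed

lemma cdf_energy_parallelogram:
  assumes x: "\<And>k. \<bar>x k\<bar> \<le> 1" and y: "\<And>k. \<bar>y k\<bar> \<le> 1" and xy: "\<And>k. \<bar>x k - y k\<bar> \<le> 1"
  shows "cdf_energy (\<lambda>k. x k - y k) =
    2 * cdf_energy x + 2 * cdf_energy y - 4 * cdf_energy (\<lambda>k. (x k + y k) / 2)"
proof -
  have m: "\<bar>(x k + y k) / 2\<bar> \<le> 1" for k using x[of k] y[of k] by (simp add: abs_le_iff)
  note s = summable_cdf_energy[OF x] summable_cdf_energy[OF y] summable_cdf_energy[OF m]
  have "2 * cdf_energy x + 2 * cdf_energy y - 4 * cdf_energy (\<lambda>k. (x k + y k) / 2)
    = (\<Sum>k. 2 * ((1/2) ^ k * (x k)\<^sup>2) + 2 * ((1/2) ^ k * (y k)\<^sup>2) - 4 * ((1/2) ^ k * ((x k + y k) / 2)\<^sup>2))"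
    unfolding cdf_energy_def suminf_mult[OF s(1), symmetric] suminf_mult[OF s(2), symmetric]
      suminf_mult[OF s(3), symmetric]
    by (subst suminf_diff[symmetric] suminf_add[symmetric]; (intro summable_add summable_mult s)?)+ rule
  also have "\<dots> = cdf_energy (\<lambda>k. x k - y k)"
    unfolding cdf_energy_def by (intro suminf_cong) (simp add: power2_eq_square field_simps)
  finally show ?thesis by simp
qed

lemma plane_code_levels [measurable]:
  "{p. plane_code p \<le> z} \<in> sets borel" "{p. z < plane_code p} \<in> sets borel"
  by measurable

text \<open>At each \<open>\<omega>\<close> the coded laws converge weakly on the line, and the
  limit law is carried back to the plane by the continuous left inverse of the code. The
  construction is explicit in the limits of the distribution functions, so it yields a kernel and
  not merely a law for each \<open>\<omega>\<close> separately.\<close>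

lemma kernel_limit_of_code_cdfs:
  assumes Y: "\<And>n. Y n \<in> M \<rightarrow>\<^sub>M prob_algebra borel"
    and conv: "\<And>\<omega> k. \<omega> \<in> space M \<Longrightarrow> convergent (\<lambda>n. code_cdf (Y n \<omega>) k)"
    and tight: "\<And>\<omega> \<epsilon>. \<omega> \<in> space M \<Longrightarrow> \<epsilon> > 0 \<Longrightarrow>
      \<exists>k. lim (\<lambda>n. code_cdf (Y n \<omega>) k) > 1 - \<epsilon>"
  obtains \<kappa> where "\<kappa> \<in> M \<rightarrow>\<^sub>M prob_algebra borel"
    "\<And>\<omega> w. \<omega> \<in> space M \<Longrightarrow> (\<And>y. open {p. y < w p}) \<Longrightarrow>
      (\<integral>\<^sup>+ p. w p \<partial>\<kappa> \<omega>) \<le> liminf (\<lambda>n. \<integral>\<^sup>+ p. w p \<partial>Y n \<omega>)"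
proof -
  obtain \<pi> where \<pi>: "continuous_on UNIV \<pi>" "\<And>p. \<pi> (plane_code p) = p"
    using plane_code_left_inverse by metis
  have [measurable]: "\<pi> \<in> borel_measurable borel"
    by (rule borel_measurable_continuous_onI[OF \<pi>(1)])
  note Ysp = measurable_space[OF Y, unfolded space_prob_algebra mem_Collect_eq]
  define N where "N n \<omega> = distr (Y n \<omega>) borel plane_code" for n \<omega>
  define \<xi> where "\<xi> \<omega> q = lim (\<lambda>n. cdf (N n \<omega>) q)" for \<omega> q
  have N: "real_distribution (N n \<omega>)" if "\<omega> \<in> space M" for n \<omega>
  proof -
    have "prob_space (N n \<omega>)"
      unfolding N_def using Ysp[OF that] by (intro prob_space.prob_space_distr) (auto cong: measurable_cong_sets)
    then show ?thesis
      unfolding real_distribution_def real_distribution_axioms_def by (simp add: N_def)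
  qed
  have cdf_N: "cdf (N n \<omega>) z = measure (Y n \<omega>) {p. plane_code p \<le> z}" if "\<omega> \<in> space M" for n \<omega> z
  proof -
    have s: "sets (Y n \<omega>) = sets borel" using Ysp[OF that] by simp
    then have "plane_code \<in> Y n \<omega> \<rightarrow>\<^sub>M borel" by (simp cong: measurable_cong_sets)
    then show ?thesis
      unfolding cdf_def N_def
      by (subst measure_distr) (auto simp: vimage_def sets_eq_imp_space_eq[OF s])
  qed
  have N_lim: "(\<lambda>n. cdf (N n \<omega>) q) \<longlonglongrightarrow> \<xi> \<omega> q" if "\<omega> \<in> space M" "q \<in> \<rat>" for \<omega> q
    using enum_rat_surj[OF that(2)] conv[OF that(1)]
    by (auto simp: \<xi>_def cdf_N[OF that(1)] code_cdf_def convergent_LIMSEQ_iff)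
  have N_bot: "cdf (N n \<omega>) (-1) = 0" if "\<omega> \<in> space M" for n \<omega>
  proof -
    have "\<not> plane_code p \<le> -1" for p using plane_code_nonneg[of p] by linarith
    then have "{p. plane_code p \<le> -1} = {}" by blast
    then show ?thesis by (simp only: cdf_N[OF that] measure_empty)
  qed
  have N_top: "\<exists>q\<in>\<rat>. \<xi> \<omega> q > 1 - \<epsilon>" if \<omega>: "\<omega> \<in> space M" and \<epsilon>: "\<epsilon> > 0" for \<omega> \<epsilon>
  proof -
    obtain k where "lim (\<lambda>n. code_cdf (Y n \<omega>) k) > 1 - \<epsilon>" using tight[OF \<omega> \<epsilon>] by blast
    then show ?thesis
      by (intro bexI[of _ "enum_rat k"])
         (auto simp: \<xi>_def cdf_N[OF \<omega>] code_cdf_def enum_rat_def)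
  qed
  note W = weak_conv_of_rational_cdf_limits[OF N N_lim N_bot N_top]
  define \<nu> where "\<nu> \<omega> = interval_measure (rat_inf (\<xi> \<omega>))" for \<omega>
  have \<nu>: "real_distribution (\<nu> \<omega>)" if "\<omega> \<in> space M" for \<omega>
    unfolding \<nu>_def by (rule W(1)) (use that in auto)
  \<comment> \<open>Half-lines generate the Borel sets, and on a half-line the limit law is a
    countable infimum of limits of measurable functions.\<close>
  have \<nu>_kernel: "\<nu> \<in> M \<rightarrow>\<^sub>M prob_algebra borel"
  proof (rule measurable_prob_algebra_generated)
    show "sets borel = sigma_sets UNIV (range (\<lambda>a::real. {..a}))"
      by (subst borel_eq_atMost) simp
    show "Int_stable (range (\<lambda>a::real. {..a}))"
      by (auto simp: Int_stable_def)
    show "prob_space (\<nu> \<omega>)" "sets (\<nu> \<omega>) = sets borel" if "\<omega> \<in> space M" for \<omega>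
      using \<nu>[OF that] by (auto simp: real_distribution_def real_distribution_axioms_def)
    fix A :: "real set" assume "A \<in> range (\<lambda>a. {..a})"
    then obtain z where A: "A = {..z}" by auto
    have [measurable]: "(\<lambda>\<omega>. \<xi> \<omega> q) \<in> borel_measurable M" if "q \<in> \<rat>" for q
    proof (rule borel_measurable_LIMSEQ_real)
      show "(\<lambda>n. cdf (N n \<omega>) q) \<longlonglongrightarrow> \<xi> \<omega> q" if "\<omega> \<in> space M" for \<omega>
        using N_lim that \<open>q \<in> \<rat>\<close> by blast
      fix n
      note [measurable] = measurable_prob_algebraD[OF Y[of n]]
      have "(\<lambda>\<omega>. measure (Y n \<omega>) {p. plane_code p \<le> q}) \<in> borel_measurable M"
        unfolding measure_def by measurable
      then show "(\<lambda>\<omega>. cdf (N n \<omega>) q) \<in> borel_measurable M"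
        by (rule measurable_cong[THEN iffD1, rotated]) (simp add: cdf_N)
    qed
    have "(\<lambda>\<omega>. rat_inf (\<xi> \<omega>) z) \<in> borel_measurable M"
      unfolding rat_inf_def
      by (rule borel_measurable_cINF_real) (auto intro: countable_subset[OF _ countable_rat])
    then have "(\<lambda>\<omega>. ennreal (rat_inf (\<xi> \<omega>) z)) \<in> borel_measurable M" by measurable
    then show "(\<lambda>\<omega>. emeasure (\<nu> \<omega>) A) \<in> borel_measurable M"
    proof (rule measurable_cong[THEN iffD1, rotated])
      fix \<omega> assume \<omega>: "\<omega> \<in> space M"
      interpret real_distribution "\<nu> \<omega>" by (rule \<nu>[OF \<omega>])
      have "cdf (\<nu> \<omega>) = rat_inf (\<xi> \<omega>)" unfolding \<nu>_def by (rule W(2)) (use \<omega> in auto)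
      then show "ennreal (rat_inf (\<xi> \<omega>) z) = emeasure (\<nu> \<omega>) A"
        using fun_cong[of _ _ z] by (fastforce simp: A emeasure_eq_measure cdf_def)
    qed
  qed auto
  show ?thesis
  proof (rule that[of "\<lambda>\<omega>. distr (\<nu> \<omega>) borel \<pi>"])
    show "(\<lambda>\<omega>. distr (\<nu> \<omega>) borel \<pi>) \<in> M \<rightarrow>\<^sub>M prob_algebra borel"
      by (rule measurable_compose[OF \<nu>_kernel measurable_distr_prob_space]) measurable
    fix \<omega> and w :: "real \<times> real \<Rightarrow> ennreal"
    assume \<omega>: "\<omega> \<in> space M" and w: "\<And>y. open {p. y < w p}"
    have "weak_conv_m (\<lambda>n. N n \<omega>) (\<nu> \<omega>)"
      unfolding \<nu>_def by (rule W(3)) (use \<omega> in auto)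
    note lsc_nn_integral_le_liminf[OF N[OF \<omega>] \<nu>[OF \<omega>] this \<pi>(1) w]
    \<comment> \<open>\<open>\<pi>\<close> undoes the code, so the approximating laws return
      exactly. Only the limit law may charge points that are no codes, and there continuity of
      \<open>\<pi>\<close> is what counts.\<close>
    moreover have "distr (N n \<omega>) borel \<pi> = Y n \<omega>" for n
    proof -
      have s: "sets (Y n \<omega>) = sets borel" using Ysp[OF \<omega>] by simp
      have "distr (N n \<omega>) borel \<pi> = distr (Y n \<omega>) borel (\<pi> \<circ> plane_code)"
        unfolding N_def by (rule distr_distr) (auto cong: measurable_cong_sets simp: s)
      also have "\<dots> = Y n \<omega>" using distr_id2[OF s[symmetric]] by (simp add: comp_def \<pi>(2))
      finally show ?thesis .
    qed
    ultimately show "(\<integral>\<^sup>+ p. w p \<partial>distr (\<nu> \<omega>) borel \<pi>) \<le> liminf (\<lambda>n. \<integral>\<^sup>+ p. w p \<partial>Y n \<omega>)"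
      by simp
  qed
qed

lemma code_cdf_bounds:
  assumes "prob_space P"
  shows "0 \<le> code_cdf P k" "code_cdf P k \<le> 1"
  using prob_space.prob_le_1[OF assms] by (auto simp: code_cdf_def)

lemma code_cdf_mid_measure:
  assumes "prob_space P" "prob_space Q" "sets P = sets Q"
  shows "code_cdf (mid_measure P Q) k = (code_cdf P k + code_cdf Q k) / 2"
proof -
  interpret P: prob_space P by fact
  interpret Q: prob_space Q by fact
  have "emeasure (mid_measure P Q) S = ennreal ((measure P S + measure Q S) / 2)" for S
    by (simp add: emeasure_mid_measure assms(3) P.emeasure_eq_measure Q.emeasure_eq_measure
      ennreal_plus[symmetric] ennreal_divide_numeral del: ennreal_plus)
  then show ?thesis by (simp add: code_cdf_def measure_def)
qed

lemma code_cdf_kernel_measurable: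
  assumes "K \<in> M \<rightarrow>\<^sub>M prob_algebra borel"
  shows "(\<lambda>\<omega>. code_cdf (K \<omega>) k) \<in> borel_measurable M"
proof -
  note [measurable] = measurable_prob_algebraD[OF assms]
  show ?thesis unfolding code_cdf_def measure_def by measurable
qed

section \<open>Compactness and attainment of minima for lower semicontinuous costs\<close>

definition kernel_cost :: "'w measure \<Rightarrow> ('w \<Rightarrow> real \<times> real \<Rightarrow> ennreal) \<Rightarrow> ('w \<Rightarrow> (real \<times> real) measure) \<Rightarrow> ennreal" where
  "kernel_cost M w K = (\<integral>\<^sup>+ \<omega>. \<integral>\<^sup>+ p. w \<omega> p \<partial>K \<omega> \<partial>M)"

text \<open>Nonnegative normal integrands: lower semicontinuous in space, phrased by open strict
  superlevel sets, and only measurable in the parameter. The value \<open>\<top>\<close> is allowed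
  and can express support constraints.\<close>

definition lsc_integrand :: "'w measure \<Rightarrow> ('w \<Rightarrow> real \<times> real \<Rightarrow> ennreal) \<Rightarrow> bool" where
  "lsc_integrand M w \<longleftrightarrow> (\<forall>\<omega> y. open {p. y < w \<omega> p}) \<and> (\<lambda>(\<omega>, p). w \<omega> p) \<in> borel_measurable (M \<Otimes>\<^sub>M borel)"

text \<open>Here \<open>d\<close> is the squared distance of coded distribution functions in a
  weighted \<open>L\<^sup>2\<close> space. The selected kernels approach each other at a geometric
  rate, so the whole sequence converges at almost every \<open>\<omega>\<close>. The limit
  inequality holds for all integrands along one and the same sequence; this lets an uncountable
  family of constraints pass to the limit together.\<close>

lemma kernel_compactness:
  fixes C :: "nat \<Rightarrow> ('w \<Rightarrow> (real \<times> real) measure) set"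
  assumes M: "finite_measure M"
    and ne: "\<And>n. C n \<noteq> {}" and dec: "decseq C"
    and ker: "\<And>K. K \<in> C 0 \<Longrightarrow> K \<in> M \<rightarrow>\<^sub>M prob_algebra borel"
    and mid: "\<And>n K L. K \<in> C n \<Longrightarrow> L \<in> C n \<Longrightarrow> (\<lambda>\<omega>. mid_measure (K \<omega>) (L \<omega>)) \<in> C n"
    and tight: "\<And>\<epsilon>. \<epsilon> > 0 \<Longrightarrow>
      \<exists>R. \<forall>K\<in>C 0. (\<integral>\<^sup>+ \<omega>. emeasure (K \<omega>) {p. R < norm p} \<partial>M) \<le> ennreal \<epsilon>"
  shows "\<exists>X \<kappa>. (\<forall>n. X n \<in> C n) \<and> \<kappa> \<in> M \<rightarrow>\<^sub>M prob_algebra borel \<and>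
    (\<forall>w. lsc_integrand M w \<longrightarrow> kernel_cost M w \<kappa> \<le> liminf (\<lambda>n. kernel_cost M w (X n)))"
proof -
  interpret M: finite_measure M by fact
  have C0: "K \<in> C 0" if "K \<in> C n" for K n using dec that by (auto simp: decseq_def)
  note sp = measurable_space[OF ker, unfolded space_prob_algebra mem_Collect_eq]
  have ps: "prob_space (K \<omega>)" "sets (K \<omega>) = sets borel" if "K \<in> C 0" "\<omega> \<in> space M" for K \<omega>
    using sp[OF that] by auto
  note [measurable] = code_cdf_kernel_measurable[OF ker]
  have em [measurable]: "(\<lambda>\<omega>. cdf_energy (code_cdf (K \<omega>))) \<in> borel_measurable M"
    "(\<lambda>\<omega>. cdf_energy (\<lambda>k. code_cdf (K \<omega>) k - code_cdf (L \<omega>) k)) \<in> borel_measurable M"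
    if "K \<in> C 0" "L \<in> C 0" for K L
    unfolding cdf_energy_def using that by measurable
  have b1: "\<bar>code_cdf (K \<omega>) k\<bar> \<le> 1" if "K \<in> C 0" "\<omega> \<in> space M" for K \<omega> k
    using code_cdf_bounds[OF ps(1)[OF that]] by simp
  have b2: "\<bar>code_cdf (K \<omega>) k - code_cdf (L \<omega>) k\<bar> \<le> 1" if "K \<in> C 0" "L \<in> C 0" "\<omega> \<in> space M" for K L \<omega> k
    using code_cdf_bounds[OF ps(1)[OF that(1,3)], of k] code_cdf_bounds[OF ps(1)[OF that(2,3)], of k]
    by (simp add: abs_le_iff)
  have i1: "integrable M (\<lambda>\<omega>. cdf_energy (code_cdf (K \<omega>)))" if "K \<in> C 0" for K
    by (rule M.integrable_const_bound[of _ 2])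
       (use that cdf_energy_bounds[OF b1[OF that]] in \<open>auto intro!: em AE_I2\<close>)
  have i2: "integrable M (\<lambda>\<omega>. cdf_energy (\<lambda>k. code_cdf (K \<omega>) k - code_cdf (L \<omega>) k))"
    if "K \<in> C 0" "L \<in> C 0" for K L
    by (rule M.integrable_const_bound[of _ 2])
       (use that cdf_energy_bounds[OF b2[OF that]] in \<open>auto intro!: em AE_I2\<close>)
  define J where "J K = (\<integral>\<omega>. cdf_energy (code_cdf (K \<omega>)) \<partial>M)" for K
  define d where "d K L = (\<integral>\<omega>. cdf_energy (\<lambda>k. code_cdf (K \<omega>) k - code_cdf (L \<omega>) k) \<partial>M)" for K L
  let ?mid = "\<lambda>K L \<omega>. mid_measure (K \<omega>) (L \<omega>)"
  have J_bounds: "0 \<le> J K \<and> J K \<le> 2 * measure M (space M)" if "K \<in> C 0" for K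
  proof
    show "0 \<le> J K" unfolding J_def
      by (rule integral_nonneg_AE) (use cdf_energy_bounds[OF b1[OF that]] in auto)
    have "J K \<le> (\<integral>\<omega>. 2 \<partial>M)" unfolding J_def
      by (rule integral_mono[OF i1[OF that]]) (use cdf_energy_bounds[OF b1[OF that]] in auto)
    then show "J K \<le> 2 * measure M (space M)" by (simp add: mult.commute)
  qed
  have par: "d K L = 2 * J K + 2 * J L - 4 * J (?mid K L)" if KL: "K \<in> C 0" "L \<in> C 0" for K L
  proof -
    have "d K L = (\<integral>\<omega>. 2 * cdf_energy (code_cdf (K \<omega>)) + 2 * cdf_energy (code_cdf (L \<omega>))
        - 4 * cdf_energy (code_cdf (?mid K L \<omega>)) \<partial>M)"
      unfolding d_def
    proof (rule Bochner_Integration.integral_cong[OF refl])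
      fix \<omega> assume \<omega>: "\<omega> \<in> space M"
      have "code_cdf (?mid K L \<omega>) = (\<lambda>k. (code_cdf (K \<omega>) k + code_cdf (L \<omega>) k) / 2)"
        by (rule ext, rule code_cdf_mid_measure) (use ps KL \<omega> in auto)
      then show "cdf_energy (\<lambda>k. code_cdf (K \<omega>) k - code_cdf (L \<omega>) k) =
        2 * cdf_energy (code_cdf (K \<omega>)) + 2 * cdf_energy (code_cdf (L \<omega>))
        - 4 * cdf_energy (code_cdf (?mid K L \<omega>))"
        using cdf_energy_parallelogram[OF b1[OF KL(1) \<omega>] b1[OF KL(2) \<omega>] b2[OF KL \<omega>]] by simp
    qed
    also have "\<dots> = 2 * J K + 2 * J L - 4 * J (?mid K L)"
      unfolding J_def using i1[OF KL(1)] i1[OF KL(2)] i1[OF mid[OF KL]] by simp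
    finally show ?thesis .
  qed
  obtain X where X: "\<And>n. X n \<in> C n" and dX: "\<And>n. d (X n) (X (Suc n)) \<le> (1/4) ^ n"
    using parallelogram_minimizing_sequence[of C ?mid J _ d, OF ne dec mid J_bounds par] by blast
  note X0 = C0[OF X]
  define \<delta> where "\<delta> n \<omega> = cdf_energy (\<lambda>k. code_cdf (X n \<omega>) k - code_cdf (X (Suc n) \<omega>) k)" for n \<omega>
  have \<delta>_nonneg: "0 \<le> \<delta> n \<omega>" if "\<omega> \<in> space M" for n \<omega>
    unfolding \<delta>_def by (rule cdf_energy_bounds(1), rule b2[OF X0 X0 that])
  have [measurable]: "\<delta> n \<in> borel_measurable M" for n
    unfolding \<delta>_def by (rule em[OF X0 X0])
  \<comment> \<open>The integrals of \<open>\<delta> n\<close> are at most \<open>(1/4) ^ n\<close>,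
    so the sum stays finite with the weights \<open>2 ^ n\<close>. Hence at almost every
    \<open>\<omega>\<close> the energies \<open>\<delta> n \<omega>\<close> are bounded by a
    multiple of \<open>(1/2) ^ n\<close>.\<close>
  have "(\<integral>\<^sup>+ \<omega>. (\<Sum>n. ennreal (2 ^ n * \<delta> n \<omega>)) \<partial>M) = (\<Sum>n. \<integral>\<^sup>+ \<omega>. ennreal (2 ^ n * \<delta> n \<omega>) \<partial>M)"
    by (rule nn_integral_suminf) measurable
  also have "\<dots> \<le> (\<Sum>n. ennreal ((1/2) ^ n))"
  proof (intro suminf_le)
    fix n
    have "integrable M (\<delta> n)" unfolding \<delta>_def by (rule i2[OF X0 X0])
    then have "(\<integral>\<^sup>+ \<omega>. ennreal (2 ^ n * \<delta> n \<omega>) \<partial>M) = ennreal (2 ^ n * d (X n) (X (Suc n)))"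
      unfolding d_def \<delta>_def[symmetric]
      by (subst nn_integral_eq_integral) (simp_all add: \<delta>_nonneg AE_I2)
    moreover have "2 ^ n * d (X n) (X (Suc n)) \<le> (1/2) ^ n"
      using mult_left_mono[OF dX[of n], of "2 ^ n"] by (simp add: power_mult_distrib[symmetric])
    ultimately show "(\<integral>\<^sup>+ \<omega>. ennreal (2 ^ n * \<delta> n \<omega>) \<partial>M) \<le> ennreal ((1/2) ^ n)"
      by (simp add: ennreal_leI)
  qed auto
  also have "\<dots> = ennreal (\<Sum>n. (1/2) ^ n)"
    by (rule suminf_ennreal2) (auto intro: summable_geometric)
  finally have "(\<integral>\<^sup>+ \<omega>. (\<Sum>n. ennreal (2 ^ n * \<delta> n \<omega>)) \<partial>M) \<noteq> \<infinity>"
    by (auto simp: top_unique)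
  then have "AE \<omega> in M. (\<Sum>n. ennreal (2 ^ n * \<delta> n \<omega>)) \<noteq> \<infinity>"
    by (intro nn_integral_noteq_infinite) measurable
  then have ae1: "AE \<omega> in M. \<forall>k. convergent (\<lambda>n. code_cdf (X n \<omega>) k)"
    using AE_space
  proof eventually_elim
    case (elim \<omega>)
    then obtain S where S: "0 \<le> S" "(\<Sum>n. ennreal (2 ^ n * \<delta> n \<omega>)) = ennreal S"
      by (metis ennreal_cases infinity_ennreal_def)
    have \<delta>S: "2 ^ n * \<delta> n \<omega> \<le> S" for n
    proof -
      have "ennreal (2 ^ n * \<delta> n \<omega>) \<le> ennreal S"
        unfolding S(2)[symmetric] using sum_le_suminf[of "\<lambda>n. ennreal (2 ^ n * \<delta> n \<omega>)" "{n}"] by simp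
      then show ?thesis using S(1) by simp
    qed
    show ?case
    proof
      fix k
      show "convergent (\<lambda>n. code_cdf (X n \<omega>) k)"
      proof (rule convergent_of_geometric_square_increments)
        fix n
        \<comment> \<open>One coordinate is controlled by the energy up to its weight; the resulting
          constant may depend on \<open>k\<close> and \<open>\<omega>\<close>.\<close>
        have le: "(1/2) ^ k * (code_cdf (X n \<omega>) k - code_cdf (X (Suc n) \<omega>) k)\<^sup>2 \<le> \<delta> n \<omega>"
          unfolding \<delta>_def cdf_energy_def
          using sum_le_suminf[OF summable_cdf_energy[OF b2[OF X0 X0 elim(2)]], of "{k}"] by simp
        have "2 ^ n * ((1/2) ^ k * (code_cdf (X n \<omega>) k - code_cdf (X (Suc n) \<omega>) k)\<^sup>2) \<le> S"
          by (rule order_trans[OF mult_left_mono[OF le] \<delta>S]) simp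
        then have "2 ^ k * (1/2) ^ n * (2 ^ n * ((1/2) ^ k * (code_cdf (X n \<omega>) k - code_cdf (X (Suc n) \<omega>) k)\<^sup>2))
            \<le> 2 ^ k * (1/2) ^ n * S"
          by (rule mult_left_mono) simp
        also have "2 ^ k * (1/2) ^ n * (2 ^ n * ((1/2) ^ k * (code_cdf (X n \<omega>) k - code_cdf (X (Suc n) \<omega>) k)\<^sup>2))
            = (code_cdf (X n \<omega>) k - code_cdf (X (Suc n) \<omega>) k)\<^sup>2"
          by (simp add: power_divide)
        finally show "(code_cdf (X n \<omega>) k - code_cdf (X (Suc n) \<omega>) k)\<^sup>2 \<le> (2 ^ k * S) * (1/2) ^ n"
          by (simp only: mult_ac)
      qed
    qed
  qed
  \<comment> \<open>Tightness is assumed only after integration over \<open>\<omega>\<close>. The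
    mass escaping at a fixed \<open>\<omega>\<close> is the infimum over \<open>r\<close> of the
    lower limits of these tails; by Fatou its integral is below every \<open>\<epsilon>\<close>, so
    it vanishes almost everywhere.\<close>
  define tail where "tail r n \<omega> = emeasure (X n \<omega>) {p. real r < plane_code p}" for r n \<omega>
  have [measurable]: "tail r n \<in> borel_measurable M" for r n
  proof -
    note [measurable] = measurable_prob_algebraD[OF ker[OF X0[of n]]]
    show ?thesis unfolding tail_def by measurable
  qed
  have "(\<integral>\<^sup>+ \<omega>. (INF r. liminf (\<lambda>n. tail r n \<omega>)) \<partial>M) \<le> 0 + ennreal \<epsilon>" if "\<epsilon> > 0" for \<epsilon>
  proof -
    obtain R where R: "\<And>K. K \<in> C 0 \<Longrightarrow> (\<integral>\<^sup>+ \<omega>. emeasure (K \<omega>) {p. R < norm p} \<partial>M) \<le> ennreal \<epsilon>"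
      using tight[OF \<open>\<epsilon> > 0\<close>] by blast
    obtain q where q: "\<And>p. norm p \<le> R \<Longrightarrow> plane_code p \<le> q"
      using plane_code_bounded[of R] by blast
    obtain r where r: "q \<le> real r" using real_arch_simple by blast
    have "(\<integral>\<^sup>+ \<omega>. (INF r. liminf (\<lambda>n. tail r n \<omega>)) \<partial>M) \<le> (\<integral>\<^sup>+ \<omega>. liminf (\<lambda>n. tail r n \<omega>) \<partial>M)"
      by (intro nn_integral_mono INF_lower) auto
    also have "\<dots> \<le> liminf (\<lambda>n. \<integral>\<^sup>+ \<omega>. tail r n \<omega> \<partial>M)"
      by (rule nn_integral_liminf) measurable
    also have "\<dots> \<le> liminf (\<lambda>n. ennreal \<epsilon>)"
    proof (intro Liminf_mono always_eventually allI)
      fix n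
      have "(\<integral>\<^sup>+ \<omega>. tail r n \<omega> \<partial>M) \<le> (\<integral>\<^sup>+ \<omega>. emeasure (X n \<omega>) {p. R < norm p} \<partial>M)"
      proof (rule nn_integral_mono)
        fix \<omega> assume \<omega>: "\<omega> \<in> space M"
        have "{p::real\<times>real. R < norm p} \<in> sets borel" by measurable
        moreover have "R < norm p" if "real r < plane_code p" for p
          using q[of p] r that by linarith
        ultimately show "tail r n \<omega> \<le> emeasure (X n \<omega>) {p. R < norm p}"
          unfolding tail_def using ps(2)[OF X0 \<omega>] by (intro emeasure_mono) auto
      qed
      also have "\<dots> \<le> ennreal \<epsilon>" by (rule R[OF X0])
      finally show "(\<integral>\<^sup>+ \<omega>. tail r n \<omega> \<partial>M) \<le> ennreal \<epsilon>" .
    qed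
    finally show ?thesis by (simp add: Liminf_const)
  qed
  then have "(\<integral>\<^sup>+ \<omega>. (INF r. liminf (\<lambda>n. tail r n \<omega>)) \<partial>M) \<le> 0"
    by (rule ennreal_le_epsilon)
  then have ae2: "AE \<omega> in M. (INF r. liminf (\<lambda>n. tail r n \<omega>)) = 0"
    by (subst nn_integral_0_iff_AE[symmetric]) auto
  define good where "good \<omega> \<longleftrightarrow> (\<forall>k. convergent (\<lambda>n. code_cdf (X n \<omega>) k)) \<and>
    (INF r. liminf (\<lambda>n. tail r n \<omega>)) = 0" for \<omega>
  have "AE \<omega> in M. good \<omega>" using ae1 ae2 by eventually_elim (simp add: good_def)
  then obtain Z where Z: "{\<omega>\<in>space M. \<not> good \<omega>} \<subseteq> Z" "emeasure M Z = 0" "Z \<in> sets M"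
    by (rule AE_E)
  \<comment> \<open>On the null set a constant Dirac law makes convergence and tightness trivial.
    The limit kernel is then defined and measurable everywhere, and no cost changes.\<close>
  define Y where "Y n \<omega> = (if \<omega> \<in> Z then return borel 0 else X n \<omega>)" for n \<omega>
  have Y: "Y n \<in> M \<rightarrow>\<^sub>M prob_algebra borel" for n
    unfolding Y_def using Z(3) ker[OF X0]
    by (intro measurable_If_set measurable_const) (auto simp: space_prob_algebra prob_space_return)
  have Y_conv: "convergent (\<lambda>n. code_cdf (Y n \<omega>) k)" if "\<omega> \<in> space M" for \<omega> k
    using Z(1) that by (cases "\<omega> \<in> Z") (auto simp: Y_def good_def convergent_const)
  have Y_tight: "\<exists>k. lim (\<lambda>n. code_cdf (Y n \<omega>) k) > 1 - \<epsilon>" if \<omega>: "\<omega> \<in> space M" and "\<epsilon> > 0" for \<omega> \<epsilon>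
  proof (cases "\<omega> \<in> Z")
    case True
    obtain r where r: "plane_code 0 \<le> real r" using real_arch_simple by blast
    obtain k where k: "real r = enum_rat k" using enum_rat_surj[of "real r"] by auto
    have "lim (\<lambda>n. code_cdf (Y n \<omega>) k) = 1"
      using True r k by (simp add: Y_def code_cdf_def measure_return indicator_def)
    then show ?thesis using \<open>\<epsilon> > 0\<close> by (intro exI[of _ k]) simp
  next
    case False
    then have "good \<omega>" using Z(1) \<omega> by auto
    then have "(INF r. liminf (\<lambda>n. tail r n \<omega>)) < ennreal \<epsilon>" using \<open>\<epsilon> > 0\<close> by (simp add: good_def)
    then obtain r where r: "liminf (\<lambda>n. tail r n \<omega>) < ennreal \<epsilon>" by (auto simp: INF_less_iff)
    obtain k where k: "real r = enum_rat k" using enum_rat_surj[of "real r"] by auto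
    let ?l = "lim (\<lambda>n. code_cdf (X n \<omega>) k)"
    have l: "(\<lambda>n. code_cdf (X n \<omega>) k) \<longlonglongrightarrow> ?l"
      using \<open>good \<omega>\<close> by (simp add: good_def convergent_LIMSEQ_iff)
    have "tail r n \<omega> = ennreal (1 - code_cdf (X n \<omega>) k)" for n
    proof -
      interpret P: prob_space "X n \<omega>" by (rule ps(1)[OF X0 \<omega>])
      note s = ps(2)[OF X0[of n] \<omega>]
      have "{p. real r < plane_code p} = space (X n \<omega>) - {p. plane_code p \<le> enum_rat k}"
        using sets_eq_imp_space_eq[OF s] by (auto simp: k)
      then show ?thesis
        unfolding tail_def code_cdf_def P.emeasure_eq_measure
        by (simp add: P.prob_compl s)
    qed
    \<comment> \<open>Convergence of the distribution function at \<open>real r\<close> turns the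
      lower limit of the tails into a limit, so a small lower limit is enough.\<close>
    then have "(\<lambda>n. tail r n \<omega>) \<longlonglongrightarrow> ennreal (1 - ?l)"
      by (simp add: tendsto_ennrealI tendsto_diff l)
    then have "liminf (\<lambda>n. tail r n \<omega>) = ennreal (1 - ?l)"
      by (rule lim_imp_Liminf[OF sequentially_bot])
    then have "1 - ?l < \<epsilon>" using r by (metis ennreal_leI not_le)
    then show ?thesis using False by (intro exI[of _ k]) (simp add: Y_def)
  qed
  obtain \<kappa> where \<kappa>: "\<kappa> \<in> M \<rightarrow>\<^sub>M prob_algebra borel"
    "\<And>\<omega> w. \<omega> \<in> space M \<Longrightarrow> (\<And>y. open {p. y < w p}) \<Longrightarrow>
      (\<integral>\<^sup>+ p. w p \<partial>\<kappa> \<omega>) \<le> liminf (\<lambda>n. \<integral>\<^sup>+ p. w p \<partial>Y n \<omega>)"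
    using kernel_limit_of_code_cdfs[OF Y Y_conv Y_tight] by metis
  have ae: "AE \<omega> in M. \<forall>n. Y n \<omega> = X n \<omega>"
    by (rule AE_I[OF _ Z(2,3)]) (auto simp: Y_def)
  have "kernel_cost M w \<kappa> \<le> liminf (\<lambda>n. kernel_cost M w (X n))" if w: "lsc_integrand M w" for w
  proof -
    have lsc: "open {p. y < w \<omega> p}" for \<omega> y using w by (simp add: lsc_integrand_def)
    have [measurable]: "(\<lambda>(\<omega>, p). w \<omega> p) \<in> borel_measurable (M \<Otimes>\<^sub>M borel)"
      using w by (simp add: lsc_integrand_def)
    note [measurable] = nn_integral_measurable_subprob_algebra2[OF _ measurable_prob_algebraD[OF Y]]
    \<comment> \<open>Semicontinuity is applied at each fixed \<open>\<omega>\<close>, and Fatou's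
      lemma over \<open>\<omega>\<close> follows. No regularity of \<open>w\<close> in
      \<open>\<omega>\<close> beyond measurability enters.\<close>
    have "(\<integral>\<^sup>+ \<omega>. \<integral>\<^sup>+ p. w \<omega> p \<partial>\<kappa> \<omega> \<partial>M) \<le> (\<integral>\<^sup>+ \<omega>. liminf (\<lambda>n. \<integral>\<^sup>+ p. w \<omega> p \<partial>Y n \<omega>) \<partial>M)"
      by (intro nn_integral_mono \<kappa>(2) lsc)
    also have "\<dots> \<le> liminf (\<lambda>n. \<integral>\<^sup>+ \<omega>. \<integral>\<^sup>+ p. w \<omega> p \<partial>Y n \<omega> \<partial>M)"
      by (rule nn_integral_liminf) measurable
    also have "(\<lambda>n. \<integral>\<^sup>+ \<omega>. \<integral>\<^sup>+ p. w \<omega> p \<partial>Y n \<omega> \<partial>M) = (\<lambda>n. \<integral>\<^sup>+ \<omega>. \<integral>\<^sup>+ p. w \<omega> p \<partial>X n \<omega> \<partial>M)"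
      by (intro ext nn_integral_cong_AE) (use ae in auto)
    finally show ?thesis by (simp add: kernel_cost_def)
  qed
  with X \<kappa>(1) show ?thesis by blast
qed

lemma kernel_cost_mid_measure:
  assumes K: "K \<in> M \<rightarrow>\<^sub>M prob_algebra borel" and L: "L \<in> M \<rightarrow>\<^sub>M prob_algebra borel"
    and w: "lsc_integrand M w"
  shows "kernel_cost M w (\<lambda>\<omega>. mid_measure (K \<omega>) (L \<omega>)) = (kernel_cost M w K + kernel_cost M w L) / 2"
proof -
  have wm: "(\<lambda>(\<omega>, p). w \<omega> p) \<in> borel_measurable (M \<Otimes>\<^sub>M borel)" using w by (simp add: lsc_integrand_def)
  have wp: "w \<omega> \<in> borel_measurable borel" for \<omega>
    using w by (auto simp: lsc_integrand_def intro!: borel_measurableI_greater borel_open)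
  note [measurable] = nn_integral_measurable_subprob_algebra2[OF wm measurable_prob_algebraD[OF K]]
    nn_integral_measurable_subprob_algebra2[OF wm measurable_prob_algebraD[OF L]]
  have "kernel_cost M w (\<lambda>\<omega>. mid_measure (K \<omega>) (L \<omega>)) =
    (\<integral>\<^sup>+ \<omega>. ((\<integral>\<^sup>+ p. w \<omega> p \<partial>K \<omega>) + (\<integral>\<^sup>+ p. w \<omega> p \<partial>L \<omega>)) / 2 \<partial>M)"
    unfolding kernel_cost_def
  proof (rule nn_integral_cong)
    fix \<omega> assume \<omega>: "\<omega> \<in> space M"
    have s: "sets (K \<omega>) = sets borel" "sets (L \<omega>) = sets borel"
      using measurable_space[OF K \<omega>] measurable_space[OF L \<omega>] by (auto simp: space_prob_algebra)
    show "(\<integral>\<^sup>+ p. w \<omega> p \<partial>mid_measure (K \<omega>) (L \<omega>)) = ((\<integral>\<^sup>+ p. w \<omega> p \<partial>K \<omega>) + (\<integral>\<^sup>+ p. w \<omega> p \<partial>L \<omega>)) / 2"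
      by (rule nn_integral_mid_measure) (use s wp[of \<omega>] in \<open>auto cong: measurable_cong_sets\<close>)
  qed
  also have "\<dots> = (kernel_cost M w K + kernel_cost M w L) / 2"
    unfolding kernel_cost_def by (simp add: nn_integral_divide nn_integral_add)
  finally show ?thesis .
qed

text \<open>The direct method, run on whole sets of near-minimizers. Costs are affine under
  midpoints, so the sets \<open>C n\<close> are midpoint-convex and nested, as
  \<open>kernel_compactness\<close> requires; a single minimizing sequence chosen in advance would
  not do.\<close>

theorem kernel_cost_attains_minimum:
  fixes M :: "'w measure" and I :: "'i set" and w :: "'i \<Rightarrow> 'w \<Rightarrow> real \<times> real \<Rightarrow> ennreal" and c :: "'i \<Rightarrow> ennreal"
  defines "S \<equiv> {K \<in> M \<rightarrow>\<^sub>M prob_algebra borel. \<forall>i\<in>I. kernel_cost M (w i) K \<le> c i}"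
  assumes M: "finite_measure M" and ne: "S \<noteq> {}"
    and w: "\<And>i. i \<in> I \<Longrightarrow> lsc_integrand M (w i)" and w0: "lsc_integrand M w0"
    and tight: "\<And>\<epsilon>. \<epsilon> > 0 \<Longrightarrow>
      \<exists>R. \<forall>K\<in>S. (\<integral>\<^sup>+ \<omega>. emeasure (K \<omega>) {p. R < norm p} \<partial>M) \<le> ennreal \<epsilon>"
  shows "\<exists>K\<in>S. \<forall>L\<in>S. kernel_cost M w0 K \<le> kernel_cost M w0 L"
proof -
  define v where "v = (INF K\<in>S. kernel_cost M w0 K)"
  define C where "C n = {K\<in>S. kernel_cost M w0 K \<le> v + ennreal (1 / Suc n)}" for n
  have half: "(x + y) / 2 \<le> z" if "x \<le> z" "y \<le> z" for x y z :: ennreal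
    using divide_right_mono_ennreal[OF add_mono[OF that], of 2] by (simp add: half_add_self_ennreal)
  have C_S: "C n \<subseteq> S" for n by (auto simp: C_def)
  have ker: "K \<in> M \<rightarrow>\<^sub>M prob_algebra borel" if "K \<in> S" for K using that by (simp add: S_def)
  have Cne: "C n \<noteq> {}" for n
  \<comment> \<open>If every cost is infinite, the bound in \<open>C n\<close> is vacuous and
    \<open>C n\<close> is all of \<open>S\<close>.\<close>
  proof (cases "v = \<infinity>")
    case True
    then show ?thesis using ne by (auto simp: C_def)
  next
    case False
    then have "v < v + ennreal (1 / Suc n)"
      by (simp add: ennreal_add_left_cancel_less[of v 0, simplified] less_top)
    then obtain K where "K \<in> S" "kernel_cost M w0 K < v + ennreal (1 / Suc n)"
      by (metis v_def INF_less_iff)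
    then show ?thesis by (auto simp: C_def)
  qed
  have dec: "decseq C"
    unfolding decseq_def C_def
    by (auto intro: order_trans add_left_mono ennreal_leI simp: frac_le)
  have Cmid: "(\<lambda>\<omega>. mid_measure (K \<omega>) (L \<omega>)) \<in> C n" if "K \<in> C n" "L \<in> C n" for n K L
  proof -
    have KL: "K \<in> S" "L \<in> S" using that C_S by auto
    show ?thesis
      using that KL unfolding C_def S_def
      by (simp add: mid_measure_kernel kernel_cost_mid_measure w w0 half)
  qed
  have Ctight: "\<exists>R. \<forall>K\<in>C 0. (\<integral>\<^sup>+ \<omega>. emeasure (K \<omega>) {p. R < norm p} \<partial>M) \<le> ennreal \<epsilon>" if "\<epsilon> > 0" for \<epsilon>
    using tight[OF that] C_S[of 0] by blast
  have Cker: "K \<in> M \<rightarrow>\<^sub>M prob_algebra borel" if "K \<in> C 0" for K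
    using ker C_S that by blast
  obtain X \<kappa> where X: "\<And>n. X n \<in> C n" and \<kappa>: "\<kappa> \<in> M \<rightarrow>\<^sub>M prob_algebra borel"
    and lim: "\<And>w. lsc_integrand M w \<Longrightarrow> kernel_cost M w \<kappa> \<le> liminf (\<lambda>n. kernel_cost M w (X n))"
    using kernel_compactness[where C=C, OF M Cne dec Cker Cmid Ctight] by blast
  \<comment> \<open>Used with constant bounds for the constraints and with
    \<open>v + ennreal (1 / Suc n)\<close> for the objective.\<close>
  have le: "kernel_cost M w' \<kappa> \<le> l" if "lsc_integrand M w'" "\<And>n. kernel_cost M w' (X n) \<le> z n" "z \<longlonglongrightarrow> l" for w' z l
  proof -
    have "kernel_cost M w' \<kappa> \<le> liminf (\<lambda>n. kernel_cost M w' (X n))"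
      by (rule lim[OF that(1)])
    also have "\<dots> \<le> liminf z" using that(2) by (intro Liminf_mono) auto
    also have "\<dots> = l" using that(3) by (intro lim_imp_Liminf) auto
    finally show ?thesis .
  qed
  have "kernel_cost M (w i) \<kappa> \<le> c i" if "i \<in> I" for i
    by (rule le[OF w[OF that], of "\<lambda>_. c i"]) (use X that in \<open>auto simp: C_def S_def\<close>)
  then have "\<kappa> \<in> S"
    unfolding S_def using \<kappa> by simp
  moreover have "kernel_cost M w0 \<kappa> \<le> v"
  proof (rule le[OF w0])
    show "kernel_cost M w0 (X n) \<le> v + ennreal (1 / Suc n)" for n using X[of n] by (simp add: C_def)
    have "(\<lambda>n. v + ennreal (1 / Suc n)) \<longlonglongrightarrow> v + ennreal 0"
      by (intro tendsto_intros tendsto_ennrealI LIMSEQ_Suc[OF lim_1_over_n])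
    then show "(\<lambda>n. v + ennreal (1 / Suc n)) \<longlonglongrightarrow> v" by simp
  qed
  moreover have "v \<le> kernel_cost M w0 L" if "L \<in> S" for L
    unfolding v_def by (rule INF_lower[OF that])
  ultimately show ?thesis by (meson order_trans)
qed

section \<open>Semicontinuous functions and extended integrals\<close>

lemma closed_usc_on_level:
  assumes F: "closed F" and h: "usc_on F h"
  shows "closed {p\<in>F. c \<le> h p}"
proof -
  have nbhd: "\<exists>U. open U \<and> p \<in> U \<and> U \<subseteq> - {p\<in>F. c \<le> h p}" if p: "p \<in> - {p\<in>F. c \<le> h p}" for p
  proof (cases "p \<in> F")
    case True
    then have "h p < c" using p by auto
    then have "\<forall>\<^sub>F w in at p within F. h w < c" using h True by (auto simp: usc_on_def)
    then obtain U where "open U" "p \<in> U" "\<And>w. w \<in> U \<Longrightarrow> w \<noteq> p \<Longrightarrow> w \<in> F \<Longrightarrow> h w < c"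
      by (auto simp: eventually_at_topological)
    note U = this
    have "\<not> c \<le> h w" if "w \<in> U" "w \<in> F" for w
      using that U(3)[of w] \<open>h p < c\<close> by (cases "w = p") (auto simp: not_le)
    then have "U \<subseteq> - {p\<in>F. c \<le> h p}" by blast
    with U(1,2) show ?thesis by (intro exI conjI)
  next
    case False
    then show ?thesis using F by (intro exI[of _ "- F"]) auto
  qed
  have "open (- {p\<in>F. c \<le> h p})" by (subst open_subopen, intro ballI nbhd)
  then show ?thesis by (simp add: closed_open)
qed

lemma usc_on_borel_measurable:
  assumes F: "closed F" and h: "usc_on F h"
  shows "h \<in> borel_measurable (restrict_space borel F)"
proof (rule borel_measurableI_ge)
  fix c
  have "{p \<in> space (restrict_space borel F). c \<le> h p} = {p\<in>F. c \<le> h p}"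
    by (auto simp: space_restrict_space)
  also have "\<dots> \<in> sets (restrict_space borel F)"
    using closed_usc_on_level[OF F h, of c] F by (subst sets_restrict_space_iff) auto
  finally show "{p \<in> space (restrict_space borel F). c \<le> h p} \<in> sets (restrict_space borel F)" .
qed

lemma continuous_on_imp_usc_on: "continuous_on F h \<Longrightarrow> usc_on F h"
  unfolding usc_on_def continuous_on_def by (auto dest: order_tendstoD(2))

lemma closed_ennreal_cost_level:
  assumes F: "closed F" and h: "usc_on F h"
  shows "closed {p\<in>F. ennreal (B - h p) \<le> ennreal r}"
proof (cases "0 \<le> r")
  case True
  have "{p\<in>F. ennreal (B - h p) \<le> ennreal r} = {p\<in>F. B - r \<le> h p}"
    using True by (auto simp: ennreal_le_iff2)
  then show ?thesis using closed_usc_on_level[OF F h] by simp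
next
  \<comment> \<open>For negative \<open>r\<close> the value \<open>ennreal r\<close> is 0, so the
    sublevel set consists of the points with \<open>B \<le> h p\<close>.\<close>
  case False
  have "{p\<in>F. ennreal (B - h p) \<le> ennreal r} = {p\<in>F. B \<le> h p}"
    using False by (auto simp: ennreal_neg ennreal_eq_0_iff)
  then show ?thesis using closed_usc_on_level[OF F h] by simp
qed

text \<open>The bridge between nonnegative integrals of shifted integrands, to which semicontinuity
  applies, and the Bochner integrals of the linear program. The bound keeps \<open>B - h\<close>
  nonnegative almost everywhere, so \<open>ennreal\<close> truncates nothing.\<close>

lemma nn_integral_const_minus:
  assumes N: "finite_measure N" and h: "h \<in> borel_measurable N" and b: "AE x in N. \<bar>h x\<bar> \<le> B"
  shows "(\<integral>\<^sup>+ x. ennreal (B - h x) \<partial>N) = ennreal (B * measure N (space N) - (\<integral>x. h x \<partial>N))"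
    and "\<bar>\<integral>x. h x \<partial>N\<bar> \<le> B * measure N (space N)"
proof -
  interpret finite_measure N by fact
  have i: "integrable N h"
    by (rule integrable_const_bound[of _ B]) (use h b in auto)
  have "(\<integral>\<^sup>+ x. ennreal (B - h x) \<partial>N) = ennreal (\<integral>x. B - h x \<partial>N)"
    by (rule nn_integral_eq_integral) (use i b in auto)
  also have "(\<integral>x. B - h x \<partial>N) = B * measure N (space N) - (\<integral>x. h x \<partial>N)"
    using i by (simp add: mult.commute)
  finally show "(\<integral>\<^sup>+ x. ennreal (B - h x) \<partial>N) = ennreal (B * measure N (space N) - (\<integral>x. h x \<partial>N))" .
  have "\<bar>\<integral>x. h x \<partial>N\<bar> \<le> (\<integral>x. \<bar>h x\<bar> \<partial>N)" by simp
  also have "\<dots> \<le> (\<integral>x. B \<partial>N)" using i b by (intro integral_mono_AE) auto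
  finally show "\<bar>\<integral>x. h x \<partial>N\<bar> \<le> B * measure N (space N)" by (simp add: mult.commute)
qed

text \<open>The integral of \<open>h\<close> may be \<open>-\<infinity>\<close>. Splitting
  \<open>C - h\<close> into \<open>C - max 0 h\<close> and the negative part of \<open>h\<close>
  isolates the term that can be infinite; the other is a finite real, so no difference of infinities
  arises.\<close>

lemma ext_integral_eq_const_minus:
  assumes N: "prob_space N" and h: "h \<in> borel_measurable N" and C: "\<And>x. x \<in> space N \<Longrightarrow> h x \<le> C" "0 \<le> C"
  shows "ext_integral N h = ereal C - enn2ereal (\<integral>\<^sup>+ x. ennreal (C - h x) \<partial>N)"
proof -
  interpret prob_space N by fact
  define g where "g x = max 0 (h x)" for x
  have g[measurable]: "g \<in> borel_measurable N" unfolding g_def using h by measurable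
  have gC: "\<bar>g x\<bar> \<le> C" if "x \<in> space N" for x using C(1)[OF that] C(2) by (auto simp: g_def)
  have fin: "finite_measure N" by (rule finite_measure_axioms)
  have ig: "integrable N g"
    by (rule integrable_const_bound[of _ C, OF AE_I2]) (simp_all add: gC g)
  note G = nn_integral_const_minus[OF fin g, of C, OF AE_I2, OF gC]
  have pos: "(\<integral>\<^sup>+ x. ennreal (h x) \<partial>N) = ennreal (\<integral>x. g x \<partial>N)"
    by (subst nn_integral_eq_integral[OF ig, symmetric]) (auto simp: g_def ennreal_max_0 intro!: nn_integral_cong)
  have "(\<integral>\<^sup>+ x. ennreal (C - h x) \<partial>N) = (\<integral>\<^sup>+ x. ennreal (C - g x) + ennreal (- h x) \<partial>N)"
  proof (rule nn_integral_cong)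
    fix x assume x: "x \<in> space N"
    show "ennreal (C - h x) = ennreal (C - g x) + ennreal (- h x)"
      using C(1)[OF x] C(2) by (cases "0 \<le> h x") (auto simp: g_def ennreal_neg ennreal_plus[symmetric] simp del: ennreal_plus)
  qed
  also have "\<dots> = (\<integral>\<^sup>+ x. ennreal (C - g x) \<partial>N) + (\<integral>\<^sup>+ x. ennreal (- h x) \<partial>N)"
    using h by (intro nn_integral_add) measurable
  also have "(\<integral>\<^sup>+ x. ennreal (C - g x) \<partial>N) = ennreal (C - (\<integral>x. g x \<partial>N))"
    using G by (simp add: prob_space)
  finally have sum: "(\<integral>\<^sup>+ x. ennreal (C - h x) \<partial>N) = ennreal (C - (\<integral>x. g x \<partial>N)) + (\<integral>\<^sup>+ x. ennreal (- h x) \<partial>N)" .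
  have g0: "0 \<le> (\<integral>x. g x \<partial>N)" by (rule integral_nonneg_AE) (simp add: g_def)
  have gle: "(\<integral>x. g x \<partial>N) \<le> C" using G(2) by (simp add: prob_space)
  have "enn2ereal (ennreal (C - (\<integral>x. g x \<partial>N)) + e) = ereal (C - (\<integral>x. g x \<partial>N)) + enn2ereal e" for e
    using gle by (simp add: plus_ennreal.rep_eq enn2ereal_ennreal)
  moreover have "ereal r - e = ereal C - (ereal (C - r) + e)" for r e
    by (cases e) auto
  ultimately show ?thesis
    unfolding ext_integral_def pos sum enn2ereal_ennreal[OF g0] by simp
qed

lemma ext_integral_bounded:
  assumes N: "prob_space N" and h: "h \<in> borel_measurable N" and C: "\<And>x. x \<in> space N \<Longrightarrow> \<bar>h x\<bar> \<le> C"
  shows "ext_integral N h = ereal (\<integral>x. h x \<partial>N)"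
proof -
  interpret prob_space N by fact
  obtain x where "x \<in> space N" using not_empty by blast
  from C[OF this] have C0: "0 \<le> C" by linarith
  have fin: "finite_measure N" by (rule finite_measure_axioms)
  note G = nn_integral_const_minus[OF fin h, of C, OF AE_I2, OF C]
  have "ext_integral N h = ereal C - enn2ereal (\<integral>\<^sup>+ x. ennreal (C - h x) \<partial>N)"
    by (rule ext_integral_eq_const_minus[OF N h _ C0]) (use C abs_le_D1 in blast)
  then show ?thesis using G by (simp add: prob_space enn2ereal_ennreal)
qed

section \<open>Measurability in time of integrals against a family of finite measures\<close>

lemma V_families_D:
  assumes "m \<in> V_families T D A" "t \<in> {0..T}"
  shows "finite_measure (m t)" "sets (m t) = sets (restrict_space borel (D \<times> A))" "space (m t) = D \<times> A"
proof -
  show "finite_measure (m t)" and s: "sets (m t) = sets (restrict_space borel (D \<times> A))"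
    using assms by (auto simp: V_families_def)
  show "space (m t) = D \<times> A" using sets_eq_imp_space_eq[OF s] by (simp add: space_restrict_space)
qed

lemma V_families_borel_measurable:
  assumes "m \<in> V_families T D A" "t \<in> {0..T}" "\<phi> \<in> borel_measurable borel"
  shows "\<phi> \<in> borel_measurable (m t)"
  using measurable_restrict_space1[OF assms(3)] V_families_D(2)[OF assms(1,2)]
  by (simp cong: measurable_cong_sets)

lemma V_families_mass_measurable:
  assumes "m \<in> V_families T D A" "closed (D \<times> A)" "X \<in> sets borel"
  shows "(\<lambda>t. emeasure (m t) (X \<inter> (D \<times> A))) \<in> borel_measurable (restrict_space borel {0..T})"
proof -
  have "X \<inter> (D \<times> A) \<in> sets (restrict_space borel (D \<times> A))"
    using assms(2,3) by (subst sets_restrict_space_iff) auto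
  then show ?thesis using assms(1) by (auto simp: V_families_def)
qed

text \<open>The masses of \<open>m t\<close> are finite but need not be bounded in \<open>t\<close>,
  so \<open>m\<close> need not be a subprobability kernel. Division by one plus the mass makes it
  one, also where the mass is zero, and the pushforward to the plane fixes the target space. The
  factor is undone after integration.\<close>

lemma V_families_nn_integral_measurable:
  assumes m: "m \<in> V_families T D A" and DA: "closed (D \<times> A)"
    and \<phi>: "(\<lambda>(t, p). \<phi> t p) \<in> borel_measurable (borel \<Otimes>\<^sub>M borel)"
  shows "(\<lambda>t. \<integral>\<^sup>+ p. \<phi> t p \<partial>m t) \<in> borel_measurable (restrict_space borel {0..T})"
proof -
  let ?R = "restrict_space borel {0..T}"
  define c where "c t = inverse (1 + emeasure (m t) (D \<times> A))" for t
  note mX = V_families_mass_measurable[OF m DA]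
  have [measurable]: "(\<lambda>t. emeasure (m t) (D \<times> A)) \<in> borel_measurable ?R"
    using mX[of UNIV] by simp
  have [measurable]: "c \<in> borel_measurable ?R" unfolding c_def by measurable
  have sp: "t \<in> space ?R \<longleftrightarrow> t \<in> {0..T}" for t by (simp add: space_restrict_space)
  have id: "(\<lambda>x. x) \<in> borel_measurable (m t)" if "t \<in> {0..T}" for t
    by (rule V_families_borel_measurable[OF m that]) simp
  define k where "k t = distr (scale_measure (c t) (m t)) borel (\<lambda>x. x)" for t
  have id': "(\<lambda>x. x) \<in> borel_measurable (scale_measure (c t) (m t))" if "t \<in> {0..T}" for t
    using id[OF that] by (simp cong: measurable_cong_sets)
  have ek: "emeasure (k t) X = c t * emeasure (m t) (X \<inter> (D \<times> A))" if "t \<in> {0..T}" "X \<in> sets borel" for t X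
    unfolding k_def using that V_families_D(3)[OF m that(1)]
    by (subst emeasure_distr[OF id'[OF that(1)]]) (auto simp: space_scale_measure)
  have fin: "emeasure (m t) (D \<times> A) \<noteq> \<top>" if "t \<in> {0..T}" for t
    using finite_measure.emeasure_finite[OF V_families_D(1)[OF m that]] by simp
  have c_inv: "(1 + emeasure (m t) (D \<times> A)) * c t = 1" if "t \<in> {0..T}" for t
    unfolding c_def divide_ennreal_def[symmetric] using fin[OF that]
    by (intro ennreal_divide_self) (auto simp: less_top)
  have [measurable]: "k \<in> ?R \<rightarrow>\<^sub>M subprob_algebra borel"
  proof (rule measurable_subprob_algebra)
    fix t assume "t \<in> space ?R"
    then have t: "t \<in> {0..T}" by (simp add: sp)
    show "subprob_space (k t)"
    proof (rule subprob_spaceI)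
      have "c t * emeasure (m t) (D \<times> A) \<le> c t * (1 + emeasure (m t) (D \<times> A))"
        by (intro mult_left_mono) auto
      also have "\<dots> = 1" using c_inv[OF t] by (simp add: mult.commute)
      finally show "emeasure (k t) (space (k t)) \<le> 1"
        using ek[OF t, of UNIV] by (simp add: k_def)
    qed (simp add: k_def)
    show "sets (k t) = sets borel" by (simp add: k_def)
  next
    fix X :: "(real \<times> real) set" assume X: "X \<in> sets borel"
    have "(\<lambda>t. c t * emeasure (m t) (X \<inter> (D \<times> A))) \<in> borel_measurable ?R"
      using mX[OF X] by measurable
    then show "(\<lambda>t. emeasure (k t) X) \<in> borel_measurable ?R"
      by (rule measurable_cong[THEN iffD1, rotated]) (simp add: sp ek X)
  qed
  have [measurable]: "(\<lambda>(t, p). \<phi> t p) \<in> borel_measurable (?R \<Otimes>\<^sub>M borel)"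
  proof -
    have "(\<lambda>z. (fst z, snd z)) \<in> ?R \<Otimes>\<^sub>M (borel :: (real \<times> real) measure) \<rightarrow>\<^sub>M borel \<Otimes>\<^sub>M borel"
    proof (rule measurable_Pair)
      show "fst \<in> ?R \<Otimes>\<^sub>M (borel :: (real \<times> real) measure) \<rightarrow>\<^sub>M borel"
        by (rule measurable_compose[OF measurable_fst]) (rule measurable_restrict_space1, simp)
    qed simp
    from measurable_compose[OF this \<phi>] show ?thesis by (simp add: case_prod_beta')
  qed
  have "(\<lambda>t. (1 + emeasure (m t) (D \<times> A)) * (\<integral>\<^sup>+ p. \<phi> t p \<partial>k t)) \<in> borel_measurable ?R"
    using nn_integral_measurable_subprob_algebra2[of \<phi> ?R borel k] by measurable
  then show ?thesis
  proof (rule measurable_cong[THEN iffD1, rotated])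
    fix t assume "t \<in> space ?R"
    then have t: "t \<in> {0..T}" by (simp add: sp)
    have \<phi>t: "\<phi> t \<in> borel_measurable borel"
      using measurable_compose[OF measurable_Pair1' \<phi>, of t] by simp
    have "(\<integral>\<^sup>+ p. \<phi> t p \<partial>k t) = (\<integral>\<^sup>+ p. \<phi> t p \<partial>scale_measure (c t) (m t))"
      unfolding k_def by (rule nn_integral_distr[OF id'[OF t]]) (simp add: \<phi>t)
    also have "\<dots> = c t * (\<integral>\<^sup>+ p. \<phi> t p \<partial>m t)"
      by (rule nn_integral_scale_measure[OF V_families_borel_measurable[OF m t \<phi>t]])
    finally show "(1 + emeasure (m t) (D \<times> A)) * (\<integral>\<^sup>+ p. \<phi> t p \<partial>k t) = (\<integral>\<^sup>+ p. \<phi> t p \<partial>m t)"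
      using c_inv[OF t] by (simp add: mult.assoc[symmetric])
  qed
qed

text \<open>The signed integral is recovered as \<open>B\<close> times the mass minus the integral
  of the nonnegative \<open>B - h\<close>, after extending \<open>h\<close> by zero to the whole
  space.\<close>

lemma V_families_integral_measurable:
  fixes h :: "real \<Rightarrow> real \<Rightarrow> real \<Rightarrow> real"
  assumes m: "m \<in> V_families T D A" and DA: "closed (D \<times> A)"
    and h: "(\<lambda>(t, x, a). h t x a) \<in> borel_measurable (restrict_space borel ({0..T} \<times> D \<times> A))"
    and b: "\<And>t x a. t \<in> {0..T} \<Longrightarrow> x \<in> D \<Longrightarrow> a \<in> A \<Longrightarrow> \<bar>h t x a\<bar> \<le> B"
  shows "(\<lambda>t. LINT (x, a)|m t. h t x a) \<in> borel_measurable (restrict_space borel {0..T})"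
    and "t \<in> {0..T} \<Longrightarrow> (\<lambda>(x, a). h t x a) \<in> borel_measurable (m t)"
proof -
  let ?R = "restrict_space borel {0..T}"
  have cl: "closed ({0..T} \<times> D \<times> A)" by (intro closed_Times DA closed_atLeastAtMost)
  define H :: "real \<Rightarrow> real \<times> real \<Rightarrow> real"
    where "H t p = indicator ({0..T} \<times> D \<times> A) (t, p) *\<^sub>R h t (fst p) (snd p)" for t p
  have H: "(\<lambda>(t, p). H t p) \<in> borel_measurable (borel \<Otimes>\<^sub>M borel)"
    using h cl unfolding H_def
    by (subst (asm) borel_measurable_restrict_space_iff) (auto simp: borel_prod case_prod_beta' split_beta)
  have Ht: "H t \<in> borel_measurable borel" for t
    using measurable_compose[OF measurable_Pair1' H, of t] by simp
  have eq: "H t (x, a) = h t x a" if "t \<in> {0..T}" "(x, a) \<in> D \<times> A" for t x a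
    using that by (simp add: H_def)
  show ht: "(\<lambda>(x, a). h t x a) \<in> borel_measurable (m t)" if t: "t \<in> {0..T}" for t
    using V_families_borel_measurable[OF m t Ht]
    by (rule measurable_cong[THEN iffD1, rotated]) (use eq[OF t] in \<open>auto simp: V_families_D(3)[OF m t]\<close>)
  have "(\<lambda>(t, p). ennreal (B - H t p)) \<in> borel_measurable (borel \<Otimes>\<^sub>M borel)"
    using H by (simp add: case_prod_beta')
  note nm = V_families_nn_integral_measurable[OF m DA this]
  have [measurable]: "(\<lambda>t. emeasure (m t) (D \<times> A)) \<in> borel_measurable ?R"
    using V_families_mass_measurable[OF m DA, of UNIV] by simp
  have "(\<lambda>t. B * enn2real (emeasure (m t) (D \<times> A)) - enn2real (\<integral>\<^sup>+ p. ennreal (B - H t p) \<partial>m t))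
    \<in> borel_measurable ?R" using nm by measurable
  then show "(\<lambda>t. LINT (x, a)|m t. h t x a) \<in> borel_measurable ?R"
  proof (rule measurable_cong[THEN iffD1, rotated])
    fix t assume "t \<in> space ?R"
    then have t: "t \<in> {0..T}" by (simp add: space_restrict_space)
    note D = V_families_D[OF m t]
    have bt: "AE z in m t. \<bar>(\<lambda>(x, a). h t x a) z\<bar> \<le> B" by (rule AE_I2) (use b[OF t] D(3) in auto)
    note S = nn_integral_const_minus[OF D(1) ht[OF t] bt]
    have "(\<integral>\<^sup>+ p. ennreal (B - H t p) \<partial>m t) = (\<integral>\<^sup>+ z. ennreal (B - (\<lambda>(x, a). h t x a) z) \<partial>m t)"
      by (rule nn_integral_cong) (use eq[OF t] D(3) in auto)
    also have "\<dots> = ennreal (B * measure (m t) (space (m t)) - (LINT (x, a)|m t. h t x a))"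
      by (rule S(1))
    finally show "B * enn2real (emeasure (m t) (D \<times> A)) - enn2real (\<integral>\<^sup>+ p. ennreal (B - H t p) \<partial>m t)
      = (LINT (x, a)|m t. h t x a)"
      using S(2) by (simp add: D(3) measure_def)
  qed
qed

section \<open>Encoding feasible pairs as kernels\<close>

locale lp_encoding =
  fixes T :: real and D A :: "real set" and a0 :: real
  assumes T_pos: "0 < T" and D_closed: "closed D" and A_compact: "compact A" and a0: "a0 \<notin> A"
begin

definition clock :: "real measure" where
  "clock = density lborel (indicator {0..T+1})"

definition dead :: "real \<times> real" where "dead = (0, a0)"

text \<open>
  A pair \<open>(\<mu>, m)\<close> is encoded as one probability kernel on the clock \<open>[0, T+1]\<close>: at times up to
  \<open>T\<close> it is \<open>m t\<close>, with the missing mass put on the isolated point \<open>dead\<close>, and on \<open>(T, T+1]\<close> it is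
  \<open>\<mu>\<close>. Thus the plane carries the coordinates \<open>(x, a)\<close> before \<open>T\<close> and \<open>(t, x)\<close> afterwards. The value
  \<open>\<top>\<close> off the support makes the support condition part of the finiteness of the cost.
\<close>

definition enc_cost ::
  "real \<Rightarrow> (real \<Rightarrow> real \<Rightarrow> real \<Rightarrow> real) \<Rightarrow> real \<Rightarrow> (real \<Rightarrow> real \<Rightarrow> real) \<Rightarrow> real \<Rightarrow> real \<times> real \<Rightarrow> ennreal" where
  "enc_cost B h C k t p =
    (if t \<in> {0..T} then
       if p \<in> D \<times> A then ennreal (B - h t (fst p) (snd p)) else if p = dead then ennreal B else \<top>
     else if p \<in> {0..T} \<times> D then ennreal (C - k (fst p) (snd p)) else \<top>)"

text \<open>\<open>h\<close> plays the running reward, bounded on both sides and semicontinuous at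
  each fixed time; \<open>k\<close> plays the terminal reward, semicontinuous jointly in time and
  space and bounded from above only. A cost \<open>\<infinity>\<close> is therefore possible and
  corresponds to the value \<open>-\<infinity>\<close>.\<close>

definition cost_data :: "real \<Rightarrow> (real \<Rightarrow> real \<Rightarrow> real \<Rightarrow> real) \<Rightarrow> real \<Rightarrow> (real \<Rightarrow> real \<Rightarrow> real) \<Rightarrow> bool" where
  "cost_data B h C k \<longleftrightarrow>
    (\<lambda>(t, x, a). h t x a) \<in> borel_measurable (restrict_space borel ({0..T} \<times> D \<times> A)) \<and>
    (\<forall>t\<in>{0..T}. usc_on (D \<times> A) (\<lambda>(x, a). h t x a)) \<and>
    (\<forall>t\<in>{0..T}. \<forall>x\<in>D. \<forall>a\<in>A. \<bar>h t x a\<bar> \<le> B) \<and>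
    usc_on ({0..T} \<times> D) (\<lambda>(t, x). k t x) \<and>
    (\<forall>t\<in>{0..T}. \<forall>x\<in>D. k t x \<le> C) \<and> 0 \<le> B \<and> 0 \<le> C"

lemma closed_DA: "closed (D \<times> A)"
  by (intro closed_Times D_closed compact_imp_closed A_compact)

lemma closed_TD: "closed ({0..T} \<times> D)"
  by (intro closed_Times D_closed closed_atLeastAtMost)

lemma dead_notin: "dead \<notin> D \<times> A"
  using a0 by (simp add: dead_def)

lemma sets_clock [simp, measurable_cong]: "sets clock = sets borel"
  by (simp add: clock_def)

lemma space_clock [simp]: "space clock = UNIV"
  by (simp add: clock_def)

lemma finite_clock: "finite_measure clock"
  by (rule finite_measureI) (use T_pos in \<open>simp add: clock_def emeasure_density\<close>)

text \<open>A sublevel set at finite height avoids the region of value \<open>\<top>\<close>. Up to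
  time \<open>T\<close> it is thus a closed part of \<open>D \<times> A\<close>, possibly together
  with \<open>dead\<close>; afterwards it is a closed part of
  \<open>{0..T} \<times> D\<close>.\<close>

lemma open_enc_cost:
  assumes "cost_data B h C k"
  shows "open {p. y < enc_cost B h C k t p}"
proof (cases y)
  case (real r)
  have "{p. y < enc_cost B h C k t p} = - {p. enc_cost B h C k t p \<le> ennreal r}"
    using real by (auto simp: not_le)
  moreover have "closed {p. enc_cost B h C k t p \<le> ennreal r}"
  proof (cases "t \<in> {0..T}")
    case True
    have "closed {p\<in>D \<times> A. ennreal (B - (\<lambda>(x, a). h t x a) p) \<le> ennreal r}"
      by (rule closed_ennreal_cost_level[OF closed_DA]) (use assms True in \<open>simp add: cost_data_def\<close>)
    moreover have "closed (if ennreal B \<le> ennreal r then {dead} else {})" by simp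
    moreover have "{p. enc_cost B h C k t p \<le> ennreal r} =
      {p\<in>D \<times> A. ennreal (B - (\<lambda>(x, a). h t x a) p) \<le> ennreal r} \<union>
      (if ennreal B \<le> ennreal r then {dead} else {})"
    proof (rule set_eqI)
      fix p
      show "p \<in> {p. enc_cost B h C k t p \<le> ennreal r} \<longleftrightarrow>
        p \<in> {p\<in>D \<times> A. ennreal (B - (\<lambda>(x, a). h t x a) p) \<le> ennreal r} \<union>
          (if ennreal B \<le> ennreal r then {dead} else {})"
        using True dead_notin
        by (cases "p \<in> D \<times> A"; cases "p = dead") (simp_all add: enc_cost_def top_unique split_beta)
    qed
    ultimately show ?thesis by (simp only: closed_Un)
  next
    case False
    have "closed {p\<in>{0..T} \<times> D. ennreal (C - (\<lambda>(t, x). k t x) p) \<le> ennreal r}"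
      by (rule closed_ennreal_cost_level[OF closed_TD]) (use assms in \<open>simp add: cost_data_def\<close>)
    moreover have "{p. enc_cost B h C k t p \<le> ennreal r} =
      {p\<in>{0..T} \<times> D. ennreal (C - (\<lambda>(t, x). k t x) p) \<le> ennreal r}"
      unfolding enc_cost_def if_not_P[OF False] by (auto simp: top_unique split: if_splits)
    ultimately show ?thesis by simp
  qed
  ultimately show ?thesis by (simp only: open_Compl)
qed simp

lemma lsc_enc_cost:
  assumes cd: "cost_data B h C k"
  shows "lsc_integrand clock (enc_cost B h C k)"
  unfolding lsc_integrand_def
proof (intro conjI allI open_enc_cost[OF cd])
  define h' :: "real \<times> real \<times> real \<Rightarrow> real"
    where "h' z = indicator ({0..T} \<times> D \<times> A) z *\<^sub>R (case z of (t, x, a) \<Rightarrow> h t x a)" for z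
  define k' :: "real \<times> real \<Rightarrow> real"
    where "k' z = indicator ({0..T} \<times> D) z *\<^sub>R (case z of (t, x) \<Rightarrow> k t x)" for z
  have cl: "closed ({0..T} \<times> D \<times> A)" by (intro closed_Times closed_DA closed_atLeastAtMost)
  have h'[measurable]: "h' \<in> borel_measurable borel"
    unfolding h'_def by (subst borel_measurable_restrict_space_iff[symmetric])
      (use cd cl in \<open>simp_all add: cost_data_def\<close>)
  have k'[measurable]: "k' \<in> borel_measurable borel"
    unfolding k'_def by (subst borel_measurable_restrict_space_iff[symmetric])
      (use cd closed_TD usc_on_borel_measurable[OF closed_TD] in \<open>simp_all add: cost_data_def\<close>)
  have [measurable]: "D \<times> A \<in> sets borel" "{0..T} \<times> D \<in> sets borel" "{dead} \<in> sets borel"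
    using closed_DA closed_TD by auto
  have "(\<lambda>z. if fst z \<in> {0..T} then
       if snd z \<in> D \<times> A then ennreal (B - h' z) else if snd z \<in> {dead} then ennreal B else \<top>
     else if snd z \<in> {0..T} \<times> D then ennreal (C - k' (snd z)) else \<top>) \<in> borel_measurable (borel \<Otimes>\<^sub>M borel)"
  proof -
    have [measurable]: "h' \<in> borel_measurable (borel \<Otimes>\<^sub>M borel)" using h' by (simp add: borel_prod)
    show ?thesis by measurable
  qed
  also have "(\<lambda>z. if fst z \<in> {0..T} then
       if snd z \<in> D \<times> A then ennreal (B - h' z) else if snd z \<in> {dead} then ennreal B else \<top>
     else if snd z \<in> {0..T} \<times> D then ennreal (C - k' (snd z)) else \<top>) = (\<lambda>(t, p). enc_cost B h C k t p)"
    by (auto simp: fun_eq_iff enc_cost_def h'_def k'_def)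
  finally show "(\<lambda>(t, p). enc_cost B h C k t p) \<in> borel_measurable (clock \<Otimes>\<^sub>M borel)"
    by (simp cong: measurable_cong_sets sets_pair_measure_cong)
qed

lemma nn_integral_clock:
  assumes [measurable]: "F \<in> borel_measurable borel"
  shows "(\<integral>\<^sup>+ t. F t \<partial>clock) = (\<integral>\<^sup>+ t\<in>{0..T}. F t \<partial>lborel) + (\<integral>\<^sup>+ t\<in>{T<..T+1}. F t \<partial>lborel)"
proof -
  have "(\<integral>\<^sup>+ t. F t \<partial>clock) = (\<integral>\<^sup>+ t. indicator {0..T+1} t * F t \<partial>lborel)"
    unfolding clock_def by (rule nn_integral_density) measurable
  also have "\<dots> = (\<integral>\<^sup>+ t. F t * indicator {0..T} t + F t * indicator {T<..T+1} t \<partial>lborel)"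
    using T_pos by (intro nn_integral_cong) (auto simp: indicator_def)
  finally show ?thesis by (simp add: nn_integral_add)
qed

text \<open>The relation is pointwise in time up to \<open>T\<close> but only integrated over the
  last unit interval: a limit kernel need not be constant there, and \<open>\<mu>\<close> is
  recovered as its average.\<close>

definition encodes :: "(real \<Rightarrow> (real \<times> real) measure) \<Rightarrow> (real \<times> real) measure \<Rightarrow> (real \<Rightarrow> (real \<times> real) measure) \<Rightarrow> bool" where
  "encodes K \<mu> m \<longleftrightarrow>
    (AE t in lborel. t \<in> {0..T} \<longrightarrow> emeasure (m t) (D \<times> A) \<le> 1 \<and>
      (\<forall>\<phi>\<in>borel_measurable borel. (\<integral>\<^sup>+ p. \<phi> p \<partial>K t) =
        (\<integral>\<^sup>+ p. \<phi> p \<partial>m t) + (1 - emeasure (m t) (D \<times> A)) * \<phi> dead)) \<and>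
    (\<forall>\<phi>\<in>borel_measurable borel. (\<integral>\<^sup>+ t\<in>{T<..T+1}. (\<integral>\<^sup>+ p. \<phi> p \<partial>K t) \<partial>lborel) = (\<integral>\<^sup>+ p. \<phi> p \<partial>\<mu>))"

text \<open>At a time before \<open>T\<close> with mass \<open>c\<close> the cost is
  \<open>(B * c - H t) + (1 - c) * B = B - H t\<close>: the price \<open>B\<close> at
  \<open>dead\<close> removes the dependence on the mass. In total the cost is a fixed constant
  minus the value, so minimizing one is maximizing the other.\<close>

lemma cost_of_encoding:
  assumes cd: "cost_data B h C k"
    and K: "K \<in> clock \<rightarrow>\<^sub>M prob_algebra borel"
    and \<mu>: "\<mu> \<in> borel_probs ({0..T} \<times> D)" and m: "m \<in> V_families T D A"
    and enc: "encodes K \<mu> m"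
  shows "enn2ereal (kernel_cost clock (enc_cost B h C k) K) =
    ereal (B * T + C) - (ereal (occupation_integral T m h) + ext_integral \<mu> (\<lambda>(t, x). k t x))"
proof -
  define w where "w = enc_cost B h C k"
  have hb: "\<bar>h t x a\<bar> \<le> B" if "t \<in> {0..T}" "x \<in> D" "a \<in> A" for t x a
    using cd that by (simp add: cost_data_def)
  have B: "0 \<le> B" and C: "0 \<le> C" using cd by (auto simp: cost_data_def)
  have hm: "(\<lambda>(t, x, a). h t x a) \<in> borel_measurable (restrict_space borel ({0..T} \<times> D \<times> A))"
    using cd by (simp add: cost_data_def)
  have Hm: "(\<lambda>t. LINT (x, a)|m t. h t x a) \<in> borel_measurable (restrict_space borel {0..T})"
    by (rule V_families_integral_measurable(1)[OF m closed_DA hm hb])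
  have hmt: "(\<lambda>(x, a). h t x a) \<in> borel_measurable (m t)" if "t \<in> {0..T}" for t
    by (rule V_families_integral_measurable(2)[OF m closed_DA hm hb that])
  have wt[measurable]: "w t \<in> borel_measurable borel" for t
    unfolding w_def by (rule borel_measurableI_greater) (auto intro!: borel_open open_enc_cost[OF cd])
  have wm: "(\<lambda>(t, p). w t p) \<in> borel_measurable (clock \<Otimes>\<^sub>M borel)"
    using lsc_enc_cost[OF cd] by (simp add: lsc_integrand_def w_def)
  have F: "(\<lambda>t. \<integral>\<^sup>+ p. w t p \<partial>K t) \<in> borel_measurable borel"
    using nn_integral_measurable_subprob_algebra2[OF wm measurable_prob_algebraD[OF K]]
    by (simp cong: measurable_cong_sets)
  define H where "H t = (LINT (x, a)|m t. h t x a)" for t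
  have Hmass: "(\<integral>\<^sup>+ p. ennreal (B - (\<lambda>(x, a). h t x a) p) \<partial>m t) = ennreal (B * measure (m t) (D \<times> A) - H t)"
    "\<bar>H t\<bar> \<le> B * measure (m t) (D \<times> A)" if t: "t \<in> {0..T}" for t
  proof -
    have "AE p in m t. \<bar>(\<lambda>(x, a). h t x a) p\<bar> \<le> B"
      by (rule AE_I2) (use hb[OF t] V_families_D(3)[OF m t] in auto)
    note S = nn_integral_const_minus[OF V_families_D(1)[OF m t] hmt[OF t] this]
    then show "(\<integral>\<^sup>+ p. ennreal (B - (\<lambda>(x, a). h t x a) p) \<partial>m t) = ennreal (B * measure (m t) (D \<times> A) - H t)"
      "\<bar>H t\<bar> \<le> B * measure (m t) (D \<times> A)"
      by (simp_all add: H_def V_families_D(3)[OF m t])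
  qed
  have ae: "AE t in lborel. t \<in> {0..T} \<longrightarrow> (\<integral>\<^sup>+ p. w t p \<partial>K t) = ennreal (B - H t) \<and> \<bar>H t\<bar> \<le> B"
    using enc[unfolded encodes_def, THEN conjunct1]
  proof eventually_elim
    case (elim t)
    show ?case
    proof (intro impI)
      assume t: "t \<in> {0..T}"
      define c where "c = measure (m t) (D \<times> A)"
      interpret mt: finite_measure "m t" by (rule V_families_D(1)[OF m t])
      have ec: "emeasure (m t) (D \<times> A) = ennreal c" by (simp add: c_def mt.emeasure_eq_measure)
      have c: "0 \<le> c" "c \<le> 1" using elim t ec by (auto simp: c_def)
      have "(\<integral>\<^sup>+ p. w t p \<partial>K t) = (\<integral>\<^sup>+ p. w t p \<partial>m t) + (1 - ennreal c) * w t dead"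
        using elim t wt by (simp add: ec)
      also have "(\<integral>\<^sup>+ p. w t p \<partial>m t) = (\<integral>\<^sup>+ p. ennreal (B - (\<lambda>(x, a). h t x a) p) \<partial>m t)"
        by (rule nn_integral_cong) (use t V_families_D(3)[OF m t] in \<open>auto simp: w_def enc_cost_def\<close>)
      also have "\<dots> = ennreal (B * c - H t)" using Hmass[OF t] by (simp add: c_def)
      also have "w t dead = ennreal B" using t dead_notin by (simp add: w_def enc_cost_def)
      also have "1 - ennreal c = ennreal (1 - c)" using c by (simp add: ennreal_minus flip: ennreal_1)
      also have "ennreal (1 - c) * ennreal B = ennreal ((1 - c) * B)" using c B by (simp add: ennreal_mult)
      also have "ennreal (B * c - H t) + ennreal ((1 - c) * B) = ennreal (B * c - H t + (1 - c) * B)"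
        using Hmass(2)[OF t] c B by (intro ennreal_plus[symmetric]) (auto simp: c_def)
      also have "B * c - H t + (1 - c) * B = B - H t" by (simp add: algebra_simps)
      finally have 1: "(\<integral>\<^sup>+ p. w t p \<partial>K t) = ennreal (B - H t)" .
      have "B * c \<le> B" using c B by (simp add: mult_left_le)
      with Hmass(2)[OF t] have "\<bar>H t\<bar> \<le> B" by (simp add: c_def)
      with 1 show "(\<integral>\<^sup>+ p. w t p \<partial>K t) = ennreal (B - H t) \<and> \<bar>H t\<bar> \<le> B" by simp
    qed
  qed
  let ?L = "restrict_space lborel {0..T}"
  have HL: "H \<in> borel_measurable ?L"
    using Hm unfolding H_def by (simp cong: measurable_cong_sets sets_restrict_space_cong)
  have finL: "finite_measure ?L"
    by (rule finite_measureI) (use T_pos in \<open>simp add: emeasure_restrict_space space_restrict_space\<close>)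
  have aeL: "AE t in ?L. \<bar>H t\<bar> \<le> B"
    using ae by (auto simp: AE_restrict_space_iff)
  have mL: "measure ?L (space ?L) = T"
    using T_pos by (simp add: space_restrict_space measure_restrict_space)
  have occ: "(\<integral>t. H t \<partial>?L) = occupation_integral T m h"
    unfolding occupation_integral_def set_lebesgue_integral_def H_def
    by (rule integral_restrict_space) simp
  note S = nn_integral_const_minus[OF finL HL aeL, unfolded mL occ]
  have "(\<integral>\<^sup>+ t\<in>{0..T}. (\<integral>\<^sup>+ p. w t p \<partial>K t) \<partial>lborel) = (\<integral>\<^sup>+ t\<in>{0..T}. ennreal (B - H t) \<partial>lborel)"
    by (rule nn_integral_cong_AE) (use ae in eventually_elim, auto simp: indicator_def)
  also have "\<dots> = (\<integral>\<^sup>+ t. ennreal (B - H t) \<partial>?L)"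
    by (rule nn_integral_restrict_space[symmetric]) simp
  also have "\<dots> = ennreal (B * T - occupation_integral T m h)" by (rule S(1))
  finally have part1: "(\<integral>\<^sup>+ t\<in>{0..T}. (\<integral>\<^sup>+ p. w t p \<partial>K t) \<partial>lborel) = ennreal (B * T - occupation_integral T m h)" .
  have \<mu>': "prob_space \<mu>" "sets \<mu> = sets (restrict_space borel ({0..T} \<times> D))"
    using \<mu> by (auto simp: borel_probs_def space_prob_algebra)
  have sp\<mu>: "space \<mu> = {0..T} \<times> D"
    using sets_eq_imp_space_eq[OF \<mu>'(2)] by (simp add: space_restrict_space)
  \<comment> \<open>After \<open>T\<close> the cost does not depend on the clock, and
    \<open>T + 1\<close> represents all these times. With a fixed integrand the averaged form of
    \<open>encodes\<close> applies.\<close>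
  have "(\<integral>\<^sup>+ t\<in>{T<..T+1}. (\<integral>\<^sup>+ p. w t p \<partial>K t) \<partial>lborel) = (\<integral>\<^sup>+ t\<in>{T<..T+1}. (\<integral>\<^sup>+ p. w (T+1) p \<partial>K t) \<partial>lborel)"
    by (rule nn_integral_cong) (auto simp: indicator_def w_def enc_cost_def)
  also have "\<dots> = (\<integral>\<^sup>+ p. w (T+1) p \<partial>\<mu>)"
    using enc wt by (simp add: encodes_def)
  also have "\<dots> = (\<integral>\<^sup>+ p. ennreal (C - (\<lambda>(t, x). k t x) p) \<partial>\<mu>)"
  proof (rule nn_integral_cong)
    fix p assume "p \<in> space \<mu>"
    then have "p \<in> {0..T} \<times> D" by (simp add: sp\<mu>)
    then show "w (T + 1) p = ennreal (C - (\<lambda>(t, x). k t x) p)"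
      by (auto simp: w_def enc_cost_def)
  qed
  finally have part2: "(\<integral>\<^sup>+ t\<in>{T<..T+1}. (\<integral>\<^sup>+ p. w t p \<partial>K t) \<partial>lborel) = (\<integral>\<^sup>+ p. ennreal (C - (\<lambda>(t, x). k t x) p) \<partial>\<mu>)" .
  have ext: "ext_integral \<mu> (\<lambda>(t, x). k t x) = ereal C - enn2ereal (\<integral>\<^sup>+ p. ennreal (C - (\<lambda>(t, x). k t x) p) \<partial>\<mu>)"
  proof (rule ext_integral_eq_const_minus[OF \<mu>'(1) _ _ C])
    show "(\<lambda>(t, x). k t x) \<in> borel_measurable \<mu>"
      using usc_on_borel_measurable[OF closed_TD, of "\<lambda>(t, x). k t x"] cd \<mu>'(2)
      by (simp add: cost_data_def cong: measurable_cong_sets)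
    show "(\<lambda>(t, x). k t x) p \<le> C" if "p \<in> space \<mu>" for p
      using that cd by (auto simp: cost_data_def sp\<mu>)
  qed
  have "kernel_cost clock w K = ennreal (B * T - occupation_integral T m h) + (\<integral>\<^sup>+ p. ennreal (C - (\<lambda>(t, x). k t x) p) \<partial>\<mu>)"
    unfolding kernel_cost_def nn_integral_clock[OF F] part1 part2 ..
  moreover have "0 \<le> B * T - occupation_integral T m h" unfolding diff_ge_0_iff_ge by (rule abs_le_D1[OF S(2)])
  moreover have "ereal (B * T - r) + e = ereal (B * T + C) - (ereal r + (ereal C - e))" for r e
    by (cases e) auto
  ultimately show ?thesis
    unfolding ext w_def[symmetric] by (simp add: plus_ennreal.rep_eq enn2ereal_ennreal)
qed

end

section \<open>Passing from pairs to kernels and back\<close>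

context lp_encoding
begin

lemma encoding_exists:
  assumes \<mu>: "\<mu> \<in> borel_probs ({0..T} \<times> D)" and m: "m \<in> V_families T D A"
    and mass: "AE t in lborel. t \<in> {0..T} \<longrightarrow> emeasure (m t) (D \<times> A) \<le> 1"
  shows "\<exists>K. K \<in> clock \<rightarrow>\<^sub>M prob_algebra borel \<and> encodes K \<mu> m"
proof -
  define e where "e X t = emeasure (m t) (X \<inter> (D \<times> A)) * indicator {0..T} t" for X t
  have e[measurable]: "e X \<in> borel_measurable borel" if "X \<in> sets borel" for X
    using V_families_mass_measurable[OF m closed_DA that] unfolding e_def
    by (subst (asm) borel_measurable_restrict_space_iff_ennreal) auto
  \<comment> \<open>Where the mass exceeds 1 the truncated difference
    \<open>1 - emeasure (m t) (D \<times> A)\<close> is 0 and the sum would not be a probability; on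
    this null set a Dirac law is used instead.\<close>
  define G where "G = {t\<in>{0..T}. e UNIV t \<le> 1}"
  have [measurable]: "G \<in> sets borel" unfolding G_def by measurable
  define part where "part t = add_measure (distr (m t) borel (\<lambda>x. x))
    (scale_measure (1 - emeasure (m t) (D \<times> A)) (return borel dead))" for t
  define N where "N = distr \<mu> borel (\<lambda>x. x)"
  define K where "K t = (if t \<in> G then part t else if t \<in> {T<..T+1} then N else return borel dead)" for t
  have \<mu>': "prob_space \<mu>" "sets \<mu> = sets (restrict_space borel ({0..T} \<times> D))"
    using \<mu> by (auto simp: borel_probs_def space_prob_algebra)
  have id\<mu>: "(\<lambda>x. x) \<in> borel_measurable \<mu>"
    using measurable_restrict_space1[of "\<lambda>x. x" borel borel] \<mu>'(2) by (simp cong: measurable_cong_sets)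
  have N: "prob_space N" "sets N = sets borel"
    unfolding N_def by (auto intro: prob_space.prob_space_distr \<mu>' id\<mu>)
  have G: "t \<in> {0..T}" "emeasure (m t) (D \<times> A) \<le> 1" if "t \<in> G" for t
    using that by (auto simp: G_def e_def)
  have sets_part[simp]: "sets (part t) = sets borel" for t by (simp add: part_def)
  have idm: "(\<lambda>x. x) \<in> borel_measurable (m t)" if "t \<in> {0..T}" for t
    by (rule V_families_borel_measurable[OF m that]) simp
  have part_em: "emeasure (part t) X = e X t + (1 - e UNIV t) * indicator X dead"
    if t: "t \<in> G" and X: "X \<in> sets borel" for t X
  proof -
    have "emeasure (distr (m t) borel (\<lambda>x. x)) X = e X t"
      using G[OF t] V_families_D(3)[OF m, of t] X
      by (subst emeasure_distr[OF idm]) (auto simp: e_def)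
    then show ?thesis
      unfolding part_def using X G(1)[OF t] by (subst emeasure_add_measure) (simp_all add: e_def)
  qed
  have part_prob: "prob_space (part t)" if t: "t \<in> G" for t
  proof (rule prob_spaceI)
    have "e UNIV t \<le> 1" using t by (simp add: G_def)
    then have "e UNIV t + (1 - e UNIV t) = 1"
      by (simp add: add_diff_inverse_ennreal)
    then show "emeasure (part t) (space (part t)) = 1"
      using part_em[OF t, of UNIV] sets_eq_imp_space_eq[OF sets_part, of t] by simp
  qed
  have K: "K \<in> clock \<rightarrow>\<^sub>M prob_algebra borel"
  proof (rule measurable_prob_algebraI)
    show ps: "prob_space (K t)" for t
      unfolding K_def by (auto simp: part_prob N prob_space_return)
    show "K \<in> clock \<rightarrow>\<^sub>M subprob_algebra borel"
    proof (rule measurable_subprob_algebra)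
      show "sets (K t) = sets borel" for t unfolding K_def by (simp add: N)
      show "subprob_space (K t)" for t by (rule prob_space_imp_subprob_space[OF ps])
      fix X :: "(real \<times> real) set" assume X[measurable]: "X \<in> sets borel"
      have "(\<lambda>t. emeasure (K t) X) = (\<lambda>t. if t \<in> G then e X t + (1 - e UNIV t) * indicator X dead
        else if t \<in> {T<..T+1} then emeasure N X else emeasure (return borel dead) X)"
        by (auto simp: K_def part_em fun_eq_iff)
      also have "\<dots> \<in> borel_measurable clock" by measurable
      finally show "(\<lambda>t. emeasure (K t) X) \<in> borel_measurable clock" .
    qed
  qed
  have "AE t in lborel. t \<in> {0..T} \<longrightarrow> emeasure (m t) (D \<times> A) \<le> 1 \<and>
      (\<forall>\<phi>\<in>borel_measurable borel. (\<integral>\<^sup>+ p. \<phi> p \<partial>K t) =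
        (\<integral>\<^sup>+ p. \<phi> p \<partial>m t) + (1 - emeasure (m t) (D \<times> A)) * \<phi> dead)"
    using mass
  proof eventually_elim
    case (elim t)
    show ?case
    proof (intro impI conjI ballI)
      assume t: "t \<in> {0..T}"
      show le: "emeasure (m t) (D \<times> A) \<le> 1" by (rule mp[OF elim t])
      then have tG: "t \<in> G" using t by (simp add: G_def e_def)
      fix \<phi> :: "real \<times> real \<Rightarrow> ennreal" assume \<phi>[measurable]: "\<phi> \<in> borel_measurable borel"
      have "(\<integral>\<^sup>+ p. \<phi> p \<partial>K t) = (\<integral>\<^sup>+ p. \<phi> p \<partial>part t)" using tG by (simp add: K_def)
      also have "\<dots> = (\<integral>\<^sup>+ p. \<phi> p \<partial>distr (m t) borel (\<lambda>x. x)) +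
          (\<integral>\<^sup>+ p. \<phi> p \<partial>scale_measure (1 - emeasure (m t) (D \<times> A)) (return borel dead))"
        unfolding part_def by (rule nn_integral_add_measure) simp_all
      also have "(\<integral>\<^sup>+ p. \<phi> p \<partial>distr (m t) borel (\<lambda>x. x)) = (\<integral>\<^sup>+ p. \<phi> p \<partial>m t)"
        by (rule nn_integral_distr[OF idm[OF t]]) simp
      also have "(\<integral>\<^sup>+ p. \<phi> p \<partial>scale_measure (1 - emeasure (m t) (D \<times> A)) (return borel dead))
        = (1 - emeasure (m t) (D \<times> A)) * \<phi> dead"
        by (subst nn_integral_scale_measure) (simp_all add: nn_integral_return)
      finally show "(\<integral>\<^sup>+ p. \<phi> p \<partial>K t) =
        (\<integral>\<^sup>+ p. \<phi> p \<partial>m t) + (1 - emeasure (m t) (D \<times> A)) * \<phi> dead" .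
    qed
  qed
  moreover have "(\<integral>\<^sup>+ t\<in>{T<..T+1}. (\<integral>\<^sup>+ p. \<phi> p \<partial>K t) \<partial>lborel) = (\<integral>\<^sup>+ p. \<phi> p \<partial>\<mu>)"
    if \<phi>: "\<phi> \<in> borel_measurable borel" for \<phi> :: "real \<times> real \<Rightarrow> ennreal"
  proof -
    have "(\<integral>\<^sup>+ t\<in>{T<..T+1}. (\<integral>\<^sup>+ p. \<phi> p \<partial>K t) \<partial>lborel) =
      (\<integral>\<^sup>+ t. (\<integral>\<^sup>+ p. \<phi> p \<partial>N) * indicator {T<..T+1} t \<partial>lborel)"
      by (rule nn_integral_cong) (auto simp: indicator_def K_def G_def)
    also have "\<dots> = (\<integral>\<^sup>+ p. \<phi> p \<partial>N)" by (simp add: nn_integral_cmult_indicator)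
    also have "\<dots> = (\<integral>\<^sup>+ p. \<phi> p \<partial>\<mu>)"
      unfolding N_def by (rule nn_integral_distr[OF id\<mu>]) (simp add: \<phi>)
    finally show ?thesis .
  qed
  ultimately show ?thesis using K unfolding encodes_def by blast
qed

text \<open>Up to \<open>T\<close> the measure is \<open>K t\<close> restricted to
  \<open>D \<times> A\<close>, forgetting the atom at \<open>dead\<close>. \<open>\<mu>\<close> is
  the law of a point drawn from \<open>K t\<close> at a time \<open>t\<close> uniform on the last
  unit interval. The support hypotheses ensure that the restrictions lose nothing else.\<close>

lemma decoding_exists:
  assumes K: "K \<in> clock \<rightarrow>\<^sub>M prob_algebra borel"
    and supp1: "AE t in lborel. t \<in> {0..T} \<longrightarrow> emeasure (K t) (- (D \<times> A \<union> {dead})) = 0"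
    and supp2: "AE t in lborel. t \<in> {T<..T+1} \<longrightarrow> emeasure (K t) (- ({0..T} \<times> D)) = 0"
  shows "\<exists>\<mu> m. \<mu> \<in> borel_probs ({0..T} \<times> D) \<and> m \<in> V_families T D A \<and> encodes K \<mu> m"
proof -
  have Kt: "prob_space (K t)" "sets (K t) = sets borel" "space (K t) = UNIV" for t
    using measurable_space[OF K, of t] by (auto simp: space_prob_algebra dest: sets_eq_imp_space_eq)
  have sb: "D \<times> A \<in> sets borel" "{0..T} \<times> D \<in> sets borel" using closed_DA closed_TD by auto
  note Ksub = measurable_prob_algebraD[OF K]
  have Km: "(\<lambda>t. emeasure (K t) X) \<in> borel_measurable borel" if "X \<in> sets borel" for X
    using measurable_emeasure_kernel[OF Ksub that] by (simp cong: measurable_cong_sets)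
  define m where "m t = restrict_space (K t) (D \<times> A)" for t
  have sm: "sets (m t) = sets (restrict_space borel (D \<times> A))" for t
    unfolding m_def by (rule sets_restrict_space_cong[OF Kt(2)])
  have em: "emeasure (m t) X = emeasure (K t) X" if "X \<in> sets (restrict_space borel (D \<times> A))" for t X
    unfolding m_def using that sb(1) Kt(2)[of t]
    by (intro emeasure_restrict_space) (auto simp: sets_restrict_space_iff)
  have DAs: "D \<times> A \<in> sets (restrict_space borel (D \<times> A))" using sb(1) by (auto simp: sets_restrict_space_iff)
  have le1: "emeasure (m t) (D \<times> A) \<le> 1" for t
    using prob_space.emeasure_le_1[OF Kt(1)] by (simp add: em[OF DAs])
  have mV: "m \<in> V_families T D A"
    unfolding V_families_def mem_Collect_eq
  proof (intro conjI ballI)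
    fix t
    show "finite_measure (m t)"
      unfolding m_def using Kt(1)[of t] by (intro finite_measure_restrict_space) (auto simp: prob_space_def Kt sb)
    show "sets (m t) = sets (restrict_space borel (D \<times> A))" by (rule sm)
  next
    fix X assume X: "X \<in> sets (restrict_space borel (D \<times> A))"
    then have "X \<in> sets borel" using sb(1) by (auto simp: sets_restrict_space_iff)
    then show "(\<lambda>t. emeasure (m t) X) \<in> borel_measurable (restrict_space borel {0..T})"
      unfolding em[OF X] by (intro measurable_restrict_space1 Km)
  next
    have "(\<integral>\<^sup>+ t\<in>{0..T}. emeasure (m t) (D \<times> A) \<partial>lborel) \<le> (\<integral>\<^sup>+ t\<in>{0..T}. 1 \<partial>lborel)"
      by (intro nn_integral_mono mult_right_mono le1) simp
    also have "\<dots> < \<infinity>" using T_pos by simp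
    finally show "(\<integral>\<^sup>+ t\<in>{0..T}. emeasure (m t) (D \<times> A) \<partial>lborel) < \<infinity>" .
  qed
  define U where "U = density lborel (indicator {T<..T+1} :: real \<Rightarrow> ennreal)"
  have U: "prob_space U" by (rule prob_spaceI) (simp add: U_def emeasure_density)
  have [simp, measurable_cong]: "sets U = sets borel" by (simp add: U_def)
  have [simp]: "space U = UNIV" by (simp add: U_def)
  have KU: "K \<in> U \<rightarrow>\<^sub>M subprob_algebra borel" using Ksub by (simp cong: measurable_cong_sets)
  define N where "N = bind U K"
  have sN: "sets N = sets borel" unfolding N_def by (rule sets_bind_measurable[OF KU]) simp
  have spN: "space N = UNIV" using sets_eq_imp_space_eq[OF sN] by simp
  have nnN: "(\<integral>\<^sup>+ p. \<phi> p \<partial>N) = (\<integral>\<^sup>+ t\<in>{T<..T+1}. (\<integral>\<^sup>+ p. \<phi> p \<partial>K t) \<partial>lborel)"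
    if [measurable]: "\<phi> \<in> borel_measurable borel" for \<phi>
  proof -
    have [measurable]: "(\<lambda>t. \<integral>\<^sup>+ p. \<phi> p \<partial>K t) \<in> borel_measurable borel"
      using measurable_compose[OF Ksub nn_integral_measurable_subprob_algebra[OF that]]
      by (simp cong: measurable_cong_sets)
    have "(\<integral>\<^sup>+ p. \<phi> p \<partial>N) = (\<integral>\<^sup>+ t. (\<integral>\<^sup>+ p. \<phi> p \<partial>K t) \<partial>U)"
      unfolding N_def by (rule nn_integral_bind[OF that KU])
    also have "\<dots> = (\<integral>\<^sup>+ t. indicator {T<..T+1} t * (\<integral>\<^sup>+ p. \<phi> p \<partial>K t) \<partial>lborel)"
      unfolding U_def by (rule nn_integral_density) measurable
    finally show ?thesis by (simp add: mult.commute)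
  qed
  have pN: "prob_space N"
    unfolding N_def by (rule prob_space.prob_space_bind[OF U _ KU]) (simp add: Kt)
  have N0: "emeasure N (- ({0..T} \<times> D)) = 0"
  proof -
    have "emeasure N (- ({0..T} \<times> D)) = (\<integral>\<^sup>+ p. indicator (- ({0..T} \<times> D)) p \<partial>N)"
      using sN sb(2) by (simp add: nn_integral_indicator)
    also have "\<dots> = (\<integral>\<^sup>+ t\<in>{T<..T+1}. emeasure (K t) (- ({0..T} \<times> D)) \<partial>lborel)"
      using sb(2) by (subst nnN) (auto simp: Kt nn_integral_indicator)
    also have "\<dots> = (\<integral>\<^sup>+ t. 0 \<partial>(lborel :: real measure))"
      by (rule nn_integral_cong_AE) (use supp2 in eventually_elim, auto simp: indicator_def)
    finally show ?thesis by simp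
  qed
  define \<mu> where "\<mu> = restrict_space N ({0..T} \<times> D)"
  have s\<mu>: "sets \<mu> = sets (restrict_space borel ({0..T} \<times> D))"
    unfolding \<mu>_def by (rule sets_restrict_space_cong[OF sN])
  have N1: "emeasure N ({0..T} \<times> D) = 1"
  proof -
    have "emeasure N (UNIV - ({0..T} \<times> D)) = 0" using N0 by (simp add: Compl_eq_Diff_UNIV)
    then have "AE p in N. p \<in> {0..T} \<times> D"
      using sN sb(2) spN by (intro AE_I[of _ _ "- ({0..T} \<times> D)"]) (auto simp: N0)
    moreover have "{0..T} \<times> D \<in> sets N" using sN sb(2) by simp
    ultimately show ?thesis by (simp only: prob_space.emeasure_eq_1_AE[OF pN])
  qed
  have p\<mu>: "prob_space \<mu>"
    unfolding \<mu>_def by (rule prob_spaceI)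
      (use sN sb(2) spN N1 in \<open>simp add: space_restrict_space emeasure_restrict_space\<close>)
  have \<mu>P: "\<mu> \<in> borel_probs ({0..T} \<times> D)"
    using p\<mu> s\<mu> by (simp add: borel_probs_def space_prob_algebra)
  have enc2: "(\<integral>\<^sup>+ t\<in>{T<..T+1}. (\<integral>\<^sup>+ p. \<phi> p \<partial>K t) \<partial>lborel) = (\<integral>\<^sup>+ p. \<phi> p \<partial>\<mu>)"
    if \<phi>: "\<phi> \<in> borel_measurable borel" for \<phi> :: "real \<times> real \<Rightarrow> ennreal"
  proof -
    have "(\<integral>\<^sup>+ p. \<phi> p \<partial>\<mu>) = (\<integral>\<^sup>+ p. \<phi> p * indicator ({0..T} \<times> D) p \<partial>N)"
      unfolding \<mu>_def by (rule nn_integral_restrict_space) (use sN sb(2) spN in simp)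
    also have "\<dots> = (\<integral>\<^sup>+ p. \<phi> p \<partial>N)"
    proof (rule nn_integral_cong_AE)
      show "AE p in N. \<phi> p * indicator ({0..T} \<times> D) p = \<phi> p"
        using sN sb(2) spN N0 by (intro AE_I[of _ _ "- ({0..T} \<times> D)"]) (auto simp: indicator_def)
    qed
    finally show ?thesis using nnN[OF \<phi>] by simp
  qed
  have enc1: "AE t in lborel. t \<in> {0..T} \<longrightarrow> emeasure (m t) (D \<times> A) \<le> 1 \<and>
      (\<forall>\<phi>\<in>borel_measurable borel. (\<integral>\<^sup>+ p. \<phi> p \<partial>K t) =
        (\<integral>\<^sup>+ p. \<phi> p \<partial>m t) + (1 - emeasure (m t) (D \<times> A)) * \<phi> dead)"
    using supp1
  proof eventually_elim
    case (elim t)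
    show ?case
    proof (intro impI conjI ballI le1)
      assume t: "t \<in> {0..T}"
      interpret prob_space "K t" by (rule Kt(1))
      have db: "{dead} \<in> sets (K t)" by (simp add: Kt)
      have null: "emeasure (K t) (- (D \<times> A \<union> {dead})) = 0" by (rule mp[OF elim t])
      have ae: "AE p in K t. p \<in> D \<times> A \<union> {dead}"
        using null sb(1) by (intro AE_I[of _ _ "- (D \<times> A \<union> {dead})"]) (auto simp: Kt)
      \<comment> \<open>The two pieces are disjoint and carry the full mass, so the atom at
        \<open>dead\<close> has exactly the mass missing from \<open>m t\<close>.\<close>
      have "1 = emeasure (K t) (D \<times> A \<union> {dead})"
        using ae sb(1) by (subst emeasure_eq_1_AE) (auto simp: Kt)
      also have "\<dots> = emeasure (K t) (D \<times> A) + emeasure (K t) {dead}"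
        using sb(1) dead_notin by (intro plus_emeasure[symmetric]) (auto simp: Kt)
      finally have one: "1 = emeasure (m t) (D \<times> A) + emeasure (K t) {dead}" by (simp add: em[OF DAs])
      then have dd: "emeasure (K t) {dead} = 1 - emeasure (m t) (D \<times> A)"
        using le1[of t] by (metis ennreal_add_diff_cancel_left ennreal_one_neq_top neq_top_trans)
      fix \<phi> :: "real \<times> real \<Rightarrow> ennreal" assume \<phi>: "\<phi> \<in> borel_measurable borel"
      have \<phi>K: "\<phi> \<in> borel_measurable (K t)" using \<phi> by (simp cong: measurable_cong_sets add: Kt)
      have "(\<integral>\<^sup>+ p. \<phi> p \<partial>K t) = (\<integral>\<^sup>+ p. \<phi> p * indicator (D \<times> A) p + \<phi> dead * indicator {dead} p \<partial>K t)"
      proof (rule nn_integral_cong_AE)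
        show "AE p in K t. \<phi> p = \<phi> p * indicator (D \<times> A) p + \<phi> dead * indicator {dead} p"
          using ae by eventually_elim (use dead_notin in \<open>auto simp: indicator_def\<close>)
      qed
      also have "\<dots> = (\<integral>\<^sup>+ p. \<phi> p * indicator (D \<times> A) p \<partial>K t) + (\<integral>\<^sup>+ p. \<phi> dead * indicator {dead} p \<partial>K t)"
        using \<phi>K sb(1) db
        by (intro nn_integral_add borel_measurable_times_ennreal borel_measurable_indicator) (simp_all add: Kt(2))
      also have "(\<integral>\<^sup>+ p. \<phi> p * indicator (D \<times> A) p \<partial>K t) = (\<integral>\<^sup>+ p. \<phi> p \<partial>m t)"
        unfolding m_def by (rule nn_integral_restrict_space[symmetric]) (simp add: Kt sb)
      also have "(\<integral>\<^sup>+ p. \<phi> dead * indicator {dead} p \<partial>K t) = (1 - emeasure (m t) (D \<times> A)) * \<phi> dead"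
        using db by (simp add: nn_integral_cmult_indicator dd mult.commute)
      finally show "(\<integral>\<^sup>+ p. \<phi> p \<partial>K t) = (\<integral>\<^sup>+ p. \<phi> p \<partial>m t) + (1 - emeasure (m t) (D \<times> A)) * \<phi> dead" .
    qed
  qed
  have "encodes K \<mu> m" unfolding encodes_def using enc1 enc2 by blast
  with \<mu>P mV show ?thesis by blast
qed

end

section \<open>Test functions\<close>

text \<open>No point of the closure of an open set is isolated in it. Derivatives relative to
  \<open>D\<close> are therefore unique, also at the boundary, and \<open>vector_derivative\<close>
  computes them.\<close>

lemma at_within_closure_open_ne_bot:
  fixes x :: real
  assumes "open S" "x \<in> closure S"
  shows "at x within closure S \<noteq> bot"
proof -
  have "x islimpt S"
    using assms by (cases "x \<in> S") (auto simp: closure_def interior_open intro: interior_limit_point)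
  then have "x islimpt closure S" by (rule islimpt_subset[OF _ closure_subset])
  then show ?thesis by (simp add: trivial_limit_within)
qed

text \<open>Continuous tests approximate indicators of open sets from below, and outer regularity
  passes from open sets to \<open>E\<close>, where \<open>g\<close> exceeds 1. There the integral of
  \<open>g\<close> is at most the finite measure of \<open>E\<close>; cancelling it makes the
  integral of \<open>g - 1\<close> over \<open>E\<close> vanish.\<close>

lemma AE_le_1_of_continuous_tests:
  fixes g :: "real \<Rightarrow> ennreal"
  assumes [measurable]: "g \<in> borel_measurable borel"
    and test: "\<And>\<phi> :: real \<Rightarrow> real. continuous_on UNIV \<phi> \<Longrightarrow> (\<And>t. 0 \<le> \<phi> t \<and> \<phi> t \<le> 1) \<Longrightarrow>
      (\<integral>\<^sup>+ t\<in>{0..T}. ennreal (\<phi> t) * g t \<partial>lborel) \<le> (\<integral>\<^sup>+ t\<in>{0..T}. ennreal (\<phi> t) \<partial>lborel)"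
  shows "AE t in lborel. t \<in> {0..T} \<longrightarrow> g t \<le> 1"
proof -
  have open_le: "(\<integral>\<^sup>+ t\<in>{0..T}. indicator U t * g t \<partial>lborel) \<le> emeasure lborel U"
    if U: "open U" "- U \<noteq> {}" for U :: "real set"
  proof -
    \<comment> \<open>Zero off \<open>U\<close> and eventually 1 at each point of \<open>U\<close>.
      Since \<open>infdist\<close> to the empty set is 0, this relies on the complement of
      \<open>U\<close> being nonempty.\<close>
    define \<phi> where "\<phi> j t = min 1 (real j * infdist t (- U))" for j t
    have cont: "continuous_on UNIV (\<phi> j)" for j
      unfolding \<phi>_def by (intro continuous_intros)
    have [measurable]: "\<phi> j \<in> borel_measurable borel" for j
      by (rule borel_measurable_continuous_onI[OF cont])
    have b: "0 \<le> \<phi> j t \<and> \<phi> j t \<le> 1" for j t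
      by (simp add: \<phi>_def infdist_nonneg)
    have off: "\<phi> j t = 0" if "t \<notin> U" for j t
      using that infdist_zero[of t "- U"] by (simp add: \<phi>_def)
    have ev: "\<forall>\<^sub>F j in sequentially. \<phi> j t = 1" if "t \<in> U" for t
    proof -
      have "infdist t (- U) \<noteq> 0"
        using in_closed_iff_infdist_zero[of "- U" t] U \<open>t \<in> U\<close> by (auto simp: closed_Compl)
      then have pos: "infdist t (- U) > 0" using infdist_nonneg[of t "- U"] by simp
      obtain n where n: "1 < real n * infdist t (- U)" using reals_Archimedean3[OF pos] by blast
      have "\<phi> j t = 1" if "j \<ge> n" for j
      proof -
        have "real n * infdist t (- U) \<le> real j * infdist t (- U)"
          using that pos by (intro mult_right_mono) auto
        with n show ?thesis by (simp add: \<phi>_def)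
      qed
      then show ?thesis by (auto simp: eventually_sequentially)
    qed
    have "(\<integral>\<^sup>+ t\<in>{0..T}. indicator U t * g t \<partial>lborel) \<le>
      (\<integral>\<^sup>+ t. liminf (\<lambda>j. (ennreal (\<phi> j t) * g t) * indicator {0..T} t) \<partial>lborel)"
    proof (rule nn_integral_mono)
      fix t
      show "indicator U t * g t * indicator {0..T} t \<le> liminf (\<lambda>j. (ennreal (\<phi> j t) * g t) * indicator {0..T} t)"
      proof (cases "t \<in> U")
        case True
        have "\<forall>\<^sub>F j in sequentially. \<phi> j t = 1" by (rule ev[OF True])
        then have "\<forall>\<^sub>F j in sequentially. (ennreal (\<phi> j t) * g t) * indicator {0..T} t = g t * indicator {0..T} t"
          by eventually_elim simp
        then have "(\<lambda>j. (ennreal (\<phi> j t) * g t) * indicator {0..T} t) \<longlonglongrightarrow> g t * indicator {0..T} t"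
          by (rule tendsto_eventually)
        then have "liminf (\<lambda>j. (ennreal (\<phi> j t) * g t) * indicator {0..T} t) = g t * indicator {0..T} t"
          by (rule lim_imp_Liminf[OF sequentially_bot])
        moreover have "indicator U t * g t = g t" using True by simp
        ultimately show ?thesis by (simp only: order_refl)
      qed simp
    qed
    also have "\<dots> \<le> liminf (\<lambda>j. \<integral>\<^sup>+ t\<in>{0..T}. ennreal (\<phi> j t) * g t \<partial>lborel)"
      by (rule nn_integral_liminf) measurable
    also have "\<dots> \<le> liminf (\<lambda>j. emeasure lborel U)"
    proof (intro Liminf_mono always_eventually allI)
      fix j
      have "(\<integral>\<^sup>+ t\<in>{0..T}. ennreal (\<phi> j t) * g t \<partial>lborel) \<le> (\<integral>\<^sup>+ t\<in>{0..T}. ennreal (\<phi> j t) \<partial>lborel)"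
        by (rule test[OF cont b])
      also have "\<dots> \<le> (\<integral>\<^sup>+ t. indicator U t \<partial>lborel)"
      proof (rule nn_integral_mono)
        fix t show "ennreal (\<phi> j t) * indicator {0..T} t \<le> indicator U t"
          using b[of j t] off[of t j] by (cases "t \<in> U"; cases "t \<in> {0..T}") auto
      qed
      also have "\<dots> = emeasure lborel U" using U by simp
      finally show "(\<integral>\<^sup>+ t\<in>{0..T}. ennreal (\<phi> j t) * g t \<partial>lborel) \<le> emeasure lborel U" .
    qed
    finally show ?thesis by (simp add: Liminf_const)
  qed
  define E where "E = {t\<in>{0..T}. 1 < g t}"
  have [measurable]: "E \<in> sets borel" unfolding E_def by measurable
  have Efin: "emeasure lborel E < \<top>"
  proof -
    have "emeasure lborel E \<le> emeasure lborel {0..T}" by (rule emeasure_mono) (auto simp: E_def)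
    also have "\<dots> < \<top>" by (cases "0 \<le> T") auto
    finally show ?thesis .
  qed
  have "(\<integral>\<^sup>+ t\<in>E. g t \<partial>lborel) \<le> emeasure lborel E + ennreal \<epsilon>" if "\<epsilon> > 0" for \<epsilon>
  proof -
    obtain V where V: "open V" "E \<subseteq> V" "emeasure lborel (V - E) < \<epsilon>"
      using outer_regular_lborel[of E \<epsilon>] \<open>\<epsilon> > 0\<close> by auto
    \<comment> \<open>Cutting to a bounded interval makes the complement nonempty and still contains
      \<open>E\<close>, which lies in \<open>{0..T}\<close>.\<close>
    define U where "U = V \<inter> {-1<..<T+1}"
    have U: "open U" "- U \<noteq> {}" "E \<subseteq> U" using V by (auto simp: U_def E_def)
    have "(\<integral>\<^sup>+ t\<in>E. g t \<partial>lborel) \<le> (\<integral>\<^sup>+ t\<in>{0..T}. indicator U t * g t \<partial>lborel)"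
      using U(3) by (intro nn_integral_mono) (auto simp: indicator_def E_def)
    also have "\<dots> \<le> emeasure lborel U" by (rule open_le[OF U(1,2)])
    also have "\<dots> \<le> emeasure lborel (E \<union> (V - E))" using V(1) by (intro emeasure_mono) (auto simp: U_def)
    also have "\<dots> \<le> emeasure lborel E + emeasure lborel (V - E)" using V(1) by (intro emeasure_subadditive) auto
    also have "\<dots> \<le> emeasure lborel E + ennreal \<epsilon>" using V(3) by (intro add_left_mono) simp
    finally show ?thesis .
  qed
  then have le: "(\<integral>\<^sup>+ t\<in>E. g t \<partial>lborel) \<le> emeasure lborel E" by (rule ennreal_le_epsilon)
  have "(\<integral>\<^sup>+ t\<in>E. g t \<partial>lborel) = (\<integral>\<^sup>+ t. indicator E t + (g t - 1) * indicator E t \<partial>lborel)"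
    by (rule nn_integral_cong) (auto simp: indicator_def E_def add_diff_inverse_ennreal less_imp_le)
  also have "\<dots> = emeasure lborel E + (\<integral>\<^sup>+ t\<in>E. (g t - 1) \<partial>lborel)"
    by (subst nn_integral_add) auto
  finally have "emeasure lborel E + (\<integral>\<^sup>+ t\<in>E. (g t - 1) \<partial>lborel) \<le> emeasure lborel E + 0" using le by simp
  then have "(\<integral>\<^sup>+ t\<in>E. (g t - 1) \<partial>lborel) \<le> 0"
    using Efin by (subst (asm) ennreal_add_left_cancel_le) auto
  then have "AE t in lborel. (g t - 1) * indicator E t = 0"
    by (subst (asm) le_zero_eq, subst (asm) nn_integral_0_iff_AE) auto
  then show ?thesis
  proof eventually_elim
    case (elim t)
    show ?case
    proof (intro impI leI notI)
      assume t: "t \<in> {0..T}" "1 < g t"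
      then have "g t - 1 = 0" using elim by (simp add: E_def)
      then have "g t \<le> 1" by (simp add: diff_eq_0_iff_ennreal split: if_splits) 
      with t show False by simp
    qed
  qed
qed

section \<open>Test functions of product form, their drift and the mass bound\<close>

locale lp_control = lp_encoding +
  fixes \<O> :: "real set" and b \<sigma> :: "real \<Rightarrow> real \<Rightarrow> real \<Rightarrow> real" and m0 :: "real measure"
  assumes D_def: "D = closure \<O>" and O_open: "open \<O>"
    and b_S: "b \<in> S_functions T D A" and \<sigma>_S: "\<sigma> \<in> S_functions T D A"
    and m0: "m0 \<in> borel_probs \<O>"
begin

lemma D_ne_bot: "x \<in> D \<Longrightarrow> at x within D \<noteq> bot"
  unfolding D_def by (rule at_within_closure_open_ne_bot[OF O_open])

lemma Cb_product:
  assumes V: "continuous_on {0..T} V" and \<eta>: "continuous_on UNIV \<eta>" "\<And>x. \<bar>\<eta> x\<bar> \<le> c"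
    and F: "\<And>t x. t \<in> {0..T} \<Longrightarrow> x \<in> D \<Longrightarrow> F t x = V t * \<eta> x"
  shows "(\<lambda>(t, x). F t x) \<in> Cb ({0..T} \<times> D)"
proof -
  have "continuous_on ({0..T} \<times> D) (\<lambda>p. V (fst p) * \<eta> (snd p))"
    by (intro continuous_intros continuous_on_compose2[OF V] continuous_on_compose2[OF \<eta>(1)]) auto
  then have 1: "continuous_on ({0..T} \<times> D) (\<lambda>(t, x). F t x)"
    by (rule continuous_on_cong[THEN iffD1, rotated 2]) (auto simp: F)
  have "bounded (V ` {0..T})" by (intro compact_imp_bounded compact_continuous_image V) simp
  then obtain v where "\<forall>y\<in>V ` {0..T}. norm y \<le> v" unfolding bounded_iff by blast
  then have v: "\<bar>V t\<bar> \<le> v" if "t \<in> {0..T}" for t using that by simp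
  have "\<bar>F t x\<bar> \<le> v * c" if "t \<in> {0..T}" "x \<in> D" for t x
  proof -
    have "\<bar>V t\<bar> * \<bar>\<eta> x\<bar> \<le> v * c"
      by (rule mult_mono) (use v[OF that(1)] \<eta>(2)[of x] in auto)
    then show ?thesis by (simp only: F[OF that] abs_mult)
  qed
  then have "bounded_fun_on ({0..T} \<times> D) (\<lambda>(t, x). F t x)"
    unfolding bounded_fun_on_def by (intro exI[of _ "v * c"]) auto
  with 1 show ?thesis by (simp add: Cb_def)
qed

text \<open>Separated variables cover every test function constructed explicitly later: functions of
  time alone, the zero function and the bumps used for tightness.\<close>

lemma product_test_function:
  assumes U: "\<And>t. t \<in> {0..T} \<Longrightarrow> (U has_vector_derivative U' t) (at t within {0..T})"
    and U': "continuous_on {0..T} U'"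
    and \<psi>: "\<And>x. (\<psi> has_real_derivative \<psi>' x) (at x)" "\<And>x. (\<psi>' has_real_derivative \<psi>'' x) (at x)"
    and \<psi>'': "continuous_on UNIV \<psi>''"
    and c: "\<And>x. \<bar>\<psi> x\<bar> \<le> c" "\<And>x. \<bar>\<psi>' x\<bar> \<le> c" "\<And>x. \<bar>\<psi>'' x\<bar> \<le> c"
  shows "(\<lambda>t x. U t * \<psi> x) \<in> Cb12 T D"
    and "\<And>t x. t \<in> {0..T} \<Longrightarrow> x \<in> D \<Longrightarrow> partial_t T (\<lambda>t x. U t * \<psi> x) t x = U' t * \<psi> x"
    and "\<And>t x. t \<in> {0..T} \<Longrightarrow> x \<in> D \<Longrightarrow> partial_x D (\<lambda>t x. U t * \<psi> x) t x = U t * \<psi>' x"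
    and "\<And>t x. t \<in> {0..T} \<Longrightarrow> x \<in> D \<Longrightarrow> partial_x D (partial_x D (\<lambda>t x. U t * \<psi> x)) t x = U t * \<psi>'' x"
proof -
  let ?u = "\<lambda>t x. U t * \<psi> x"
  have dt: "((\<lambda>s. ?u s x) has_vector_derivative U' t * \<psi> x) (at t within {0..T})" if "t \<in> {0..T}" for t x
    by (rule has_vector_derivative_mult_left[OF U[OF that]])
  have dx: "((\<lambda>y. U t * \<eta> y) has_vector_derivative U t * \<eta>' x) (at x within D)"
    if "\<And>x. (\<eta> has_real_derivative \<eta>' x) (at x)" for \<eta> \<eta>' t x
    by (rule has_vector_derivative_mult_right[OF has_vector_derivative_at_within
        [OF that[unfolded has_real_derivative_iff_has_vector_derivative]]])
  show pt: "partial_t T ?u t x = U' t * \<psi> x" if "t \<in> {0..T}" "x \<in> D" for t x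
    unfolding partial_t_def by (rule vector_derivative_within_closed_interval[OF T_pos that(1) dt[OF that(1)]])
  show px: "partial_x D ?u t x = U t * \<psi>' x" if "t \<in> {0..T}" "x \<in> D" for t x
    unfolding partial_x_def by (rule vector_derivative_within[OF D_ne_bot[OF that(2)] dx[OF \<psi>(1)]])
  \<comment> \<open>\<open>partial_x D\<close> is known to equal \<open>U t * \<psi>'\<close> on
    \<open>D\<close> only, so the second derivative is taken by transformation within
    \<open>D\<close>.\<close>
  have dpx: "((\<lambda>y. partial_x D ?u t y) has_vector_derivative U t * \<psi>'' x) (at x within D)"
    if "t \<in> {0..T}" "x \<in> D" for t x
    by (rule has_vector_derivative_transform[OF that(2) px[OF that(1)] dx[OF \<psi>(2)]])
  show pxx: "partial_x D (partial_x D ?u) t x = U t * \<psi>'' x" if "t \<in> {0..T}" "x \<in> D" for t x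
    by (subst partial_x_def) (rule vector_derivative_within[OF D_ne_bot[OF that(2)] dpx[OF that]])
  have cU: "continuous_on {0..T} U"
    unfolding continuous_on_eq_continuous_within by (intro ballI has_vector_derivative_continuous[OF U])
  have c\<psi>: "continuous_on UNIV \<psi>" "continuous_on UNIV \<psi>'"
    by (intro continuous_at_imp_continuous_on ballI DERIV_isCont[OF \<psi>(1)],
        intro continuous_at_imp_continuous_on ballI DERIV_isCont[OF \<psi>(2)])
  show "?u \<in> Cb12 T D"
    unfolding Cb12_def mem_Collect_eq
  proof (intro conjI ballI)
    fix t x assume tx: "t \<in> {0..T}" "x \<in> D"
    show "(\<lambda>s. ?u s x) differentiable (at t within {0..T})" by (rule differentiableI_vector[OF dt[OF tx(1)]])
    show "(\<lambda>y. ?u t y) differentiable (at x within D)" by (rule differentiableI_vector[OF dx[OF \<psi>(1)]])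
    show "(\<lambda>y. partial_x D ?u t y) differentiable (at x within D)" by (rule differentiableI_vector[OF dpx[OF tx]])
  next
    show "(\<lambda>(t, x). ?u t x) \<in> Cb ({0..T} \<times> D)" by (rule Cb_product[OF cU c\<psi>(1) c(1)]) simp
    show "(\<lambda>(t, x). partial_t T ?u t x) \<in> Cb ({0..T} \<times> D)" by (rule Cb_product[OF U' c\<psi>(1) c(1) pt])
    show "(\<lambda>(t, x). partial_x D ?u t x) \<in> Cb ({0..T} \<times> D)" by (rule Cb_product[OF cU c\<psi>(2) c(2) px])
    show "(\<lambda>(t, x). partial_x D (partial_x D ?u) t x) \<in> Cb ({0..T} \<times> D)"
      by (rule Cb_product[OF cU \<psi>'' c(3) pxx])
  qed
qed

definition drift :: "(real \<Rightarrow> real \<Rightarrow> real) \<Rightarrow> real \<Rightarrow> real \<Rightarrow> real \<Rightarrow> real" where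
  "drift u t x a = partial_t T u t x + generator D b \<sigma> u t x a"

lemma S_functions_D:
  assumes "h \<in> S_functions T D A"
  shows "(\<lambda>z. h (fst z) (fst (snd z)) (snd (snd z))) \<in> borel_measurable (restrict_space borel ({0..T} \<times> D \<times> A))"
    and "\<exists>C\<ge>0. \<forall>t\<in>{0..T}. \<forall>x\<in>D. \<forall>a\<in>A. \<bar>h t x a\<bar> \<le> C"
    and "t \<in> {0..T} \<Longrightarrow> continuous_on (D \<times> A) (\<lambda>z. h t (fst z) (snd z))"
proof -
  show "(\<lambda>z. h (fst z) (fst (snd z)) (snd (snd z))) \<in> borel_measurable (restrict_space borel ({0..T} \<times> D \<times> A))"
    using assms by (simp add: S_functions_def case_prod_beta')
  obtain C where C: "\<forall>t\<in>{0..T}. \<forall>x\<in>D. \<forall>a\<in>A. \<bar>h t x a\<bar> \<le> C"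
    using assms by (auto simp: S_functions_def bounded_fun_on_def)
  then have "\<forall>t\<in>{0..T}. \<forall>x\<in>D. \<forall>a\<in>A. \<bar>h t x a\<bar> \<le> max 0 C" by fastforce
  then show "\<exists>C\<ge>0. \<forall>t\<in>{0..T}. \<forall>x\<in>D. \<forall>a\<in>A. \<bar>h t x a\<bar> \<le> C" by (intro exI[of _ "max 0 C"]) simp
  show "t \<in> {0..T} \<Longrightarrow> continuous_on (D \<times> A) (\<lambda>z. h t (fst z) (snd z))"
    using assms by (simp add: S_functions_def case_prod_beta')
qed

lemma drift_regular:
  assumes u: "u \<in> Cb12 T D"
  shows "(\<lambda>z. drift u (fst z) (fst (snd z)) (snd (snd z))) \<in> borel_measurable (restrict_space borel ({0..T} \<times> D \<times> A))"
    and "t \<in> {0..T} \<Longrightarrow> continuous_on (D \<times> A) (\<lambda>z. drift u t (fst z) (snd z))"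
    and "\<exists>N\<ge>0. (\<forall>t\<in>{0..T}. \<forall>x\<in>D. \<forall>a\<in>A. \<bar>drift u t x a\<bar> \<le> N) \<and> (\<forall>t\<in>{0..T}. \<forall>x\<in>D. \<bar>u t x\<bar> \<le> N)"
proof -
  let ?S = "{0..T} \<times> D \<times> A"
  have c: "continuous_on ({0..T} \<times> D) (\<lambda>z. partial_t T u (fst z) (snd z))"
    "continuous_on ({0..T} \<times> D) (\<lambda>z. partial_x D u (fst z) (snd z))"
    "continuous_on ({0..T} \<times> D) (\<lambda>z. partial_x D (partial_x D u) (fst z) (snd z))"
    using u by (auto simp: Cb12_def Cb_def case_prod_beta')
  have m: "(\<lambda>z. F (fst z) (fst (snd z))) \<in> borel_measurable (restrict_space borel ?S)"
    if "continuous_on ({0..T} \<times> D) (\<lambda>z. F (fst z) (snd z))" for F :: "real \<Rightarrow> real \<Rightarrow> real"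
  proof (rule borel_measurable_continuous_on_restrict)
    have "continuous_on ?S (\<lambda>z. (fst z, fst (snd z)))" by (intro continuous_intros)
    then show "continuous_on ?S (\<lambda>z. F (fst z) (fst (snd z)))"
      by (rule continuous_on_compose2[OF that, of ?S "\<lambda>z. (fst z, fst (snd z))", simplified]) auto
  qed
  have k: "continuous_on (D \<times> A) (\<lambda>z. F t (fst z))"
    if "continuous_on ({0..T} \<times> D) (\<lambda>z. F (fst z) (snd z))" "t \<in> {0..T}" for F :: "real \<Rightarrow> real \<Rightarrow> real" and t
  proof -
    have "continuous_on (D \<times> A) (\<lambda>z. (t, fst z))" by (intro continuous_intros)
    then show ?thesis
      by (rule continuous_on_compose2[OF that(1), of "D \<times> A" "\<lambda>z. (t, fst z)", simplified]) (use that(2) in auto)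
  qed
  note Sb = S_functions_D[OF b_S] and Ss = S_functions_D[OF \<sigma>_S]
  show "(\<lambda>z. drift u (fst z) (fst (snd z)) (snd (snd z))) \<in> borel_measurable (restrict_space borel ?S)"
    unfolding drift_def generator_def
    by (intro borel_measurable_add borel_measurable_times borel_measurable_divide borel_measurable_power
      borel_measurable_const m c Sb(1) Ss(1))
  show "continuous_on (D \<times> A) (\<lambda>z. drift u t (fst z) (snd z))" if "t \<in> {0..T}"
    unfolding drift_def generator_def
    by (intro continuous_intros k c Sb(3) Ss(3) that) simp
  obtain B1 where B1: "0 \<le> B1" "\<And>t x a. t \<in> {0..T} \<Longrightarrow> x \<in> D \<Longrightarrow> a \<in> A \<Longrightarrow> \<bar>b t x a\<bar> \<le> B1" using Sb(2) by blast
  obtain B2 where B2: "0 \<le> B2" "\<And>t x a. t \<in> {0..T} \<Longrightarrow> x \<in> D \<Longrightarrow> a \<in> A \<Longrightarrow> \<bar>\<sigma> t x a\<bar> \<le> B2" using Ss(2) by blast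
  have "\<exists>C. \<forall>t\<in>{0..T}. \<forall>x\<in>D. \<bar>F t x\<bar> \<le> C" if "(\<lambda>(t, x). F t x) \<in> Cb ({0..T} \<times> D)" for F
    using that by (auto simp: Cb_def bounded_fun_on_def)
  note bound = this
  have "(\<lambda>(t, x). u t x) \<in> Cb ({0..T} \<times> D)" "(\<lambda>(t, x). partial_t T u t x) \<in> Cb ({0..T} \<times> D)"
    "(\<lambda>(t, x). partial_x D u t x) \<in> Cb ({0..T} \<times> D)"
    "(\<lambda>(t, x). partial_x D (partial_x D u) t x) \<in> Cb ({0..T} \<times> D)"
    using u by (simp_all add: Cb12_def)
  from this[THEN bound] obtain C0 C1 C2 C3 where C: "\<forall>t\<in>{0..T}. \<forall>x\<in>D. \<bar>u t x\<bar> \<le> C0"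
    "\<forall>t\<in>{0..T}. \<forall>x\<in>D. \<bar>partial_t T u t x\<bar> \<le> C1" "\<forall>t\<in>{0..T}. \<forall>x\<in>D. \<bar>partial_x D u t x\<bar> \<le> C2"
    "\<forall>t\<in>{0..T}. \<forall>x\<in>D. \<bar>partial_x D (partial_x D u) t x\<bar> \<le> C3"
    by blast
  define N where "N = max 0 (max C0 (C1 + (B1 * C2 + B2\<^sup>2 / 2 * C3)))"
  have "\<bar>drift u t x a\<bar> \<le> N" if "t \<in> {0..T}" "x \<in> D" "a \<in> A" for t x a
  proof -
    have "\<bar>b t x a * partial_x D u t x\<bar> \<le> B1 * C2"
      unfolding abs_mult using B1 C that by (intro mult_mono) auto
    moreover have "\<bar>(\<sigma> t x a)\<^sup>2 / 2 * partial_x D (partial_x D u) t x\<bar> \<le> B2\<^sup>2 / 2 * C3"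
    proof -
      have "(\<sigma> t x a)\<^sup>2 \<le> B2\<^sup>2" using B2(1) B2(2)[OF that] by (simp add: abs_le_square_iff[symmetric])
      then show ?thesis unfolding abs_mult using C that by (intro mult_mono) auto
    qed
    moreover have "\<bar>partial_t T u t x\<bar> \<le> C1" using C(2) that by blast
    ultimately have "\<bar>drift u t x a\<bar> \<le> C1 + (B1 * C2 + B2\<^sup>2 / 2 * C3)"
      unfolding drift_def generator_def by linarith
    then show ?thesis by (simp add: N_def)
  qed
  moreover have "\<bar>u t x\<bar> \<le> N" if "t \<in> {0..T}" "x \<in> D" for t x
  proof -
    have "\<bar>u t x\<bar> \<le> C0" using C(1) that by blast
    then show ?thesis unfolding N_def by linarith
  qed
  moreover have "0 \<le> N" by (simp add: N_def)
  ultimately show "\<exists>N\<ge>0. (\<forall>t\<in>{0..T}. \<forall>x\<in>D. \<forall>a\<in>A. \<bar>drift u t x a\<bar> \<le> N) \<and> (\<forall>t\<in>{0..T}. \<forall>x\<in>D. \<bar>u t x\<bar> \<le> N)"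
    by blast
qed

text \<open>One constant for both the drift and the function itself, to serve as the shift before
  and after \<open>T\<close>. Its size is irrelevant because it cancels from the constraints, hence
  an arbitrary choice.\<close>

definition test_bound :: "(real \<Rightarrow> real \<Rightarrow> real) \<Rightarrow> real" where
  "test_bound u = (SOME N. 0 \<le> N \<and> (\<forall>t\<in>{0..T}. \<forall>x\<in>D. \<forall>a\<in>A. \<bar>drift u t x a\<bar> \<le> N) \<and>
    (\<forall>t\<in>{0..T}. \<forall>x\<in>D. \<bar>u t x\<bar> \<le> N))"

lemma test_bound:
  assumes "u \<in> Cb12 T D"
  shows "0 \<le> test_bound u"
    "\<And>t x a. t \<in> {0..T} \<Longrightarrow> x \<in> D \<Longrightarrow> a \<in> A \<Longrightarrow> \<bar>drift u t x a\<bar> \<le> test_bound u"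
    "\<And>t x. t \<in> {0..T} \<Longrightarrow> x \<in> D \<Longrightarrow> \<bar>u t x\<bar> \<le> test_bound u"
  using someI_ex[OF drift_regular(3)[OF assms]] unfolding test_bound_def by blast+

lemma test_cost_data:
  assumes u: "u \<in> Cb12 T D" and s: "\<bar>s\<bar> = 1"
  shows "cost_data (test_bound u) (\<lambda>t x a. s * drift u t x a) (test_bound u) (\<lambda>t x. - s * u t x)"
  unfolding cost_data_def
proof (intro conjI ballI)
  show "(\<lambda>(t, x, a). s * drift u t x a) \<in> borel_measurable (restrict_space borel ({0..T} \<times> D \<times> A))"
    using drift_regular(1)[OF u] by (simp add: case_prod_beta')
  show "usc_on (D \<times> A) (\<lambda>(x, a). s * drift u t x a)" if "t \<in> {0..T}" for t
    unfolding case_prod_beta' by (intro continuous_on_imp_usc_on continuous_intros drift_regular(2)[OF u that])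
  show "\<bar>s * drift u t x a\<bar> \<le> test_bound u" if "t \<in> {0..T}" "x \<in> D" "a \<in> A" for t x a
    using test_bound(2)[OF u that] s by (simp add: abs_mult)
  have "continuous_on ({0..T} \<times> D) (\<lambda>z. u (fst z) (snd z))"
    using u by (simp add: Cb12_def Cb_def case_prod_beta')
  then show "usc_on ({0..T} \<times> D) (\<lambda>(t, x). - s * u t x)"
    unfolding case_prod_beta' by (intro continuous_on_imp_usc_on continuous_intros)
  show "- s * u t x \<le> test_bound u" if "t \<in> {0..T}" "x \<in> D" for t x
    using test_bound(3)[OF u that] abs_ge_self[of "- s * u t x"] s by (simp add: abs_mult)
qed (use test_bound(1)[OF u] in auto)

text \<open>For \<open>u\<close> the primitive of a continuous \<open>\<phi> \<ge> 0\<close> in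
  time, vanishing at 0, the generator drops out. The constraint equates the integral of
  \<open>\<phi>\<close> against the mass of \<open>m t\<close> with the integral of \<open>u\<close>
  against \<open>\<mu>\<close>. The latter is at most the final value of \<open>u\<close>, which is
  the Lebesgue integral of \<open>\<phi>\<close> over \<open>{0..T}\<close>.\<close>

lemma mass_le_1:
  assumes feas: "(\<mu>, m) \<in> lp_feasible T \<O> A b \<sigma> m0"
  shows "AE t in lborel. t \<in> {0..T} \<longrightarrow> emeasure (m t) (D \<times> A) \<le> 1"
proof -
  have \<mu>: "\<mu> \<in> borel_probs ({0..T} \<times> D)" and m: "m \<in> V_families T D A"
    and eq: "\<And>u. u \<in> Cb12 T D \<Longrightarrow> (LINT (t, x)|\<mu>. u t x) = (LINT x|m0. u 0 x) + occupation_integral T m (drift u)"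
    using feas unfolding lp_feasible_def D_def[symmetric] drift_def[abs_def] by auto
  interpret \<mu>: prob_space \<mu> using \<mu> by (simp add: borel_probs_def space_prob_algebra)
  have s\<mu>: "sets \<mu> = sets (restrict_space borel ({0..T} \<times> D))"
    using \<mu> by (simp add: borel_probs_def space_prob_algebra)
  have sp\<mu>: "space \<mu> = {0..T} \<times> D" using sets_eq_imp_space_eq[OF s\<mu>] by (simp add: space_restrict_space)
  let ?R = "restrict_space borel {0..T}"
  have mR: "(\<lambda>t. emeasure (m t) (D \<times> A)) \<in> borel_measurable ?R"
    using V_families_mass_measurable[OF m closed_DA, of UNIV] by simp
  define g where "g t = emeasure (m t) (D \<times> A) * indicator {0..T} t" for t
  have g[measurable]: "g \<in> borel_measurable borel"
    unfolding g_def using mR by (subst (asm) borel_measurable_restrict_space_iff_ennreal) auto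
  have gfin: "(\<integral>\<^sup>+ t. g t \<partial>lborel) < \<infinity>" using m by (simp add: V_families_def g_def)
  have fin: "g t \<noteq> \<top>" for t
    using finite_measure.emeasure_finite[OF V_families_D(1)[OF m, of t]] by (auto simp: g_def indicator_def)
  have "AE t in lborel. t \<in> {0..T} \<longrightarrow> g t \<le> 1"
  proof (rule AE_le_1_of_continuous_tests[OF g])
    fix \<phi> :: "real \<Rightarrow> real" assume cont: "continuous_on UNIV \<phi>" and \<phi>: "\<And>t. 0 \<le> \<phi> t \<and> \<phi> t \<le> 1"
    have [measurable]: "\<phi> \<in> borel_measurable borel" by (rule borel_measurable_continuous_onI[OF cont])
    have cont': "continuous_on {0..T} \<phi>" by (rule continuous_on_subset[OF cont]) simp
    define U where "U t = integral {0..t} \<phi>" for t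
    define u where "u = (\<lambda>(t::real) (x::real). U t * 1)"
    have U: "(U has_vector_derivative \<phi> t) (at t within {0..T})" if "t \<in> {0..T}" for t
      unfolding U_def by (rule integral_has_vector_derivative[OF cont' that])
    have one: "((\<lambda>x::real. 1::real) has_real_derivative (\<lambda>x. 0) x) (at x)"
      "((\<lambda>x::real. 0::real) has_real_derivative (\<lambda>x. 0) x) (at x)" for x
      by (auto intro!: derivative_eq_intros)
    have bnd: "\<bar>(\<lambda>x::real. 1::real) x\<bar> \<le> 1" "\<bar>(\<lambda>x::real. 0::real) x\<bar> \<le> 1" for x by simp_all
    note P = product_test_function[of U \<phi> "\<lambda>x. 1" "\<lambda>x. 0" "\<lambda>x. 0" 1,
      OF _ cont' one continuous_on_const bnd(1) bnd(2) bnd(2), folded u_def]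
    have dr: "drift u t x a = \<phi> t" if "t \<in> {0..T}" "x \<in> D" for t x a
      unfolding drift_def generator_def using P(2-4)[OF U that] by simp
    have U0: "u 0 x = 0" for x by (simp add: u_def U_def)
    have Umono: "U t \<le> U T" if "t \<in> {0..T}" for t
      unfolding U_def using that \<phi>
      by (intro integral_subset_le) (auto intro!: integrable_continuous_real continuous_on_subset[OF cont])
    have ig: "integrable lborel (\<lambda>t. \<phi> t * enn2real (g t))"
    proof (rule Bochner_Integration.integrable_bound)
      show "integrable lborel (\<lambda>t. enn2real (g t))"
        using gfin fin by (intro integrableI_bounded) (simp_all add: less_top)
      show "AE t in lborel. norm (\<phi> t * enn2real (g t)) \<le> norm (enn2real (g t))"
        using \<phi> by (intro AE_I2) (auto simp: abs_mult mult_left_le_one_le)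
    qed measurable
    have "occupation_integral T m (drift u) = (LINT t|lborel. \<phi> t * enn2real (g t))"
      unfolding occupation_integral_def set_lebesgue_integral_def
    proof (rule Bochner_Integration.integral_cong[OF refl])
      fix t
      show "indicat_real {0..T} t *\<^sub>R (LINT (x, a)|m t. drift u t x a) = \<phi> t * enn2real (g t)"
      proof (cases "t \<in> {0..T}")
        case True
        have "(LINT (x, a)|m t. drift u t x a) = (LINT z|m t. \<phi> t)"
          by (rule Bochner_Integration.integral_cong[OF refl]) (use dr[OF True] V_families_D(3)[OF m True] in auto)
        then show ?thesis using True V_families_D(3)[OF m True] by (simp add: g_def measure_def mult.commute)
      qed (simp add: g_def)
    qed
    then have le: "(LINT t|lborel. \<phi> t * enn2real (g t)) = (LINT (t, x)|\<mu>. u t x)"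
      using eq[OF P(1)[OF U]] by (simp add: U0)
    have "(LINT (t, x)|\<mu>. u t x) \<le> (LINT z|\<mu>. U T)"
    proof (rule integral_mono')
      show "integrable \<mu> (\<lambda>z. U T)" by simp
      show "(case z of (t, x) \<Rightarrow> u t x) \<le> U T" if "z \<in> space \<mu>" for z
        using that sp\<mu> Umono by (auto simp: u_def)
      show "0 \<le> U T" for z :: "real \<times> real"
        unfolding U_def using \<phi> by (intro integral_nonneg integrable_continuous_real cont') auto
    qed
    then have "(LINT t|lborel. \<phi> t * enn2real (g t)) \<le> U T" using le \<mu>.prob_space by simp
    then have "ennreal (LINT t|lborel. \<phi> t * enn2real (g t)) \<le> ennreal (U T)" by (rule ennreal_leI)
    also have "ennreal (LINT t|lborel. \<phi> t * enn2real (g t)) = (\<integral>\<^sup>+ t. ennreal (\<phi> t * enn2real (g t)) \<partial>lborel)"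
      using \<phi> by (intro nn_integral_eq_integral[symmetric] ig) auto
    also have "\<dots> = (\<integral>\<^sup>+ t\<in>{0..T}. ennreal (\<phi> t) * g t \<partial>lborel)"
      using \<phi> fin by (intro nn_integral_cong) (auto simp: ennreal_mult g_def less_top indicator_def)
    also have "ennreal (U T) = (\<integral>\<^sup>+ t\<in>{0..T}. ennreal (\<phi> t) \<partial>lborel)"
      unfolding U_def
      by (rule nn_integral_has_integral_lebesgue'[symmetric])
         (use \<phi> integrable_continuous_real[OF cont'] in \<open>auto intro: integrable_integral\<close>)
    finally show "(\<integral>\<^sup>+ t\<in>{0..T}. ennreal (\<phi> t) * g t \<partial>lborel) \<le> (\<integral>\<^sup>+ t\<in>{0..T}. ennreal (\<phi> t) \<partial>lborel)" .
  qed
  then show ?thesis by eventually_elim (simp add: g_def)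
qed

end

text \<open>A smooth cutoff at scale \<open>R\<close>: at least 1/2 beyond distance
  \<open>R\<close>, tending to 0 at each fixed point as \<open>R\<close> grows, and bounded with all
  the derivatives a test function needs even when \<open>D\<close> is unbounded.\<close>

definition bump :: "real \<Rightarrow> real \<Rightarrow> real" where "bump R x = x\<^sup>2 / (R\<^sup>2 + x\<^sup>2)"

definition bump' :: "real \<Rightarrow> real \<Rightarrow> real" where "bump' R x = 2 * R\<^sup>2 * x / (R\<^sup>2 + x\<^sup>2)\<^sup>2"

definition bump'' :: "real \<Rightarrow> real \<Rightarrow> real" where
  "bump'' R x = 2 * R\<^sup>2 * (R\<^sup>2 - 3 * x\<^sup>2) / (R\<^sup>2 + x\<^sup>2) ^ 3"

lemma bump_denominator_pos: "R \<ge> 1 \<Longrightarrow> 0 < R\<^sup>2 + (x::real)\<^sup>2"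
  by (intro add_pos_nonneg) auto

lemma bump_derivatives:
  assumes R: "R \<ge> 1"
  shows "(bump R has_real_derivative bump' R x) (at x)" "(bump' R has_real_derivative bump'' R x) (at x)"
    "continuous_on UNIV (bump'' R)"
proof -
  have R0: "R \<noteq> 0" using R by auto
  have p: "R\<^sup>2 + y\<^sup>2 \<noteq> 0" for y using bump_denominator_pos[OF R, of y] by (metis less_irrefl)
  have "(bump R has_real_derivative (2 * x * (R\<^sup>2 + x\<^sup>2) - x\<^sup>2 * (2 * x)) / ((R\<^sup>2 + x\<^sup>2) * (R\<^sup>2 + x\<^sup>2))) (at x)"
    unfolding bump_def[abs_def] by (auto intro!: derivative_eq_intros simp: p R0)
  also have "(2 * x * (R\<^sup>2 + x\<^sup>2) - x\<^sup>2 * (2 * x)) / ((R\<^sup>2 + x\<^sup>2) * (R\<^sup>2 + x\<^sup>2)) = bump' R x"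
    unfolding bump'_def by (simp add: power2_eq_square algebra_simps)
  finally show "(bump R has_real_derivative bump' R x) (at x)" .
  have "(bump' R has_real_derivative
      (2 * R\<^sup>2 * (R\<^sup>2 + x\<^sup>2)\<^sup>2 - 2 * R\<^sup>2 * x * (2 * (R\<^sup>2 + x\<^sup>2) * (2 * x))) / ((R\<^sup>2 + x\<^sup>2)\<^sup>2 * (R\<^sup>2 + x\<^sup>2)\<^sup>2)) (at x)"
    unfolding bump'_def[abs_def] by (auto intro!: derivative_eq_intros simp: p R0)
  also have "(2 * R\<^sup>2 * (R\<^sup>2 + x\<^sup>2)\<^sup>2 - 2 * R\<^sup>2 * x * (2 * (R\<^sup>2 + x\<^sup>2) * (2 * x))) / ((R\<^sup>2 + x\<^sup>2)\<^sup>2 * (R\<^sup>2 + x\<^sup>2)\<^sup>2)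
    = bump'' R x"
  proof -
    define d where "d = R\<^sup>2 + x\<^sup>2"
    have d: "d \<noteq> 0" using p[of x] by (simp add: d_def)
    have e1: "2 * R\<^sup>2 * d\<^sup>2 - 2 * R\<^sup>2 * x * (2 * d * (2 * x)) = d * (2 * R\<^sup>2 * (d - 4 * x\<^sup>2))"
      by (simp add: power2_eq_square algebra_simps)
    have e2: "d - 4 * x\<^sup>2 = R\<^sup>2 - 3 * x\<^sup>2" by (simp add: d_def)
    have e3: "d\<^sup>2 * d\<^sup>2 = d * d ^ 3" by (simp add: power2_eq_square power3_eq_cube)
    show ?thesis unfolding bump''_def d_def[symmetric] e1 e2 e3
      by (rule mult_divide_mult_cancel_left[OF d])
  qed
  finally show "(bump' R has_real_derivative bump'' R x) (at x)" .
  show "continuous_on UNIV (bump'' R)"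
    unfolding bump''_def[abs_def] using p by (intro continuous_intros) auto
qed

text \<open>The first derivative is controlled by
  \<open>2 * R * \<bar>x\<bar> \<le> R\<^sup>2 + x\<^sup>2\<close>, the second by
  \<open>\<bar>R\<^sup>2 - 3 * x\<^sup>2\<bar> \<le> 3 * (R\<^sup>2 + x\<^sup>2)\<close>. The latter
  decays like \<open>6 / R\<^sup>2\<close>, weakened by \<open>R \<ge> 1\<close> to
  \<open>6 / R\<close> so that both derivatives share one rate.\<close>

lemma bump_bounds:
  assumes R: "R \<ge> 1"
  shows "0 \<le> bump R x" "bump R x \<le> 1" "\<bar>bump' R x\<bar> \<le> 1 / R" "\<bar>bump'' R x\<bar> \<le> 6 / R"
    "R < \<bar>x\<bar> \<Longrightarrow> 1 / 2 \<le> bump R x"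
proof -
  define d where "d = R\<^sup>2 + x\<^sup>2"
  have d: "0 < d" using bump_denominator_pos[OF R] by (simp add: d_def)
  have R2: "R \<le> R\<^sup>2" "1 \<le> R\<^sup>2"
    using R mult_left_mono[OF R, of R] one_le_power[OF R, of 2] by (simp_all add: power2_eq_square)
  have Rd: "R\<^sup>2 \<le> d" by (simp add: d_def)
  show "0 \<le> bump R x" by (simp add: bump_def)
  show "bump R x \<le> 1" unfolding bump_def d_def[symmetric] using d by (simp add: d_def)
  have "2 * R * \<bar>x\<bar> \<le> d"
    using sum_squares_ge_zero[of "R - \<bar>x\<bar>" 0] by (simp add: d_def power2_eq_square algebra_simps)
  then have "R * (2 * R * \<bar>x\<bar>) \<le> R * d" using R by (intro mult_left_mono) auto
  then have "2 * R\<^sup>2 * \<bar>x\<bar> \<le> R * d" by (simp add: power2_eq_square algebra_simps)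
  then have "\<bar>bump' R x\<bar> \<le> R * d / d\<^sup>2"
    unfolding bump'_def d_def[symmetric] using d R by (simp add: abs_mult divide_right_mono)
  also have "\<dots> = R / d" using d by (simp add: power2_eq_square)
  also have "\<dots> \<le> R / R\<^sup>2" using Rd R2 R d by (intro divide_left_mono) auto
  also have "\<dots> = 1 / R" by (simp add: power2_eq_square)
  finally show "\<bar>bump' R x\<bar> \<le> 1 / R" .
  have "\<bar>y - 3 * z\<bar> \<le> 3 * (y + z)" if "0 \<le> y" "0 \<le> z" for y z :: real
    using that by (simp add: abs_le_iff)
  then have "\<bar>R\<^sup>2 - 3 * x\<^sup>2\<bar> \<le> 3 * d" unfolding d_def by simp
  then have "2 * R\<^sup>2 * \<bar>R\<^sup>2 - 3 * x\<^sup>2\<bar> \<le> 2 * d * (3 * d)"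
    using Rd d by (intro mult_mono) auto
  then have "\<bar>bump'' R x\<bar> \<le> 2 * d * (3 * d) / d ^ 3"
    unfolding bump''_def d_def[symmetric] using d by (simp add: abs_mult divide_right_mono)
  also have "\<dots> = 6 / d" using d by (simp add: power3_eq_cube)
  also have "\<dots> \<le> 6 / R" using Rd R2 R d by (intro divide_left_mono) auto
  finally show "\<bar>bump'' R x\<bar> \<le> 6 / R" .
  assume "R < \<bar>x\<bar>"
  then have "R\<^sup>2 \<le> x\<^sup>2" using R by (simp add: abs_le_square_iff[symmetric])
  then show "1 / 2 \<le> bump R x" unfolding bump_def using d by (simp add: d_def field_simps)
qed

section \<open>Feasibility as a family of cost inequalities\<close>

context lp_control
begin

lemma m0_D: "prob_space m0" "space m0 = \<O>" "sets m0 = sets (restrict_space borel \<O>)"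
proof -
  show "prob_space m0" and s: "sets m0 = sets (restrict_space borel \<O>)"
    using m0 by (auto simp: borel_probs_def space_prob_algebra)
  show "space m0 = \<O>" using sets_eq_imp_space_eq[OF s] by (simp add: space_restrict_space)
qed

lemma O_subset_D: "\<O> \<subseteq> D"
  by (simp add: D_def closure_subset)

definition test_cost :: "(real \<Rightarrow> real \<Rightarrow> real) \<Rightarrow> real \<Rightarrow> real \<Rightarrow> real \<times> real \<Rightarrow> ennreal" where
  "test_cost u s = enc_cost (test_bound u) (\<lambda>t x a. s * drift u t x a) (test_bound u) (\<lambda>t x. - s * u t x)"

text \<open>For the data in \<open>test_cost\<close> the value is \<open>s\<close> times the
  occupation integral of the drift minus \<open>s\<close> times the integral of \<open>u\<close>
  against \<open>\<mu>\<close>. Feasibility fixes it at \<open>-s\<close> times the initial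
  integral, and then the cost is exactly this level. The bounds for \<open>s = 1\<close> and
  \<open>s = -1\<close> are the two halves of the equality.\<close>

definition test_level :: "(real \<Rightarrow> real \<Rightarrow> real) \<Rightarrow> real \<Rightarrow> ennreal" where
  "test_level u s = ennreal (test_bound u * T + test_bound u + s * (LINT x|m0. u 0 x))"

definition admissible :: "(real \<Rightarrow> (real \<times> real) measure) set" where
  "admissible = {K \<in> clock \<rightarrow>\<^sub>M prob_algebra borel.
    \<forall>i\<in>Cb12 T D \<times> {1, -1}. kernel_cost clock (test_cost (fst i) (snd i)) K \<le> test_level (fst i) (snd i)}"

text \<open>Makes the argument of \<open>ennreal\<close> in \<open>test_level\<close> nonnegative,
  so that truncation at zero alters no constraint.\<close>

lemma initial_integral_bound:
  assumes u: "u \<in> Cb12 T D"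
  shows "\<bar>LINT x|m0. u 0 x\<bar> \<le> test_bound u"
proof -
  interpret prob_space m0 by (rule m0_D)
  have b: "\<bar>u 0 x\<bar> \<le> test_bound u" if "x \<in> space m0" for x
    using test_bound(3)[OF u, of 0 x] that O_subset_D T_pos m0_D(2) by auto
  have "\<bar>LINT x|m0. u 0 x\<bar> \<le> (LINT x|m0. \<bar>u 0 x\<bar>)" by simp
  also have "\<dots> \<le> (LINT x|m0. test_bound u)"
    by (rule integral_mono') (use b test_bound(1)[OF u] in auto)
  finally show ?thesis by (simp add: prob_space)
qed

lemma test_cost_of_encoding:
  assumes u: "u \<in> Cb12 T D" and s: "\<bar>s\<bar> = 1"
    and K: "K \<in> clock \<rightarrow>\<^sub>M prob_algebra borel"
    and \<mu>: "\<mu> \<in> borel_probs ({0..T} \<times> D)" and m: "m \<in> V_families T D A"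
    and enc: "encodes K \<mu> m"
  shows "kernel_cost clock (test_cost u s) K \<le> test_level u s \<longleftrightarrow>
    s * (LINT (t, x)|\<mu>. u t x) \<le> s * ((LINT x|m0. u 0 x) + occupation_integral T m (drift u))"
proof -
  let ?N = "test_bound u" and ?I = "LINT (t, x)|\<mu>. u t x" and ?o = "occupation_integral T m (drift u)"
  have p\<mu>: "prob_space \<mu>" and s\<mu>: "sets \<mu> = sets (restrict_space borel ({0..T} \<times> D))"
    using \<mu> by (auto simp: borel_probs_def space_prob_algebra)
  have sp\<mu>: "space \<mu> = {0..T} \<times> D" using sets_eq_imp_space_eq[OF s\<mu>] by (simp add: space_restrict_space)
  have occ: "occupation_integral T m (\<lambda>t x a. s * drift u t x a) = s * ?o"
    unfolding occupation_integral_def set_lebesgue_integral_def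
    by (simp add: case_prod_beta' mult.left_commute)
  have ext: "ext_integral \<mu> (\<lambda>(t, x). - s * u t x) = ereal (- s * ?I)"
  proof -
    have "ext_integral \<mu> (\<lambda>(t, x). - s * u t x) = ereal (LINT z|\<mu>. (\<lambda>(t, x). - s * u t x) z)"
    proof (rule ext_integral_bounded[OF p\<mu>, of _ ?N])
      have "continuous_on ({0..T} \<times> D) (\<lambda>z. u (fst z) (snd z))"
        using u by (simp add: Cb12_def Cb_def case_prod_beta')
      then have "continuous_on ({0..T} \<times> D) (\<lambda>(t, x). - s * u t x)"
        unfolding case_prod_beta' by (intro continuous_intros)
      then show "(\<lambda>(t, x). - s * u t x) \<in> borel_measurable \<mu>"
        using borel_measurable_continuous_on_restrict s\<mu> by (simp cong: measurable_cong_sets)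
      show "\<bar>(\<lambda>(t, x). - s * u t x) z\<bar> \<le> ?N" if "z \<in> space \<mu>" for z
        using that sp\<mu> test_bound(3)[OF u] s by (auto simp: abs_mult)
    qed
    also have "(LINT z|\<mu>. (\<lambda>(t, x). - s * u t x) z) = - s * ?I"
      by (simp add: case_prod_beta')
    finally show ?thesis .
  qed
  have cost: "enn2ereal (kernel_cost clock (test_cost u s) K) = ereal (?N * T + ?N - (s * ?o - s * ?I))"
    unfolding test_cost_def cost_of_encoding[OF test_cost_data[OF u s] K \<mu> m enc] occ ext by simp
  have "\<bar>s * (LINT x|m0. u 0 x)\<bar> \<le> ?N" using initial_integral_bound[OF u] s by (simp add: abs_mult)
  moreover have "0 \<le> ?N * T" using test_bound(1)[OF u] T_pos by simp
  ultimately have "0 \<le> ?N * T + ?N + s * (LINT x|m0. u 0 x)" by linarith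
  then have level: "enn2ereal (test_level u s) = ereal (?N * T + ?N + s * (LINT x|m0. u 0 x))"
    unfolding test_level_def by (simp add: enn2ereal_ennreal)
  show ?thesis
    unfolding less_eq_ennreal.rep_eq cost level by (simp add: algebra_simps)
qed

lemma feasible_encode:
  assumes feas: "(\<mu>, m) \<in> lp_feasible T \<O> A b \<sigma> m0"
  shows "\<mu> \<in> borel_probs ({0..T} \<times> D)" "m \<in> V_families T D A" "\<exists>K\<in>admissible. encodes K \<mu> m"
proof -
  show \<mu>: "\<mu> \<in> borel_probs ({0..T} \<times> D)" and m: "m \<in> V_families T D A"
    using feas unfolding lp_feasible_def D_def[symmetric] by auto
  have eq: "(LINT (t, x)|\<mu>. u t x) = (LINT x|m0. u 0 x) + occupation_integral T m (drift u)"
    if "u \<in> Cb12 T D" for u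
    using feas that unfolding lp_feasible_def D_def[symmetric] drift_def[abs_def] by auto
  obtain K where K: "K \<in> clock \<rightarrow>\<^sub>M prob_algebra borel" "encodes K \<mu> m"
    using encoding_exists[OF \<mu> m mass_le_1[OF feas]] by blast
  have "kernel_cost clock (test_cost u s) K \<le> test_level u s" if "u \<in> Cb12 T D" "s \<in> {1, -1}" for u s
  proof -
    have "\<bar>s\<bar> = 1" using that(2) by auto
    from test_cost_of_encoding[OF that(1) this K(1) \<mu> m K(2)] show ?thesis using eq[OF that(1)] by simp
  qed
  then have "K \<in> admissible" using K(1) by (auto simp: admissible_def)
  with K(2) show "\<exists>K\<in>admissible. encodes K \<mu> m" by blast
qed

lemma zero_test: "(\<lambda>t x. 0 * 1) \<in> Cb12 T D"
  by (rule product_test_function(1)[of "\<lambda>_. 0" "\<lambda>_. 0" "\<lambda>_. 1" "\<lambda>_. 0" "\<lambda>_. 0" 1])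
     (auto intro!: derivative_eq_intros)

lemma kernel_measure_space:
  assumes "K \<in> clock \<rightarrow>\<^sub>M prob_algebra borel"
  shows "prob_space (K t)" "sets (K t) = sets borel" "space (K t) = UNIV"
  using measurable_space[OF assms, of t] by (auto simp: space_prob_algebra dest: sets_eq_imp_space_eq)

lemma test_cost_lsc:
  assumes "u \<in> Cb12 T D" "\<bar>s\<bar> = 1"
  shows "lsc_integrand clock (test_cost u s)"
  unfolding test_cost_def by (rule lsc_enc_cost[OF test_cost_data[OF assms]])

lemma lsc_integrand_measurable:
  assumes w: "lsc_integrand clock w" and K: "K \<in> clock \<rightarrow>\<^sub>M prob_algebra borel"
  shows "w t \<in> borel_measurable (K t)" "(\<lambda>t. \<integral>\<^sup>+ p. w t p \<partial>K t) \<in> borel_measurable borel"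
proof -
  have "w t \<in> borel_measurable borel"
    using w unfolding lsc_integrand_def by (intro borel_measurableI_greater borel_open) auto
  then show "w t \<in> borel_measurable (K t)"
    using kernel_measure_space(2)[OF K, of t] by (simp cong: measurable_cong_sets)
  show "(\<lambda>t. \<integral>\<^sup>+ p. w t p \<partial>K t) \<in> borel_measurable borel"
    using nn_integral_measurable_subprob_algebra2[OF _ measurable_prob_algebraD[OF K], of w] w
    by (simp add: lsc_integrand_def cong: measurable_cong_sets)
qed

text \<open>The support conditions are hidden in the zero test function: its level is finite while
  its cost is \<open>\<top>\<close> off the support, so almost every \<open>K t\<close> charges only
  the support. After decoding, both signs together give back the equality for every test
  function.\<close>

lemma admissible_decode:
  assumes K: "K \<in> admissible"
  shows "\<exists>\<mu> m. (\<mu>, m) \<in> lp_feasible T \<O> A b \<sigma> m0 \<and> encodes K \<mu> m"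
proof -
  have Kk: "K \<in> clock \<rightarrow>\<^sub>M prob_algebra borel"
    and le: "\<And>u s. u \<in> Cb12 T D \<Longrightarrow> s \<in> {1, -1} \<Longrightarrow> kernel_cost clock (test_cost u s) K \<le> test_level u s"
    using K by (auto simp: admissible_def)
  let ?w = "test_cost (\<lambda>t x. 0 * 1) 1"
  have wl: "lsc_integrand clock ?w" by (rule test_cost_lsc[OF zero_test]) simp
  note ms = kernel_measure_space[OF Kk] and wm = lsc_integrand_measurable[OF wl Kk]
  have "kernel_cost clock ?w K < \<infinity>"
    using le[OF zero_test, of 1] by (auto simp: test_level_def intro: le_less_trans)
  then have "AE t in clock. (\<integral>\<^sup>+ p. ?w t p \<partial>K t) \<noteq> \<infinity>"
    unfolding kernel_cost_def using wm(2) by (intro nn_integral_noteq_infinite) (auto cong: measurable_cong_sets)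
  then have fin: "AE t in lborel. t \<in> {0..T+1} \<longrightarrow> (\<integral>\<^sup>+ p. ?w t p \<partial>K t) \<noteq> \<infinity>"
    unfolding clock_def by (subst (asm) AE_density) (auto simp: indicator_def elim!: eventually_mono)
  have null: "emeasure (K t) S = 0"
    if "(\<integral>\<^sup>+ p. ?w t p \<partial>K t) \<noteq> \<infinity>" "S \<in> sets borel" "\<And>p. p \<in> S \<Longrightarrow> ?w t p = \<top>" for t S
  proof -
    have "\<top> * emeasure (K t) S = (\<integral>\<^sup>+ p. \<top> * indicator S p \<partial>K t)"
      using that(2) ms(2)[of t] by (simp add: nn_integral_cmult_indicator)
    also have "\<dots> \<le> (\<integral>\<^sup>+ p. ?w t p \<partial>K t)"
      using that(3) by (intro nn_integral_mono) (auto simp: indicator_def)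
    finally show ?thesis using that(1) by (auto simp: ennreal_top_mult top_unique split: if_splits)
  qed
  have sb: "- (D \<times> A \<union> {dead}) \<in> sets borel" "- ({0..T} \<times> D) \<in> sets borel"
    using closed_DA closed_TD by auto
  have s1: "AE t in lborel. t \<in> {0..T} \<longrightarrow> emeasure (K t) (- (D \<times> A \<union> {dead})) = 0"
    using fin
  proof eventually_elim
    case (elim t)
    show ?case
    proof
      assume t: "t \<in> {0..T}"
      show "emeasure (K t) (- (D \<times> A \<union> {dead})) = 0"
      proof (rule null[OF _ sb(1)])
        show "(\<integral>\<^sup>+ p. ?w t p \<partial>K t) \<noteq> \<infinity>" by (rule mp[OF elim]) (use t in auto)
        show "?w t p = \<top>" if "p \<in> - (D \<times> A \<union> {dead})" for p
          using t that unfolding test_cost_def enc_cost_def by auto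
      qed
    qed
  qed
  have s2: "AE t in lborel. t \<in> {T<..T+1} \<longrightarrow> emeasure (K t) (- ({0..T} \<times> D)) = 0"
    using fin
  proof eventually_elim
    case (elim t)
    show ?case
    proof
      assume t: "t \<in> {T<..T+1}"
      show "emeasure (K t) (- ({0..T} \<times> D)) = 0"
      proof (rule null[OF _ sb(2)])
        show "(\<integral>\<^sup>+ p. ?w t p \<partial>K t) \<noteq> \<infinity>" by (rule mp[OF elim]) (use t T_pos in auto)
        show "?w t p = \<top>" if "p \<in> - ({0..T} \<times> D)" for p
          using t that unfolding test_cost_def enc_cost_def by auto
      qed
    qed
  qed
  obtain \<mu> m where \<mu>: "\<mu> \<in> borel_probs ({0..T} \<times> D)" and m: "m \<in> V_families T D A" and enc: "encodes K \<mu> m"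
    using decoding_exists[OF Kk s1 s2] by blast
  have "(LINT (t, x)|\<mu>. u t x) = (LINT x|m0. u 0 x) + occupation_integral T m (drift u)"
    if u: "u \<in> Cb12 T D" for u
    using le[OF u, of 1] le[OF u, of "-1"] test_cost_of_encoding[OF u _ Kk \<mu> m enc, of 1]
      test_cost_of_encoding[OF u _ Kk \<mu> m enc, of "-1"] by simp
  then have "(\<mu>, m) \<in> lp_feasible T \<O> A b \<sigma> m0"
    using \<mu> m unfolding lp_feasible_def D_def[symmetric] drift_def[abs_def] by auto
  with enc show ?thesis by blast
qed

text \<open>Immediate stopping: \<open>\<mu>\<close> is the law of \<open>(0, x)\<close> under
  \<open>m0\<close> and \<open>m\<close> vanishes, so both sides of the constraint are the initial
  integral.\<close>

lemma feasible_nonempty: "lp_feasible T \<O> A b \<sigma> m0 \<noteq> {}"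
proof -
  let ?R = "restrict_space borel ({0..T} \<times> D)"
  define \<mu> where "\<mu> = distr m0 ?R (\<lambda>x. (0, x))"
  define m :: "real \<Rightarrow> (real \<times> real) measure" where "m = (\<lambda>t. null_measure (restrict_space borel (D \<times> A)))"
  have meas: "(\<lambda>x. (0, x)) \<in> m0 \<rightarrow>\<^sub>M ?R"
  proof (rule measurable_restrict_space2)
    show "(\<lambda>x. (0, x)) \<in> space m0 \<rightarrow> {0..T} \<times> D" using O_subset_D T_pos m0_D(2) by auto
    have "(\<lambda>x::real. (0::real, x)) \<in> borel_measurable borel"
      by (intro borel_measurable_continuous_onI continuous_intros)
    from measurable_restrict_space1[OF this, of \<O>] show "(\<lambda>x. (0::real, x)) \<in> borel_measurable m0"
      unfolding measurable_cong_sets[OF m0_D(3) refl] .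
  qed
  have "\<mu> \<in> borel_probs ({0..T} \<times> D)"
    unfolding borel_probs_def \<mu>_def
    using prob_space.prob_space_distr[OF m0_D(1) meas] by (simp add: space_prob_algebra)
  moreover have "m \<in> V_families T D A"
    unfolding V_families_def m_def by (auto intro!: finite_measureI)
  moreover have "(LINT (t, x)|\<mu>. u t x) = (LINT x|m0. u 0 x) + occupation_integral T m h"
    if u: "u \<in> Cb12 T D" for u h
  proof -
    have "(\<lambda>(t, x). u t x) \<in> borel_measurable ?R"
      using u by (intro borel_measurable_continuous_on_restrict) (simp add: Cb12_def Cb_def)
    then have "(LINT (t, x)|\<mu>. u t x) = (LINT x|m0. u 0 x)"
      unfolding \<mu>_def by (subst integral_distr[OF meas]) simp_all
    then show ?thesis by (simp add: m_def occupation_integral_def set_lebesgue_integral_def)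
  qed
  ultimately have "(\<mu>, m) \<in> lp_feasible T \<O> A b \<sigma> m0"
    unfolding lp_feasible_def D_def[symmetric] by auto
  then show ?thesis by blast
qed

text \<open>
  The test function \<open>(1 + T - t) * bump R x\<close> controls \<open>\<mu>\<close> through its values and \<open>m\<close> through its time
  derivative \<open>- bump R x\<close>; its drift is otherwise of order \<open>1 / R\<close>.
\<close>

lemma bump_test:
  assumes R: "R \<ge> 1"
    and B1: "\<And>t x a. t \<in> {0..T} \<Longrightarrow> x \<in> D \<Longrightarrow> a \<in> A \<Longrightarrow> \<bar>b t x a\<bar> \<le> B1"
    and B2: "0 \<le> B2" "\<And>t x a. t \<in> {0..T} \<Longrightarrow> x \<in> D \<Longrightarrow> a \<in> A \<Longrightarrow> \<bar>\<sigma> t x a\<bar> \<le> B2"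
  shows "(\<lambda>t x. (1 + T - t) * bump R x) \<in> Cb12 T D"
    and "t \<in> {0..T} \<Longrightarrow> x \<in> D \<Longrightarrow> a \<in> A \<Longrightarrow>
      bump R x \<le> (1 + T) * (B1 + 3 * B2\<^sup>2) / R - drift (\<lambda>t x. (1 + T - t) * bump R x) t x a"
proof -
  let ?u = "\<lambda>t x. (1 + T - t) * bump R x"
  have U: "((\<lambda>t. 1 + T - t) has_vector_derivative (\<lambda>_. -1) t) (at t within {0..T})" for t
    by (auto intro!: derivative_eq_intros)
  have R6: "1 / R \<le> 6" "6 / R \<le> 6" "0 < R" using R by (auto simp: field_simps)
  have c: "\<bar>bump R x\<bar> \<le> 6" "\<bar>bump' R x\<bar> \<le> 6" "\<bar>bump'' R x\<bar> \<le> 6" for x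
    using bump_bounds[OF R, of x] R6 by linarith+
  note P = product_test_function[of "\<lambda>t. 1 + T - t" "\<lambda>_. -1" "bump R" "bump' R" "bump'' R" 6,
      OF U continuous_on_const bump_derivatives[OF R] c]
  show "?u \<in> Cb12 T D" by (rule P(1))
  assume t: "t \<in> {0..T}" and x: "x \<in> D" and a: "a \<in> A"
  define s where "s = (\<sigma> t x a)\<^sup>2 / 2"
  have "(\<sigma> t x a)\<^sup>2 \<le> B2\<^sup>2" using B2(1) B2(2)[OF t x a] by (simp add: abs_le_square_iff[symmetric])
  then have s: "0 \<le> s" "s \<le> B2\<^sup>2 / 2" by (simp_all add: s_def)
  have "\<bar>b t x a * bump' R x\<bar> \<le> B1 * (1 / R)"
    unfolding abs_mult using B1[OF t x a] bump_bounds(3)[OF R, of x] by (intro mult_mono) auto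
  moreover have "\<bar>s * bump'' R x\<bar> \<le> B2\<^sup>2 / 2 * (6 / R)"
    unfolding abs_mult using s bump_bounds(4)[OF R, of x] by (intro mult_mono) auto
  ultimately have "b t x a * bump' R x + s * bump'' R x \<le> (B1 + 3 * B2\<^sup>2) / R"
    by (simp add: add_divide_distrib abs_le_iff)
  then have "(1 + T - t) * (b t x a * bump' R x + s * bump'' R x) \<le> (1 + T - t) * ((B1 + 3 * B2\<^sup>2) / R)"
    using t by (intro mult_left_mono) auto
  also have "\<dots> \<le> (1 + T) * ((B1 + 3 * B2\<^sup>2) / R)"
  proof (rule mult_right_mono)
    have "0 \<le> B1" using B1[OF t x a] by linarith
    then show "0 \<le> (B1 + 3 * B2\<^sup>2) / R" using R6 by simp
  qed (use t in auto)
  also have "(1 + T - t) * (b t x a * bump' R x + s * bump'' R x) = drift ?u t x a + bump R x"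
    unfolding drift_def generator_def P(2-4)[OF t x] s_def by (simp add: field_simps)
  finally show "bump R x \<le> (1 + T) * (B1 + 3 * B2\<^sup>2) / R - drift ?u t x a" by simp
qed

section \<open>Uniform tightness of the admissible kernels\<close>

lemma AE_clock: "AE t in clock. t \<in> {0..T+1}"
  unfolding clock_def by (subst AE_density) (auto simp: indicator_def)

lemma emeasure_clock_space: "emeasure clock (space clock) = ennreal (T + 1)"
  using T_pos by (simp add: clock_def emeasure_density)

text \<open>A Markov-type inequality: up to the error \<open>\<kappa>\<close>, the cost of the bump
  exceeds the constant \<open>N\<close> by at least half the indicator of the tail, and integrating
  over the clock compares this with the level. \<open>Q\<close> bounds the coordinate that is not
  spatial, the control before \<open>T\<close> and the time afterwards, so a norm above
  \<open>R + Q\<close> forces the spatial coordinate beyond \<open>R\<close>.\<close>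

lemma admissible_tail:
  assumes R: "R \<ge> 1" and \<kappa>: "0 \<le> \<kappa>"
    and K: "K \<in> admissible"
    and u: "(\<lambda>t x. (1 + T - t) * bump R x) \<in> Cb12 T D"
    and dr: "\<And>t x a. t \<in> {0..T} \<Longrightarrow> x \<in> D \<Longrightarrow> a \<in> A \<Longrightarrow>
      bump R x \<le> \<kappa> - drift (\<lambda>t x. (1 + T - t) * bump R x) t x a"
    and Q: "\<And>a. a \<in> insert a0 A \<Longrightarrow> \<bar>a\<bar> \<le> Q" "T \<le> Q"
  shows "(\<integral>\<^sup>+ t. emeasure (K t) {p. R + Q < norm p} \<partial>clock)
    \<le> ennreal (2 * ((1 + T) * (LINT x|m0. bump R x) + \<kappa> * (T + 1)))"
proof -
  define u where "u = (\<lambda>t x. (1 + T - t) * bump R x)"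
  define N where "N = test_bound u"
  note u' = u[folded u_def]
  have N: "0 \<le> N" using test_bound(1)[OF u'] by (simp add: N_def)
  have Kk: "K \<in> clock \<rightarrow>\<^sub>M prob_algebra borel"
    and le: "kernel_cost clock (test_cost u 1) K \<le> test_level u 1"
    using K u' by (auto simp: admissible_def)
  note ms = kernel_measure_space[OF Kk] and wm = lsc_integrand_measurable[OF test_cost_lsc[OF u', of 1] Kk]
  let ?B = "{p::real\<times>real. R + Q < norm p}"
  have B[measurable]: "?B \<in> sets borel" by measurable
  have Kb: "(\<lambda>t. emeasure (K t) ?B) \<in> borel_measurable borel"
    using measurable_emeasure_kernel[OF measurable_prob_algebraD[OF Kk] B] by (simp cong: measurable_cong_sets)
  have far: "1 / 2 \<le> bump R x" if "R + Q < norm p" "norm p \<le> \<bar>x\<bar> + q" "q \<le> Q" for p :: "real \<times> real" and x q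
    using that by (intro bump_bounds(5)[OF R]) linarith
  have norm_le: "norm (x, y) \<le> \<bar>x\<bar> + \<bar>y\<bar>" for x y :: real
    using norm_Pair_le[of x y] by simp
  have point: "ennreal N + ennreal (1/2) * indicator ?B p \<le> test_cost u 1 t p + ennreal \<kappa>"
    if t: "t \<in> {0..T+1}" for t p
  proof -
    \<comment> \<open>Every finite branch of the cost has the form \<open>N - z\<close>:
      \<open>z\<close> is the drift on \<open>D \<times> A\<close>, 0 at \<open>dead\<close>, and
      \<open>- u\<close> after \<open>T\<close>. Here \<open>x\<close> is the spatial coordinate and
      \<open>q\<close> bounds the other one.\<close>
    have bump_case: "ennreal N + ennreal (1/2) * indicator ?B p \<le> ennreal (N - z) + ennreal \<kappa>"
      if "bump R x \<le> \<kappa> - z" "\<bar>z\<bar> \<le> N" "norm p \<le> \<bar>x\<bar> + q" "q \<le> Q" for z x q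
    proof -
      have "N + 1/2 * indicator ?B p \<le> (N - z) + \<kappa>"
        using far[OF _ that(3,4)] that(1) bump_bounds(1)[OF R, of x] by (auto simp: indicator_def)
      moreover have "ennreal N + ennreal (1/2) * indicator ?B p = ennreal (N + 1/2 * indicator ?B p)"
      proof (cases "p \<in> ?B")
        case True
        then have i: "indicator ?B p = (1 :: ennreal)" "indicator ?B p = (1 :: real)" by simp_all
        show ?thesis unfolding i mult_1_right by (rule ennreal_plus[symmetric]) (use N in auto)
      qed simp
      moreover have "ennreal (N - z) + ennreal \<kappa> = ennreal ((N - z) + \<kappa>)"
        using that(2) \<kappa> by (intro ennreal_plus[symmetric]) auto
      ultimately show ?thesis by (simp only: ennreal_leI)
    qed
    obtain x y where p: "p = (x, y)" by fastforce
    consider "t \<in> {0..T}" "p \<in> D \<times> A" | "t \<in> {0..T}" "p \<notin> D \<times> A" "p = dead"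
      | "test_cost u 1 t p = \<top>" | "t \<notin> {0..T}" "p \<in> {0..T} \<times> D"
      unfolding test_cost_def enc_cost_def by (metis (full_types))
    then show ?thesis
    proof cases
      case 1
      have "test_cost u 1 t p = ennreal (N - drift u t x y)"
        using 1 by (simp add: test_cost_def enc_cost_def p N_def)
      moreover have "x \<in> D" "y \<in> A" using 1 p by auto
      ultimately show ?thesis
        using bump_case[of x "drift u t x y" "\<bar>y\<bar>"] dr[of t x y, folded u_def] 1(1) norm_le[of x y] Q(1)[of y]
          test_bound(2)[OF u', of t x y] by (simp add: p N_def)
    next
      case 2
      have "test_cost u 1 t p = ennreal (N - 0)" using 2 dead_notin by (simp add: test_cost_def enc_cost_def N_def)
      moreover have "bump R 0 \<le> \<kappa> - 0" using \<kappa> by (simp add: bump_def)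
      ultimately show ?thesis
        using bump_case[of 0 0 "\<bar>a0\<bar>"] N norm_le[of 0 a0] Q(1)[of a0] 2(3) by (simp add: dead_def)
    next
      case 3 then show ?thesis by simp
    next
      case 4
      have xy: "x \<in> {0..T}" "y \<in> D" using 4 p by auto
      have "test_cost u 1 t p = ennreal (N - - u x y)"
        unfolding test_cost_def enc_cost_def if_not_P[OF 4(1)] using 4(2) by (simp add: p N_def)
      moreover have "bump R y \<le> \<kappa> - - u x y"
      proof -
        \<comment> \<open>Past \<open>T\<close> the first coordinate \<open>x\<close> is the time.
          The summand 1 in \<open>1 + T - x\<close> keeps the factor at least 1 up to time
          \<open>T\<close>, so \<open>\<mu>\<close> is controlled there too.\<close>
        have "1 * bump R y \<le> u x y" unfolding u_def
          by (rule mult_right_mono) (use xy bump_bounds(1)[OF R] in auto)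
        then show ?thesis using \<kappa> by simp
      qed
      moreover have "norm p \<le> \<bar>y\<bar> + \<bar>x\<bar>" "\<bar>x\<bar> \<le> Q" using norm_le[of x y] xy Q(2) by (auto simp: p)
      moreover have "\<bar>- u x y\<bar> \<le> N" using test_bound(3)[OF u' xy] by (simp add: N_def)
      ultimately show ?thesis using bump_case[of y "- u x y" "\<bar>x\<bar>"] by simp
    qed
  qed
  have inner: "ennreal N + ennreal (1/2) * emeasure (K t) ?B \<le> (\<integral>\<^sup>+ p. test_cost u 1 t p \<partial>K t) + ennreal \<kappa>"
    if t: "t \<in> {0..T+1}" for t
  proof -
    interpret prob_space "K t" by (rule ms)
    have "ennreal N + ennreal (1/2) * emeasure (K t) ?B = (\<integral>\<^sup>+ p. ennreal N + ennreal (1/2) * indicator ?B p \<partial>K t)"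
      using ms(2)[of t] B by (subst nn_integral_add) (auto simp: nn_integral_cmult_indicator emeasure_space_1)
    also have "\<dots> \<le> (\<integral>\<^sup>+ p. test_cost u 1 t p + ennreal \<kappa> \<partial>K t)"
      by (rule nn_integral_mono) (rule point[OF t])
    also have "\<dots> = (\<integral>\<^sup>+ p. test_cost u 1 t p \<partial>K t) + ennreal \<kappa>"
      using wm(1)[of t] by (subst nn_integral_add) (auto simp: emeasure_space_1)
    finally show ?thesis .
  qed
  let ?E = "\<integral>\<^sup>+ t. emeasure (K t) ?B \<partial>clock" and ?J = "LINT x|m0. bump R x"
  have cl: "F \<in> borel_measurable clock" if "F \<in> borel_measurable borel" for F :: "real \<Rightarrow> ennreal"
    using that by (simp cong: measurable_cong_sets)
  have "ennreal (N * (T + 1)) + ennreal (1/2) * ?E = (\<integral>\<^sup>+ t. ennreal N + ennreal (1/2) * emeasure (K t) ?B \<partial>clock)"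
    using cl[OF Kb] N T_pos
    by (subst nn_integral_add) (auto simp: nn_integral_cmult emeasure_clock_space[simplified] ennreal_mult)
  also have "\<dots> \<le> (\<integral>\<^sup>+ t. (\<integral>\<^sup>+ p. test_cost u 1 t p \<partial>K t) + ennreal \<kappa> \<partial>clock)"
    by (rule nn_integral_mono_AE) (use AE_clock in eventually_elim, rule inner)
  also have "\<dots> = kernel_cost clock (test_cost u 1) K + ennreal (\<kappa> * (T + 1))"
    unfolding kernel_cost_def using cl[OF wm(2)] \<kappa> T_pos
    by (subst nn_integral_add) (auto simp: emeasure_clock_space[simplified] ennreal_mult)
  also have "\<dots> \<le> test_level u 1 + ennreal (\<kappa> * (T + 1))"
    by (intro add_right_mono le)
  also have "test_level u 1 = ennreal (N * (T + 1) + (1 + T) * ?J)"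
  proof -
    have "(LINT x|m0. u 0 x) = (1 + T) * ?J" unfolding u_def by simp
    then show ?thesis unfolding test_level_def N_def[symmetric] by (simp add: algebra_simps)
  qed
  also have "\<dots> = ennreal (N * (T + 1)) + ennreal ((1 + T) * ?J)"
    using N T_pos bump_bounds(1)[OF R] by (intro ennreal_plus) auto
  also have "\<dots> + ennreal (\<kappa> * (T + 1)) = ennreal (N * (T + 1)) + ennreal ((1 + T) * ?J + \<kappa> * (T + 1))"
    using \<kappa> T_pos bump_bounds(1)[OF R] by (subst ennreal_plus) (auto simp: add.assoc)
  \<comment> \<open>\<open>N * (T + 1)\<close> stands on both sides, since the clock has length
    \<open>T + 1\<close>, and cancels; \<open>test_bound\<close> leaves no trace in the tail
    bound.\<close>
  finally have half: "ennreal (1/2) * ?E \<le> ennreal ((1 + T) * ?J + \<kappa> * (T + 1))"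
    by (subst (asm) ennreal_add_left_cancel_le) auto
  have "ennreal 2 * ennreal (1/2) = ennreal (2 * (1/2))" by (rule ennreal_mult[symmetric]) simp_all
  then have two: "ennreal 2 * ennreal (1/2) = 1" by simp
  have "?E = ennreal 2 * (ennreal (1/2) * ?E)"
    unfolding mult.assoc[symmetric] two by simp
  also have "\<dots> \<le> ennreal 2 * ennreal ((1 + T) * ?J + \<kappa> * (T + 1))"
    by (rule mult_left_mono[OF half]) simp
  also have "\<dots> = ennreal (2 * ((1 + T) * ?J + \<kappa> * (T + 1)))"
    by (rule ennreal_mult'[symmetric]) simp
  finally show ?thesis .
qed

text \<open>The tail bound is the same for all admissible kernels, and both its terms vanish as
  \<open>R\<close> grows: the initial term by dominated convergence under the single law
  \<open>m0\<close>, the drift term like \<open>1 / R\<close>.\<close>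

lemma admissible_tight:
  assumes "0 < \<epsilon>"
  shows "\<exists>R. \<forall>K\<in>admissible. (\<integral>\<^sup>+ t. emeasure (K t) {p. R < norm p} \<partial>clock) \<le> ennreal \<epsilon>"
proof -
  obtain B1 where B1: "0 \<le> B1" "\<And>t x a. t \<in> {0..T} \<Longrightarrow> x \<in> D \<Longrightarrow> a \<in> A \<Longrightarrow> \<bar>b t x a\<bar> \<le> B1"
    using S_functions_D(2)[OF b_S] by blast
  obtain B2 where B2: "0 \<le> B2" "\<And>t x a. t \<in> {0..T} \<Longrightarrow> x \<in> D \<Longrightarrow> a \<in> A \<Longrightarrow> \<bar>\<sigma> t x a\<bar> \<le> B2"
    using S_functions_D(2)[OF \<sigma>_S] by blast
  have "bounded (insert a0 A)" using compact_imp_bounded[OF A_compact] by simp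
  then obtain Q0 where Q0: "\<forall>a\<in>insert a0 A. norm a \<le> Q0" unfolding bounded_iff by blast
  define Q where "Q = max Q0 T"
  have Q: "\<bar>a\<bar> \<le> Q" if "a \<in> insert a0 A" for a
  proof -
    have "\<bar>a\<bar> \<le> Q0" using Q0 that by (metis real_norm_def)
    then show ?thesis by (simp add: Q_def)
  qed
  have QT: "T \<le> Q" by (simp add: Q_def)
  define \<kappa>0 where "\<kappa>0 = (1 + T) * (B1 + 3 * B2\<^sup>2)"
  have \<kappa>0: "0 \<le> \<kappa>0" using B1 T_pos by (simp add: \<kappa>0_def)
  define r where "r n = real (Suc n)" for n
  define e where "e n = 2 * ((1 + T) * (LINT x|m0. bump (r n) x) + \<kappa>0 / r n * (T + 1))" for n
  interpret m0: prob_space m0 by (rule m0_D)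
  have r1: "r n \<ge> 1" for n by (simp add: r_def)
  have lim_r: "filterlim r at_top sequentially"
    unfolding r_def using filterlim_real_sequentially by (rule filterlim_sequentially_Suc[THEN iffD2])
  have bump_m: "bump (r n) \<in> borel_measurable m0" for n
  proof -
    have "bump (r n) \<in> borel_measurable borel" unfolding bump_def[abs_def] by measurable
    from measurable_restrict_space1[OF this, of \<O>] show ?thesis
      unfolding measurable_cong_sets[OF m0_D(3) refl] .
  qed
  have "(\<lambda>n. LINT x|m0. bump (r n) x) \<longlonglongrightarrow> (LINT x|m0. 0)"
  proof (rule integral_dominated_convergence[where w="\<lambda>_. 1"])
    show "AE x in m0. (\<lambda>n. bump (r n) x) \<longlonglongrightarrow> 0"
    proof (intro AE_I2)
      fix x
      have "filterlim (\<lambda>n. (r n)\<^sup>2 + x\<^sup>2) at_top sequentially"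
      proof (rule filterlim_at_top_mono[OF lim_r], intro always_eventually allI)
        fix n
        have "r n \<le> (r n)\<^sup>2" using mult_left_mono[OF r1[of n], of "r n"] r1[of n] by (simp add: power2_eq_square)
        then show "r n \<le> (r n)\<^sup>2 + x\<^sup>2" using zero_le_power2[of x] by linarith
      qed
      then show "(\<lambda>n. bump (r n) x) \<longlonglongrightarrow> 0"
        unfolding bump_def by (intro real_tendsto_divide_at_top[OF tendsto_const])
    qed
    show "AE x in m0. norm (bump (r n) x) \<le> 1" for n
      using bump_bounds(1,2)[OF r1[of n]] by (intro AE_I2) simp
  qed (use bump_m in auto)
  moreover have "(\<lambda>n. \<kappa>0 / r n) \<longlonglongrightarrow> 0" by (rule real_tendsto_divide_at_top[OF tendsto_const lim_r])
  ultimately have "e \<longlonglongrightarrow> 2 * ((1 + T) * (LINT x|m0. 0) + 0 * (T + 1))"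
    unfolding e_def by (intro tendsto_intros)
  then have "e \<longlonglongrightarrow> 0" by simp
  then have "\<forall>\<^sub>F n in sequentially. e n < \<epsilon>" using assms by (rule order_tendstoD)
  then obtain n where n: "e n < \<epsilon>" by (auto simp: eventually_sequentially)
  have "(\<integral>\<^sup>+ t. emeasure (K t) {p. r n + Q < norm p} \<partial>clock) \<le> ennreal \<epsilon>" if K: "K \<in> admissible" for K
  proof -
    have "(\<integral>\<^sup>+ t. emeasure (K t) {p. r n + Q < norm p} \<partial>clock) \<le> ennreal (e n)"
      unfolding e_def
    proof (rule admissible_tail[OF r1 _ K _ _ Q QT])
      show "0 \<le> \<kappa>0 / r n" using \<kappa>0 r1[of n] by simp
      show "(\<lambda>t x. (1 + T - t) * bump (r n) x) \<in> Cb12 T D" by (rule bump_test(1)[OF r1 B1(2) B2])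
      show "bump (r n) x \<le> \<kappa>0 / r n - drift (\<lambda>t x. (1 + T - t) * bump (r n) x) t x a"
        if "t \<in> {0..T}" "x \<in> D" "a \<in> A" for t x a
        unfolding \<kappa>0_def by (rule bump_test(2)[OF r1 B1(2) B2 that])
    qed
    also have "\<dots> \<le> ennreal \<epsilon>" using n by (intro ennreal_leI) simp
    finally show ?thesis .
  qed
  then show ?thesis by blast
qed

text \<open>Every feasible pair has an admissible encoding, every admissible kernel decodes to a
  feasible pair, and along both the cost is one constant minus the value. The pair decoded from a
  cheapest kernel is therefore optimal; the correspondence need not be one to one.\<close>

theorem lp_maximum_attained:
  assumes cd: "cost_data B f C g"
  shows "\<exists>z\<in>lp_feasible T \<O> A b \<sigma> m0. \<forall>z'\<in>lp_feasible T \<O> A b \<sigma> m0. lp_value T f g z' \<le> lp_value T f g z"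
proof -
  let ?F = "lp_feasible T \<O> A b \<sigma> m0" and ?w = "enc_cost B f C g"
  have cost: "enn2ereal (kernel_cost clock ?w K) = ereal (B * T + C) - lp_value T f g (\<mu>, m)"
    if "(\<mu>, m) \<in> ?F" "K \<in> admissible" "encodes K \<mu> m" for \<mu> m K
    using cost_of_encoding[OF cd _ feasible_encode(1,2)[OF that(1)] that(3)] that(2)
    by (simp add: lp_value_def admissible_def)
  have "\<exists>K\<in>admissible. \<forall>L\<in>admissible. kernel_cost clock ?w K \<le> kernel_cost clock ?w L"
    unfolding admissible_def
  proof (rule kernel_cost_attains_minimum[OF finite_clock])
    show "{K \<in> clock \<rightarrow>\<^sub>M prob_algebra borel. \<forall>i\<in>Cb12 T D \<times> {1, -1}.
      kernel_cost clock (test_cost (fst i) (snd i)) K \<le> test_level (fst i) (snd i)} \<noteq> {}"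
      unfolding admissible_def[symmetric] using feasible_nonempty feasible_encode(3) by fastforce
    show "lsc_integrand clock (test_cost (fst i) (snd i))" if "i \<in> Cb12 T D \<times> {1, -1}" for i
      using that by (auto intro!: test_cost_lsc)
    show "lsc_integrand clock ?w" by (rule lsc_enc_cost[OF cd])
    show "\<exists>R. \<forall>K\<in>{K \<in> clock \<rightarrow>\<^sub>M prob_algebra borel. \<forall>i\<in>Cb12 T D \<times> {1, -1}.
      kernel_cost clock (test_cost (fst i) (snd i)) K \<le> test_level (fst i) (snd i)}.
      (\<integral>\<^sup>+ t. emeasure (K t) {p. R < norm p} \<partial>clock) \<le> ennreal \<epsilon>" if "0 < \<epsilon>" for \<epsilon>
      unfolding admissible_def[symmetric] by (rule admissible_tight[OF that])
  qed
  then obtain K where K: "K \<in> admissible"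
    and min: "\<And>L. L \<in> admissible \<Longrightarrow> kernel_cost clock ?w K \<le> kernel_cost clock ?w L" by blast
  obtain \<mu> m where feas: "(\<mu>, m) \<in> ?F" and enc: "encodes K \<mu> m"
    using admissible_decode[OF K] by blast
  \<comment> \<open>The cancelled constant is finite, so the step is valid also for the value
    \<open>-\<infinity>\<close>.\<close>
  have minus_le: "v' \<le> v" if "ereal c - v \<le> ereal c - v'" for c v v'
    using that by (cases v; cases v') auto
  have "lp_value T f g (\<mu>', m') \<le> lp_value T f g (\<mu>, m)" if feas': "(\<mu>', m') \<in> ?F" for \<mu>' m'
  proof -
    obtain L where L: "L \<in> admissible" "encodes L \<mu>' m'" using feasible_encode(3)[OF feas'] by blast
    have "enn2ereal (kernel_cost clock ?w K) \<le> enn2ereal (kernel_cost clock ?w L)"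
      using min[OF L(1)] by (simp add: less_eq_ennreal.rep_eq)
    then show ?thesis unfolding cost[OF feas K enc] cost[OF feas' L] by (rule minus_le)
  qed
  with feas show ?thesis by (intro bexI[of _ "(\<mu>, m)"]) auto
qed

end

theorem theorem2p13:
  fixes T :: real and \<O> A :: "real set"
    and b \<sigma> f :: "real \<Rightarrow> real \<Rightarrow> real \<Rightarrow> real"
    and g :: "real \<Rightarrow> real \<Rightarrow> real"
    and m0 :: "real measure"
  assumes "T > 0" and "open \<O>" and "compact A" and "A \<noteq> {}"
    and "(\<lambda>(t, x, a). b t x a) \<in> borel_measurable (restrict_space borel ({0..T} \<times> UNIV \<times> A))"
    and "(\<lambda>(t, x, a). \<sigma> t x a) \<in> borel_measurable (restrict_space borel ({0..T} \<times> UNIV \<times> A))"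
    and "\<forall>t\<in>{0..T}. \<forall>x. \<forall>a\<in>A. 0 \<le> \<sigma> t x a"
    and "bounded_fun_on ({0..T} \<times> UNIV \<times> A) (\<lambda>(t, x, a). b t x a)"
    and "bounded_fun_on ({0..T} \<times> UNIV \<times> A) (\<lambda>(t, x, a). \<sigma> t x a)"
    and "\<exists>L. \<forall>t\<in>{0..T}. \<forall>a\<in>A. L-lipschitz_on UNIV (\<lambda>x. b t x a)"
    and "\<exists>L. \<forall>t\<in>{0..T}. \<forall>a\<in>A. L-lipschitz_on UNIV (\<lambda>x. \<sigma> t x a)"
    and "b \<in> S_functions T (closure \<O>) A"
    and "\<sigma> \<in> S_functions T (closure \<O>) A"
    and "(\<lambda>(t, x, a). f t x a)
           \<in> borel_measurable (restrict_space borel ({0..T} \<times> closure \<O> \<times> A))"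
    and "bounded_fun_on ({0..T} \<times> closure \<O> \<times> A) (\<lambda>(t, x, a). f t x a)"
    and "\<forall>t\<in>{0..T}. usc_on (closure \<O> \<times> A) (\<lambda>(x, a). f t x a)"
    and "usc_on ({0..T} \<times> closure \<O>) (\<lambda>(t, x). g t x)"
    and "\<exists>C. \<forall>t\<in>{0..T}. \<forall>x\<in>closure \<O>. g t x \<le> C"
    and "m0 \<in> borel_probs \<O>"
    and "(\<integral>\<^sup>+ x. ennreal (ln (1 + \<bar>x\<bar>)) \<partial>m0) < \<infinity>"
  shows "\<exists>(\<mu>, m) \<in> lp_feasible T \<O> A b \<sigma> m0.
           lp_value T f g (\<mu>, m) =
             (SUP (\<mu>', m') \<in> lp_feasible T \<O> A b \<sigma> m0. lp_value T f g (\<mu>', m'))"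
proof -
  obtain q where q: "\<forall>a\<in>A. norm a \<le> q"
    using compact_imp_bounded[OF \<open>compact A\<close>] unfolding bounded_iff by blast
  \<comment> \<open>Any point off the compact set \<open>A\<close> can serve as second coordinate of
    \<open>dead\<close>.\<close>
  have "q + 1 \<notin> A" using q by force
  then interpret lp_control T "closure \<O>" A "q + 1" \<O> b \<sigma> m0
    using assms by unfold_locales auto
  obtain B where B: "\<forall>z\<in>{0..T} \<times> closure \<O> \<times> A. \<bar>(\<lambda>(t, x, a). f t x a) z\<bar> \<le> B"
    using \<open>bounded_fun_on ({0..T} \<times> closure \<O> \<times> A) (\<lambda>(t, x, a). f t x a)\<close>
    unfolding bounded_fun_on_def by blast
  \<comment> \<open>\<open>cost_data\<close> asks for nonnegative bounds, hence the maximum with 0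
    here and for \<open>g\<close>.\<close>
  have fB: "\<bar>f t x a\<bar> \<le> max 0 B" if "t \<in> {0..T}" "x \<in> closure \<O>" "a \<in> A" for t x a
    using B[rule_format, of "(t, x, a)"] that by auto
  obtain C where C: "\<forall>t\<in>{0..T}. \<forall>x\<in>closure \<O>. g t x \<le> C"
    using \<open>\<exists>C. \<forall>t\<in>{0..T}. \<forall>x\<in>closure \<O>. g t x \<le> C\<close> by blast
  have gC: "g t x \<le> max 0 C" if "t \<in> {0..T}" "x \<in> closure \<O>" for t x
    using C that by (auto intro: le_max_iff_disj[THEN iffD2])
  have "cost_data (max 0 B) f (max 0 C) g"
    unfolding cost_data_def using assms(14,16,17) fB gC by simp
  from lp_maximum_attained[OF this] obtain z where z: "z \<in> lp_feasible T \<O> A b \<sigma> m0"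
    and max: "\<And>z'. z' \<in> lp_feasible T \<O> A b \<sigma> m0 \<Longrightarrow> lp_value T f g z' \<le> lp_value T f g z"
    by blast
  have "lp_value T f g z = (SUP z'\<in>lp_feasible T \<O> A b \<sigma> m0. lp_value T f g z')"
    by (intro antisym SUP_upper SUP_least z max)
  with z show ?thesis
    by (intro bexI[of _ z]) (simp_all add: case_prod_beta')
qed

end
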